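(* Let $(H,p,D,U)$ and $(H',p',D',U')$ be oriented quantum algebras over a field $K$, and let $r\in H\otimes H'$ be such that $(H,H',p,p',r,D,U,D',U')$ is an OQA nonuple. Write $p=p_i\otimes p^i$, $p'=p'_j\otimes p'^j$, $P=p^{-1}=P_l\otimes P^l$, $P'=p'^{-1}=P'_m\otimes P'^m$, $r=r_k\otimes r^k$, $R=r^{-1}=R_n\otimes R^n$. Then $(H\otimes H',\tilde\alpha,\tilde D,\tilde U)$ is an oriented quantum algebra, where $$\tilde\alpha=r_kp_i\otimes p'_jR^n\otimes p^iR_n\otimes r^kp'^j\in (H\otimes H')\otimes(H\otimes H'),\qquad \tilde D=D\otimes D',\qquad \tilde U=U\otimes U',$$ and $$\tilde\alpha^{-1}=P_lR_n\otimes r^kP'_m\otimes r_kP^l\otimes P'^mR^n.$$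
   Context: All algebras are associative unital algebras over a field $K$; $\otimes=\otimes_K$. Summation convention: an element $r=\sum r_i\otimes r^i$ of a tensor product is written formally as a single tensor $r=r_i\otimes r^i=r_j\otimes r^j=\cdots$, different indices denoting independent copies of the sum. When several tensors occur in an expression, summation over all of the indices is understood. Oriented quantum algebra (OQA): a quadruple $(H,r,D,U)$ where $H$ is an algebra, $r=r_i\otimes r^i\in H\otimes H$ is invertible with inverse $r^{-1}=R_l\otimes R^l$, and $D,U$ are commuting algebra automorphisms of $H$, such that (1) $(D\otimes \mathrm{id}_H)(r^{-1})$ and $(\mathrm{id}_H\otimes U)(r)$ are inverse to each other in $H\otimes H^{op}$, i.e. $D(R_l)r_i\otimes U(r^i)R^l=1\otimes1=r_iD(R_l)\otimes R^lU(r^i)$; (2) $(D\otimes D)(r)=r=(U\otimes U)(r)$; (3) $r_{12}r_{13}r_{23}=r_{23}r_{13}r_{12}$ in $H\otimes H\otimes H$, i.e. $r_ir_j\otimes r^ir_k\otimes r^jr^k=r_jr_i\otimes r_kr^i\otimes r^kr^j$. OQA nonuple: $(H,H',p,p',r,D,U,D',U')$ where $H,H'$ are algebras, $p=p_i\otimes p^i\in H\otimes H$, $p'=p'_j\otimes p'^j\in H'\otimes H'$, $r=r_k\otimes r^k=r_s\otimes r^s\in H\otimes H'$ are invertible, with $r^{-1}=R_l\otimes R^l$; $D,U$ are commuting algebra automorphisms of $H$; $D',U'$ are commuting algebra automorphisms of $H'$; and (a) $D(R_l)r_k\otimes U'(r^k)R^l=1_H\otimes1_{H'}=r_kD(R_l)\otimes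 R^lU'(r^k)$; (b) $(D\otimes D')(r)=r=(U\otimes U')(r)$; (c) $p_ir_k\otimes p^ir_s\otimes r^kr^s=r_kp_i\otimes r_sp^i\otimes r^sr^k$; (d) $r_kr_s\otimes r^kp'_j\otimes r^sp'^j=r_sr_k\otimes p'_jr^k\otimes p'^jr^s$. *)

theory Defs
  imports "HOL-Algebra.Free_Abelian_Groups" "HOL-Algebra.Module" "HOL-Algebra.QuotRing"
begin

text \<open>Associative unital algebras over a field. (The library locale \<open>algebra\<close> is restricted to
  commutative algebras.)\<close>

definition unital_algebra ::
  "('k, 'l) ring_scheme \<Rightarrow> ('k, 'a, 'm) module_scheme \<Rightarrow> bool" where
  "unital_algebra K A \<longleftrightarrow> field K \<and> ring A \<and> module K A \<and>
    (\<forall>c\<in>carrier K. \<forall>x\<in>carrier A. \<forall>y\<in>carrier A.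
       (c \<odot>\<^bsub>A\<^esub> x) \<otimes>\<^bsub>A\<^esub> y = c \<odot>\<^bsub>A\<^esub> (x \<otimes>\<^bsub>A\<^esub> y) \<and>
       x \<otimes>\<^bsub>A\<^esub> (c \<odot>\<^bsub>A\<^esub> y) = c \<odot>\<^bsub>A\<^esub> (x \<otimes>\<^bsub>A\<^esub> y))"

definition algebra_auto ::
  "('k, 'l) ring_scheme \<Rightarrow> ('k, 'a, 'm) module_scheme \<Rightarrow> ('a \<Rightarrow> 'a) set" where
  "algebra_auto K A = {f \<in> ring_iso A A.
     \<forall>c\<in>carrier K. \<forall>x\<in>carrier A. f (c \<odot>\<^bsub>A\<^esub> x) = c \<odot>\<^bsub>A\<^esub> f x}"

definition commute_on :: "'a set \<Rightarrow> ('a \<Rightarrow> 'a) \<Rightarrow> ('a \<Rightarrow> 'a) \<Rightarrow> bool" where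
  "commute_on S f g \<longleftrightarrow> (\<forall>x\<in>S. f (g x) = g (f x))"

definition opposite :: "('k, 'a) module \<Rightarrow> ('k, 'a) module" where
  "opposite A = A\<lparr>monoid.mult := \<lambda>x y. y \<otimes>\<^bsub>A\<^esub> x\<rparr>"


text \<open>The tensor product over \<open>K\<close>: the free abelian group on pairs modulo the subgroup generated
  by biadditivity and \<open>K\<close>-balancedness.\<close>

definition tensor_relations ::
  "('k, 'l) ring_scheme \<Rightarrow> ('k, 'a) module \<Rightarrow> ('k, 'b) module \<Rightarrow> (('a \<times> 'b) \<Rightarrow>\<^sub>0 int) set" where
  "tensor_relations K A B =
     {frag_of (a \<oplus>\<^bsub>A\<^esub> a', b) - frag_of (a, b) - frag_of (a', b) | a a' b.
        a \<in> carrier A \<and> a' \<in> carrier A \<and> b \<in> carrier B}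
   \<union> {frag_of (a, b \<oplus>\<^bsub>B\<^esub> b') - frag_of (a, b) - frag_of (a, b') | a b b'.
        a \<in> carrier A \<and> b \<in> carrier B \<and> b' \<in> carrier B}
   \<union> {frag_of (c \<odot>\<^bsub>A\<^esub> a, b) - frag_of (a, c \<odot>\<^bsub>B\<^esub> b) | c a b.
        c \<in> carrier K \<and> a \<in> carrier A \<and> b \<in> carrier B}"

definition tensor_null ::
  "('k, 'l) ring_scheme \<Rightarrow> ('k, 'a) module \<Rightarrow> ('k, 'b) module \<Rightarrow> (('a \<times> 'b) \<Rightarrow>\<^sub>0 int) set" where
  "tensor_null K A B =
     generate (free_Abelian_group (carrier A \<times> carrier B)) (tensor_relations K A B)"

definition tensor_group ::
  "('k, 'l) ring_scheme \<Rightarrow> ('k, 'a) module \<Rightarrow> ('k, 'b) module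
     \<Rightarrow> (('a \<times> 'b) \<Rightarrow>\<^sub>0 int) set monoid" where
  "tensor_group K A B =
     free_Abelian_group (carrier A \<times> carrier B) Mod tensor_null K A B"

definition tens ::
  "('k, 'l) ring_scheme \<Rightarrow> ('k, 'a) module \<Rightarrow> ('k, 'b) module
     \<Rightarrow> 'a \<Rightarrow> 'b \<Rightarrow> (('a \<times> 'b) \<Rightarrow>\<^sub>0 int) set" where
  "tens K A B a b =
     tensor_null K A B #>\<^bsub>free_Abelian_group (carrier A \<times> carrier B)\<^esub> frag_of (a, b)"

text \<open>For a biadditive and \<open>K\<close>-balanced \<open>f\<close> with values in an abelian group \<open>G\<close> (written
  multiplicatively, as in HOL-Algebra), \<open>tensor_lift K A B G f\<close> is the homomorphism that sends
  the class of \<open>a \<otimes> b\<close> to \<open>f a b\<close>. On the carrier it is unique by the universal property; it is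
  only used below for such \<open>f\<close>.\<close>

definition tensor_lift ::
  "('k, 'l) ring_scheme \<Rightarrow> ('k, 'a) module \<Rightarrow> ('k, 'b) module \<Rightarrow> ('c, 'm) monoid_scheme
     \<Rightarrow> ('a \<Rightarrow> 'b \<Rightarrow> 'c) \<Rightarrow> (('a \<times> 'b) \<Rightarrow>\<^sub>0 int) set \<Rightarrow> 'c" where
  "tensor_lift K A B G f = (SOME h. h \<in> hom (tensor_group K A B) G \<and>
     (\<forall>a\<in>carrier A. \<forall>b\<in>carrier B. h (tens K A B a b) = f a b))"

text \<open>The multiplication is \<open>(a \<otimes> b)(c \<otimes> d) = ac \<otimes> bd\<close>, and the scalar action is
  \<open>k(a \<otimes> b) = ka \<otimes> b\<close>.\<close>

definition tensor_alg ::
  "('k, 'l) ring_scheme \<Rightarrow> ('k, 'a) module \<Rightarrow> ('k, 'b) module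
     \<Rightarrow> ('k, (('a \<times> 'b) \<Rightarrow>\<^sub>0 int) set) module" where
  "tensor_alg K A B = (let G = tensor_group K A B in
     \<lparr>carrier = carrier G,
      monoid.mult = (\<lambda>s t. tensor_lift K A B G
                (\<lambda>a b. tensor_lift K A B G
                  (\<lambda>c d. tens K A B (a \<otimes>\<^bsub>A\<^esub> c) (b \<otimes>\<^bsub>B\<^esub> d)) t) s),
      monoid.one = tens K A B \<one>\<^bsub>A\<^esub> \<one>\<^bsub>B\<^esub>,
      ring.zero = \<one>\<^bsub>G\<^esub>,
      ring.add = monoid.mult G,
      module.smult = (\<lambda>c. tensor_lift K A B G (\<lambda>a b. tens K A B (c \<odot>\<^bsub>A\<^esub> a) b))\<rparr>)"

definition tensor_map ::
  "('k, 'l) ring_scheme \<Rightarrow> ('k, 'a) module \<Rightarrow> ('k, 'b) module \<Rightarrow> ('k, 'c) module \<Rightarrow> ('k, 'd) module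
     \<Rightarrow> ('a \<Rightarrow> 'c) \<Rightarrow> ('b \<Rightarrow> 'd) \<Rightarrow> (('a \<times> 'b) \<Rightarrow>\<^sub>0 int) set \<Rightarrow> (('c \<times> 'd) \<Rightarrow>\<^sub>0 int) set" where
  "tensor_map K A B C D f g =
     tensor_lift K A B (tensor_group K C D) (\<lambda>a b. tens K C D (f a) (g b))"

text \<open>The summation convention: \<open>t = \<Sum>i\<in>I. x i \<otimes> y i\<close> is an expression of \<open>t\<close> as a finite sum of
  pure tensors. Formulas that use the convention do not depend on the chosen expression; below
  they are required for every expression.\<close>

definition tensor_expr ::
  "('k, 'l) ring_scheme \<Rightarrow> ('k, 'a) module \<Rightarrow> ('k, 'b) module
     \<Rightarrow> (('a \<times> 'b) \<Rightarrow>\<^sub>0 int) set \<Rightarrow> 'i set \<Rightarrow> ('i \<Rightarrow> 'a) \<Rightarrow> ('i \<Rightarrow> 'b) \<Rightarrow> bool" where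
  "tensor_expr K A B t I x y \<longleftrightarrow> finite I \<and> x \<in> I \<rightarrow> carrier A \<and> y \<in> I \<rightarrow> carrier B \<and>
     t = (\<Oplus>\<^bsub>tensor_alg K A B\<^esub> i\<in>I. tens K A B (x i) (y i))"


text \<open>Triple tensor products are bracketed to the left. Since \<open>opposite\<close> changes only the
  multiplication, \<open>H \<otimes> H\<close> and \<open>H \<otimes> opposite H\<close> have the same elements.\<close>

definition oriented_quantum_algebra ::
  "('k, 'l) ring_scheme \<Rightarrow> ('k, 'a) module \<Rightarrow> (('a \<times> 'a) \<Rightarrow>\<^sub>0 int) set
     \<Rightarrow> ('a \<Rightarrow> 'a) \<Rightarrow> ('a \<Rightarrow> 'a) \<Rightarrow> bool" where
  "oriented_quantum_algebra K H r D U \<longleftrightarrow>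
    (let T = tensor_alg K H H;
         Top = tensor_alg K H (opposite H);
         T3 = tensor_alg K T H;
         t3 = (\<lambda>a b c. tens K T H (tens K H H a b) c);
         DR = tensor_map K H H H H D id (inv\<^bsub>T\<^esub> r);
         Ur = tensor_map K H H H H id U r
     in unital_algebra K H \<and>
        r \<in> Units T \<and>
        D \<in> algebra_auto K H \<and> U \<in> algebra_auto K H \<and> commute_on (carrier H) D U \<and>
        DR \<otimes>\<^bsub>Top\<^esub> Ur = \<one>\<^bsub>Top\<^esub> \<and> Ur \<otimes>\<^bsub>Top\<^esub> DR = \<one>\<^bsub>Top\<^esub> \<and>
        tensor_map K H H H H D D r = r \<and> tensor_map K H H H H U U r = r \<and>
        (\<forall>(I :: nat set) x y. tensor_expr K H H r I x y \<longrightarrow>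
           finsum T3 (\<lambda>(i, j, k).
                t3 (x i \<otimes>\<^bsub>H\<^esub> x j) (y i \<otimes>\<^bsub>H\<^esub> x k) (y j \<otimes>\<^bsub>H\<^esub> y k))
              (I \<times> I \<times> I) =
           finsum T3 (\<lambda>(i, j, k).
                t3 (x j \<otimes>\<^bsub>H\<^esub> x i) (x k \<otimes>\<^bsub>H\<^esub> y i) (y k \<otimes>\<^bsub>H\<^esub> y j))
              (I \<times> I \<times> I)))"

definition oqa_nonuple ::
  "('k, 'l) ring_scheme \<Rightarrow> ('k, 'a) module \<Rightarrow> ('k, 'b) module
     \<Rightarrow> (('a \<times> 'a) \<Rightarrow>\<^sub>0 int) set \<Rightarrow> (('b \<times> 'b) \<Rightarrow>\<^sub>0 int) set \<Rightarrow> (('a \<times> 'b) \<Rightarrow>\<^sub>0 int) set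
     \<Rightarrow> ('a \<Rightarrow> 'a) \<Rightarrow> ('a \<Rightarrow> 'a) \<Rightarrow> ('b \<Rightarrow> 'b) \<Rightarrow> ('b \<Rightarrow> 'b) \<Rightarrow> bool" where
  "oqa_nonuple K H H' p p' r D U D' U' \<longleftrightarrow>
    (let T = tensor_alg K H H';
         t = tens K H H';
         HHH' = tensor_alg K (tensor_alg K H H) H';
         t_HHH' = (\<lambda>a b c. tens K (tensor_alg K H H) H' (tens K H H a b) c);
         HH'H' = tensor_alg K T H';
         t_HH'H' = (\<lambda>a b c. tens K T H' (t a b) c)
     in unital_algebra K H \<and> unital_algebra K H' \<and>
        p \<in> Units (tensor_alg K H H) \<and> p' \<in> Units (tensor_alg K H' H') \<and> r \<in> Units T \<and>
        D \<in> algebra_auto K H \<and> U \<in> algebra_auto K H \<and> commute_on (carrier H) D U \<and>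
        D' \<in> algebra_auto K H' \<and> U' \<in> algebra_auto K H' \<and> commute_on (carrier H') D' U' \<and>
        (\<forall>(I :: nat set) x y (L :: nat set) z w.
           tensor_expr K H H' r I x y \<and> tensor_expr K H H' (inv\<^bsub>T\<^esub> r) L z w \<longrightarrow>
           finsum T (\<lambda>(l, k).
                t (D (z l) \<otimes>\<^bsub>H\<^esub> x k) (U' (y k) \<otimes>\<^bsub>H'\<^esub> w l))
              (L \<times> I)
             = t \<one>\<^bsub>H\<^esub> \<one>\<^bsub>H'\<^esub> \<and>
           finsum T (\<lambda>(l, k).
                t (x k \<otimes>\<^bsub>H\<^esub> D (z l)) (w l \<otimes>\<^bsub>H'\<^esub> U' (y k)))
              (L \<times> I)
             = t \<one>\<^bsub>H\<^esub> \<one>\<^bsub>H'\<^esub>) \<and>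
        tensor_map K H H' H H' D D' r = r \<and> tensor_map K H H' H H' U U' r = r \<and>
        (\<forall>(I :: nat set) x y (J :: nat set) u v.
           tensor_expr K H H' r I x y \<and> tensor_expr K H H p J u v \<longrightarrow>
           finsum HHH' (\<lambda>(i, k, s).
                t_HHH' (u i \<otimes>\<^bsub>H\<^esub> x k) (v i \<otimes>\<^bsub>H\<^esub> x s) (y k \<otimes>\<^bsub>H'\<^esub> y s))
              (J \<times> I \<times> I) =
           finsum HHH' (\<lambda>(i, k, s).
                t_HHH' (x k \<otimes>\<^bsub>H\<^esub> u i) (x s \<otimes>\<^bsub>H\<^esub> v i) (y s \<otimes>\<^bsub>H'\<^esub> y k))
              (J \<times> I \<times> I)) \<and>
        (\<forall>(I :: nat set) x y (J :: nat set) u' v'.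
           tensor_expr K H H' r I x y \<and> tensor_expr K H' H' p' J u' v' \<longrightarrow>
           finsum HH'H' (\<lambda>(j, k, s).
                t_HH'H' (x k \<otimes>\<^bsub>H\<^esub> x s) (y k \<otimes>\<^bsub>H'\<^esub> u' j) (y s \<otimes>\<^bsub>H'\<^esub> v' j))
              (J \<times> I \<times> I) =
           finsum HH'H' (\<lambda>(j, k, s).
                t_HH'H' (x s \<otimes>\<^bsub>H\<^esub> x k) (u' j \<otimes>\<^bsub>H'\<^esub> y k) (v' j \<otimes>\<^bsub>H'\<^esub> y s))
              (J \<times> I \<times> I)))"

end

theory Submission
  imports Defs
begin

text \<open>
  Number the four factors of \<open>(H \<otimes> H') \<otimes> (H \<otimes> H')\<close> by 1, 2, 3, 4. Then
  \<open>\<alpha> = r\<^sub>1\<^sub>4 p\<^sub>1\<^sub>3 p'\<^sub>2\<^sub>4 R\<^sub>3\<^sub>2\<close> is a product of invertible elements, with inverse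
  \<open>r\<^sub>3\<^sub>2 P'\<^sub>2\<^sub>4 P\<^sub>1\<^sub>3 R\<^sub>1\<^sub>4\<close>. With a third copy of \<open>H \<otimes> H'\<close> in the factors 5, 6, the
  Yang--Baxter equation for \<open>\<alpha>\<close> becomes an identity between words in a monoid. It follows from
  the Yang--Baxter equations of \<open>p\<close> and \<open>p'\<close>, from (c), (d) and their variants for \<open>R\<close>, and
  from the fact that elements supported in disjoint factors commute.

  In \<open>(H \<otimes> H') \<otimes> (H \<otimes> H')\<^sup>o\<^sup>p\<close> the elements of condition (1) factor as
  \<open>P\<^sub>1\<^sub>3 R\<^sub>1\<^sub>4 r\<^sub>3\<^sub>2 P'\<^sub>2\<^sub>4\<close> and \<open>p'\<^sub>2\<^sub>4 R\<^sub>3\<^sub>2 r\<^sub>1\<^sub>4 p\<^sub>1\<^sub>3\<close>, each factor being twisted by automorphisms,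
  and neighbours cancel by (1) for \<open>p\<close> and \<open>p'\<close> and by (a).
\<close>

subsection \<open>Tensor products of modules\<close>

text \<open>The relations (1), (3), (a), (c), (d) live in different tensor products with different
  multiplications. They become comparable when all are mapped into one algebra \<open>M\<close>:
  algebra maps with commuting images take the place of the numbered factors, and a tensor put into
  two factors is its image under \<open>product_lift\<close>. Each relation is established once in
  this form, for arbitrary \<open>M\<close> and arbitrary maps; a map that reverses products is an
  algebra map out of an opposite algebra.

  Factors 3, 2 carry \<open>R\<close> and not \<open>r\<close> because there the
  \<open>H'\<close>-factor belongs to the earlier copy. The Yang-Baxter equation meets the pairs in
  the order of the copies, and for factors 2, 3, 6 relation (d) acquires that order only when
  \<open>r\<close> in factors 3, 2 is moved to the other side.

  For condition (1), factors 1, 4 have \<open>H'\<close> in the opposite copy, as (a) demands, but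
  factors 3, 2 have \<open>H\<close> there. For them \<open>R\<close> has to be twisted by
  \<open>U\<close> and \<open>r\<close> by \<open>D'\<close>, whereas (a) twists \<open>R\<close> by
  \<open>D\<close> and \<open>r\<close> by \<open>U'\<close>; the invariance (b) closes this
  gap.\<close>

lemma unital_algebraD:
  assumes "unital_algebra K A"
  shows "field K" "ring A" "module K A" "abelian_group A" "monoid A" "cring K"
proof -
  show "field K" "ring A" "module K A" using assms by (auto simp: unital_algebra_def)
  then show "abelian_group A" "monoid A" "cring K"
    by (auto simp: ring_def module_def)
qed

locale tensor_pair =
  fixes K :: "('k, 'l) ring_scheme" and A :: "('k, 'a) module" and B :: "('k, 'b) module"
  assumes A: "unital_algebra K A" and B: "unital_algebra K B"
begin

abbreviation "F \<equiv> free_Abelian_group (carrier A \<times> carrier B)"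
abbreviation "N \<equiv> tensor_null K A B"
abbreviation "G \<equiv> tensor_group K A B"
abbreviation "T \<equiv> tensor_alg K A B"
abbreviation "tn \<equiv> tens K A B"

sublocale A: ring A by (rule unital_algebraD[OF A])
sublocale B: ring B by (rule unital_algebraD[OF B])

lemma smultA [simp]:
  "c \<in> carrier K \<Longrightarrow> x \<in> carrier A \<Longrightarrow> c \<odot>\<^bsub>A\<^esub> x \<in> carrier A"
  using unital_algebraD(3)[OF A] by (rule module.smult_closed)

lemma smultB [simp]:
  "c \<in> carrier K \<Longrightarrow> x \<in> carrier B \<Longrightarrow> c \<odot>\<^bsub>B\<^esub> x \<in> carrier B"
  using unital_algebraD(3)[OF B] by (rule module.smult_closed)

lemma tensor_relations_subset: "tensor_relations K A B \<subseteq> carrier F"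
proof
  fix z assume "z \<in> tensor_relations K A B"
  moreover have "x - y \<in> carrier F" if "x \<in> carrier F" "y \<in> carrier F" for x y
    using that keys_diff by fastforce
  ultimately show "z \<in> carrier F"
    unfolding tensor_relations_def
    by (auto simp del: carrier_free_Abelian_group_iff simp add: frag_of_in_free_Abelian_group)
qed

lemma tensor_null_normal: "N \<lhd> F"
  unfolding tensor_null_def
  by (intro comm_group.subgroup_imp_normal abelian_free_Abelian_group
      group.generate_is_subgroup group_free_Abelian_group tensor_relations_subset)

lemma comm_group_tensor_group: "comm_group G"
  unfolding tensor_group_def
  by (intro comm_group.abelian_FactGroup abelian_free_Abelian_group normal_imp_subgroup
      tensor_null_normal)

sublocale G: comm_group G by (rule comm_group_tensor_group)

lemma coset_hom: "(\<lambda>x. N #>\<^bsub>F\<^esub> x) \<in> hom F G"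
  unfolding tensor_group_def by (rule normal.r_coset_hom_Mod[OF tensor_null_normal])

lemma coset_diff:
  assumes "x \<in> carrier F" "y \<in> carrier F" "x - y \<in> N"
  shows "N #>\<^bsub>F\<^esub> x = N #>\<^bsub>F\<^esub> y"
proof -
  have "x \<in> N #>\<^bsub>F\<^esub> y"
    using assms(3) by (force simp: r_coset_def)
  then show ?thesis
    using group.repr_independence[OF group_free_Abelian_group _ assms(2)
        normal_imp_subgroup[OF tensor_null_normal]] by simp
qed

lemma coset_add:
  assumes "x \<in> carrier F" "y \<in> carrier F"
  shows "N #>\<^bsub>F\<^esub> (x + y) = (N #>\<^bsub>F\<^esub> x) \<otimes>\<^bsub>G\<^esub> (N #>\<^bsub>F\<^esub> y)"
  using hom_mult[OF coset_hom assms] by simp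

lemma tens_closed [simp]: "a \<in> carrier A \<Longrightarrow> b \<in> carrier B \<Longrightarrow> tn a b \<in> carrier G"
  unfolding tens_def by (rule hom_in_carrier[OF coset_hom]) simp

lemma relation_in_null: "z \<in> tensor_relations K A B \<Longrightarrow> z \<in> N"
  unfolding tensor_null_def by (rule generate.incl)

lemma tens_add_left:
  assumes "a \<in> carrier A" "a' \<in> carrier A" "b \<in> carrier B"
  shows "tn (a \<oplus>\<^bsub>A\<^esub> a') b = tn a b \<otimes>\<^bsub>G\<^esub> tn a' b"
proof -
  have "frag_of (a \<oplus>\<^bsub>A\<^esub> a', b) - (frag_of (a, b) + frag_of (a', b)) \<in> N"
    using assms by (intro relation_in_null) (unfold tensor_relations_def, force simp: algebra_simps)
  moreover have "frag_of (a, b) + frag_of (a', b) \<in> carrier F"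
    using assms keys_add[of "frag_of (a,b)" "frag_of (a',b)"] by auto
  ultimately show ?thesis
    unfolding tens_def using assms by (subst coset_add[symmetric]; (intro coset_diff)?; simp)
qed

lemma tens_add_right:
  assumes "a \<in> carrier A" "b \<in> carrier B" "b' \<in> carrier B"
  shows "tn a (b \<oplus>\<^bsub>B\<^esub> b') = tn a b \<otimes>\<^bsub>G\<^esub> tn a b'"
proof -
  have "frag_of (a, b \<oplus>\<^bsub>B\<^esub> b') - (frag_of (a, b) + frag_of (a, b')) \<in> N"
    using assms by (intro relation_in_null) (unfold tensor_relations_def, force simp: algebra_simps)
  moreover have "frag_of (a, b) + frag_of (a, b') \<in> carrier F"
    using assms keys_add[of "frag_of (a,b)" "frag_of (a,b')"] by auto
  ultimately show ?thesis
    unfolding tens_def using assms by (subst coset_add[symmetric]; (intro coset_diff)?; simp)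
qed

lemma tens_balanced:
  assumes "c \<in> carrier K" "a \<in> carrier A" "b \<in> carrier B"
  shows "tn (c \<odot>\<^bsub>A\<^esub> a) b = tn a (c \<odot>\<^bsub>B\<^esub> b)"
  unfolding tens_def using assms
  by (intro coset_diff relation_in_null) (auto simp: tensor_relations_def)

lemma tens_zero_left: "b \<in> carrier B \<Longrightarrow> tn \<zero>\<^bsub>A\<^esub> b = \<one>\<^bsub>G\<^esub>"
  using tens_add_left[of "\<zero>\<^bsub>A\<^esub>" "\<zero>\<^bsub>A\<^esub>" b] by (simp add: G.l_cancel_one')

lemma tens_inv: "a \<in> carrier A \<Longrightarrow> b \<in> carrier B \<Longrightarrow> inv\<^bsub>G\<^esub> (tn a b) = tn (\<ominus>\<^bsub>A\<^esub> a) b"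
  by (rule G.inv_equality) (simp_all add: tens_add_left[symmetric] A.l_neg tens_zero_left)

text \<open>Sums of pure tensors exhaust the tensor product, with no case for inverses or for the
  neutral element: the inverse of the class of (a, b) is that of (-a, b), and the neutral element is
  the pure tensor of two zeros.\<close>

lemma tensor_induct [consumes 1, case_names tens add]:
  assumes "t \<in> carrier G"
    and tens: "\<And>a b. a \<in> carrier A \<Longrightarrow> b \<in> carrier B \<Longrightarrow> P (tn a b)"
    and add: "\<And>s t. s \<in> carrier G \<Longrightarrow> t \<in> carrier G \<Longrightarrow> P s \<Longrightarrow> P t \<Longrightarrow> P (s \<otimes>\<^bsub>G\<^esub> t)"
  shows "P t"
proof -
  obtain x where x: "x \<in> carrier F" "t = N #>\<^bsub>F\<^esub> x"
    using assms(1) by (auto simp: tensor_group_def carrier_FactGroup)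
  interpret h: group_hom F G "\<lambda>x. N #>\<^bsub>F\<^esub> x"
    by (intro group_hom.intro group_hom_axioms.intro group_free_Abelian_group G.is_group coset_hom)
  let ?c = "\<lambda>x. N #>\<^bsub>F\<^esub> x"
  \<comment> \<open>Induction on the free group passes through differences \<open>x - y\<close>, so
    the claim for the inverse class has to be carried along.\<close>
  have "P (?c x) \<and> P (inv\<^bsub>G\<^esub> (?c x))"
    using x(1) unfolding carrier_free_Abelian_group_iff
  proof (induction rule: free_Abelian_group_induct[consumes 1, case_names 1 2 3])
    case 1
    have "?c 0 = tn \<zero>\<^bsub>A\<^esub> \<zero>\<^bsub>B\<^esub>" using h.hom_one by (simp add: tens_zero_left)
    then show ?case by (simp add: tens tens_inv)
  next
    case (2 x y)
    have "?c (x - y) = ?c x \<otimes>\<^bsub>G\<^esub> inv\<^bsub>G\<^esub> (?c y)"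
      using 2 h.hom_mult[of x "-y"] h.hom_inv[of y] by simp
    moreover have "inv\<^bsub>G\<^esub> (?c x \<otimes>\<^bsub>G\<^esub> inv\<^bsub>G\<^esub> (?c y)) = inv\<^bsub>G\<^esub> (?c x) \<otimes>\<^bsub>G\<^esub> ?c y"
      using 2 h.hom_closed by (simp add: G.inv_mult)
    ultimately show ?case using 2 h.hom_closed by (simp add: add)
  next
    case (3 ab)
    then show ?case using tens tens_inv by (cases ab) (auto simp: tens_def[symmetric])
  qed
  then show ?thesis using x by simp
qed

end

section \<open>The universal property of the tensor product\<close>

definition balanced where
  "balanced K A B M f \<longleftrightarrow>
    (\<forall>a\<in>carrier A. \<forall>b\<in>carrier B. f a b \<in> carrier M) \<and>
    (\<forall>a\<in>carrier A. \<forall>a'\<in>carrier A. \<forall>b\<in>carrier B. f (a \<oplus>\<^bsub>A\<^esub> a') b = f a b \<otimes>\<^bsub>M\<^esub> f a' b) \<and>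
    (\<forall>a\<in>carrier A. \<forall>b\<in>carrier B. \<forall>b'\<in>carrier B. f a (b \<oplus>\<^bsub>B\<^esub> b') = f a b \<otimes>\<^bsub>M\<^esub> f a b') \<and>
    (\<forall>c\<in>carrier K. \<forall>a\<in>carrier A. \<forall>b\<in>carrier B. f (c \<odot>\<^bsub>A\<^esub> a) b = f a (c \<odot>\<^bsub>B\<^esub> b))"

context tensor_pair
begin

text \<open>The homomorphism on the free abelian group with the values of \<open>f\<close> kills the
  three families of relations, hence the subgroup they generate, and descends to the quotient. This
  supplies the witness for the \<open>SOME\<close> in \<open>tensor_lift\<close>.\<close>

lemma tensor_lift:
  assumes "comm_group M" and f: "balanced K A B M f"
  shows tensor_lift_hom: "tensor_lift K A B M f \<in> hom G M"
    and tensor_lift_tens: "a \<in> carrier A \<Longrightarrow> b \<in> carrier B \<Longrightarrow> tensor_lift K A B M f (tn a b) = f a b"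
proof -
  interpret M: comm_group M by fact
  have fc: "\<And>a b. a \<in> carrier A \<Longrightarrow> b \<in> carrier B \<Longrightarrow> f a b \<in> carrier M"
    using f by (simp add: balanced_def)
  obtain h where h: "h \<in> hom F M" "\<And>x. x \<in> carrier A \<times> carrier B \<Longrightarrow> h (frag_of x) = case_prod f x"
    by (rule M.free_Abelian_group_universal[of "case_prod f" "carrier A \<times> carrier B"]) (auto simp: fc)
  interpret h: group_hom F M h
    by (intro group_hom.intro group_hom_axioms.intro group_free_Abelian_group M.is_group h(1))
  have hd: "h (x - y) = h x \<otimes>\<^bsub>M\<^esub> inv\<^bsub>M\<^esub> h y" if "x \<in> carrier F" "y \<in> carrier F" for x y
    using that h.hom_mult[of x "-y"] h.hom_inv[of y] by simp
  have eq1: "h (frag_of x - frag_of y) = \<one>\<^bsub>M\<^esub>"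
    if "x \<in> carrier A \<times> carrier B" "y \<in> carrier A \<times> carrier B" "case_prod f x = case_prod f y" for x y
    using that fc by (subst hd) (auto simp: h split: prod.splits)
  have eq2: "h (frag_of x - frag_of y - frag_of z) = \<one>\<^bsub>M\<^esub>"
    if "x \<in> carrier A \<times> carrier B" "y \<in> carrier A \<times> carrier B" "z \<in> carrier A \<times> carrier B"
      "case_prod f x = case_prod f y \<otimes>\<^bsub>M\<^esub> case_prod f z" for x y z
  proof -
    have *: "frag_of x + frag_of y \<in> carrier F" if "x \<in> carrier A \<times> carrier B" "y \<in> carrier A \<times> carrier B" for x y
      using that keys_add[of "frag_of x" "frag_of y"] by (simp, blast)
    have "frag_of x - frag_of y - frag_of z = frag_of x - (frag_of y + frag_of z)" by simp
    then have "h (frag_of x - frag_of y - frag_of z)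
        = h (frag_of x) \<otimes>\<^bsub>M\<^esub> inv\<^bsub>M\<^esub> h (frag_of y + frag_of z)"
      using hd[of "frag_of x" "frag_of y + frag_of z"] *[OF that(2,3)] that(1)
      by (simp add: diff_diff_eq)
    also have "h (frag_of y + frag_of z) = h (frag_of y) \<otimes>\<^bsub>M\<^esub> h (frag_of z)"
      using h.hom_mult[of "frag_of y" "frag_of z"] that by simp
    finally show ?thesis using that fc by (auto simp: h)
  qed
  \<comment> \<open>Biadditivity gives relations with three terms, handled by \<open>eq2\<close>;
    balancedness gives relations with two, handled by \<open>eq1\<close>.\<close>
  have "h z = \<one>\<^bsub>M\<^esub>" if "z \<in> tensor_relations K A B" for z
    using that f unfolding tensor_relations_def balanced_def
    by (elim UnE CollectE exE conjE; hypsubst) (intro eq1 eq2; simp)+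
  then have "tensor_relations K A B \<subseteq> kernel F M h"
    using tensor_relations_subset
    by (simp add: kernel_def subset_iff del: carrier_free_Abelian_group_iff)
  then have "N \<subseteq> kernel F M h"
    unfolding tensor_null_def by (intro group.generate_subgroup_incl h.subgroup_kernel) auto
  then obtain g where "g \<in> hom (F Mod N) M" "\<And>x. x \<in> carrier F \<Longrightarrow> g (N #>\<^bsub>F\<^esub> x) = h x"
    using h.FactGroup_universal_kernel[OF tensor_null_normal] by metis
  then have "\<exists>g. g \<in> hom G M \<and> (\<forall>a\<in>carrier A. \<forall>b\<in>carrier B. g (tn a b) = f a b)"
    by (intro exI[of _ g]) (auto simp: tens_def tensor_group_def h)
  from someI_ex[OF this]
  show "tensor_lift K A B M f \<in> hom G M"
    and "a \<in> carrier A \<Longrightarrow> b \<in> carrier B \<Longrightarrow> tensor_lift K A B M f (tn a b) = f a b"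
    unfolding tensor_lift_def by blast+
qed

end

subsection \<open>The tensor product algebra\<close>

context tensor_pair
begin

lemma T_simps:
  "carrier T = carrier G" "x \<oplus>\<^bsub>T\<^esub> y = x \<otimes>\<^bsub>G\<^esub> y" "\<zero>\<^bsub>T\<^esub> = \<one>\<^bsub>G\<^esub>"
  "\<one>\<^bsub>T\<^esub> = tn \<one>\<^bsub>A\<^esub> \<one>\<^bsub>B\<^esub>"
  by (simp_all add: tensor_alg_def Let_def)

lemma abelian_group_T: "abelian_group T"
  by (rule abelian_groupI) (simp_all add: T_simps G.m_ac G.l_inv_ex)

sublocale T: abelian_group T by (rule abelian_group_T)

lemma tens_in_T [simp]: "a \<in> carrier A \<Longrightarrow> b \<in> carrier B \<Longrightarrow> tn a b \<in> carrier T"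
  by (simp add: T_simps)

lemmas tens_add = tens_add_left[folded T_simps] tens_add_right[folded T_simps]
lemmas tensor_T_induct [consumes 1, case_names tens add] = tensor_induct[folded T_simps]

lemma smult_mult:
  "c \<in> carrier K \<Longrightarrow> x \<in> carrier A \<Longrightarrow> y \<in> carrier A \<Longrightarrow> (c \<odot>\<^bsub>A\<^esub> x) \<otimes>\<^bsub>A\<^esub> y = c \<odot>\<^bsub>A\<^esub> (x \<otimes>\<^bsub>A\<^esub> y)"
  "c \<in> carrier K \<Longrightarrow> x \<in> carrier A \<Longrightarrow> y \<in> carrier A \<Longrightarrow> x \<otimes>\<^bsub>A\<^esub> (c \<odot>\<^bsub>A\<^esub> y) = c \<odot>\<^bsub>A\<^esub> (x \<otimes>\<^bsub>A\<^esub> y)"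
  "c \<in> carrier K \<Longrightarrow> x' \<in> carrier B \<Longrightarrow> y' \<in> carrier B \<Longrightarrow> (c \<odot>\<^bsub>B\<^esub> x') \<otimes>\<^bsub>B\<^esub> y' = c \<odot>\<^bsub>B\<^esub> (x' \<otimes>\<^bsub>B\<^esub> y')"
  "c \<in> carrier K \<Longrightarrow> x' \<in> carrier B \<Longrightarrow> y' \<in> carrier B \<Longrightarrow> x' \<otimes>\<^bsub>B\<^esub> (c \<odot>\<^bsub>B\<^esub> y') = c \<odot>\<^bsub>B\<^esub> (x' \<otimes>\<^bsub>B\<^esub> y')"
  using A B by (auto simp: unital_algebra_def)

text \<open>The inner of the two nested lifts in the product of \<open>tensor_alg\<close>. The outer
  lift is legitimate only once this one is known to be balanced in \<open>a\<close> and
  \<open>b\<close>.\<close>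

definition left_mult where
  "left_mult a b = tensor_lift K A B G (\<lambda>c d. tn (a \<otimes>\<^bsub>A\<^esub> c) (b \<otimes>\<^bsub>B\<^esub> d))"

lemma left_mult:
  assumes "a \<in> carrier A" "b \<in> carrier B"
  shows left_mult_add: "s \<in> carrier T \<Longrightarrow> t \<in> carrier T \<Longrightarrow>
      left_mult a b (s \<oplus>\<^bsub>T\<^esub> t) = left_mult a b s \<oplus>\<^bsub>T\<^esub> left_mult a b t"
    and left_mult_closed [simp]: "s \<in> carrier T \<Longrightarrow> left_mult a b s \<in> carrier T"
    and left_mult_tens [simp]: "c \<in> carrier A \<Longrightarrow> d \<in> carrier B \<Longrightarrow>
      left_mult a b (tn c d) = tn (a \<otimes>\<^bsub>A\<^esub> c) (b \<otimes>\<^bsub>B\<^esub> d)"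
proof -
  have bal: "balanced K A B G (\<lambda>c d. tn (a \<otimes>\<^bsub>A\<^esub> c) (b \<otimes>\<^bsub>B\<^esub> d))"
    using assms unfolding balanced_def
    by (auto simp: A.r_distr B.r_distr tens_add_left tens_add_right smult_mult tens_balanced)
  note h = tensor_lift_hom[OF comm_group_tensor_group bal, folded left_mult_def]
  show "s \<in> carrier T \<Longrightarrow> t \<in> carrier T \<Longrightarrow>
      left_mult a b (s \<oplus>\<^bsub>T\<^esub> t) = left_mult a b s \<oplus>\<^bsub>T\<^esub> left_mult a b t"
    using hom_mult[OF h] by (simp add: T_simps)
  show "s \<in> carrier T \<Longrightarrow> left_mult a b s \<in> carrier T"
    using hom_in_carrier[OF h] by (simp add: T_simps)
  show "c \<in> carrier A \<Longrightarrow> d \<in> carrier B \<Longrightarrow>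
      left_mult a b (tn c d) = tn (a \<otimes>\<^bsub>A\<^esub> c) (b \<otimes>\<^bsub>B\<^esub> d)"
    using tensor_lift_tens[OF comm_group_tensor_group bal] by (simp add: left_mult_def)
qed

lemma mult_T: "s \<otimes>\<^bsub>T\<^esub> t = tensor_lift K A B G (\<lambda>a b. left_mult a b t) s"
  by (simp add: tensor_alg_def Let_def left_mult_def)

text \<open>Both sides of each law are additive in \<open>t\<close>, so it suffices to take
  \<open>t\<close> pure, where the laws are those of the two factors.\<close>

lemma balanced_left_mult:
  assumes "t \<in> carrier T"
  shows "balanced K A B G (\<lambda>a b. left_mult a b t)"
  unfolding balanced_def T_simps[symmetric]
proof (intro conjI ballI)
  fix a a' b b' assume *: "a \<in> carrier A" "a' \<in> carrier A" "b \<in> carrier B" "b' \<in> carrier B"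
  show "left_mult a b t \<in> carrier T" using * assms by simp
  show "left_mult (a \<oplus>\<^bsub>A\<^esub> a') b t = left_mult a b t \<oplus>\<^bsub>T\<^esub> left_mult a' b t"
    using assms by (induction rule: tensor_T_induct)
      (simp_all add: * left_mult_add tens_add A.l_distr T.a_ac)
  show "left_mult a (b \<oplus>\<^bsub>B\<^esub> b') t = left_mult a b t \<oplus>\<^bsub>T\<^esub> left_mult a b' t"
    using assms by (induction rule: tensor_T_induct)
      (simp_all add: * left_mult_add tens_add B.l_distr T.a_ac)
next
  fix c a b assume *: "a \<in> carrier A" "b \<in> carrier B" "c \<in> carrier K"
  show "left_mult (c \<odot>\<^bsub>A\<^esub> a) b t = left_mult a (c \<odot>\<^bsub>B\<^esub> b) t"
    using assms by (induction rule: tensor_T_induct)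
      (simp_all add: * left_mult_add smult_mult tens_balanced)
qed

lemma mult_tens_left: "a \<in> carrier A \<Longrightarrow> b \<in> carrier B \<Longrightarrow> t \<in> carrier T \<Longrightarrow>
    tn a b \<otimes>\<^bsub>T\<^esub> t = left_mult a b t"
  by (simp add: mult_T tensor_lift_tens[OF comm_group_tensor_group balanced_left_mult])

lemma mult_tens [simp]:
  "a \<in> carrier A \<Longrightarrow> b \<in> carrier B \<Longrightarrow> c \<in> carrier A \<Longrightarrow> d \<in> carrier B \<Longrightarrow>
    tn a b \<otimes>\<^bsub>T\<^esub> tn c d = tn (a \<otimes>\<^bsub>A\<^esub> c) (b \<otimes>\<^bsub>B\<^esub> d)"
  by (simp add: mult_tens_left)

lemma T_mult_closed [simp]: "s \<in> carrier T \<Longrightarrow> t \<in> carrier T \<Longrightarrow> s \<otimes>\<^bsub>T\<^esub> t \<in> carrier T"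
  using hom_in_carrier[OF tensor_lift_hom[OF comm_group_tensor_group balanced_left_mult]]
  by (simp add: mult_T T_simps)

lemma T_l_distr: "s \<in> carrier T \<Longrightarrow> s' \<in> carrier T \<Longrightarrow> t \<in> carrier T \<Longrightarrow>
    (s \<oplus>\<^bsub>T\<^esub> s') \<otimes>\<^bsub>T\<^esub> t = s \<otimes>\<^bsub>T\<^esub> t \<oplus>\<^bsub>T\<^esub> s' \<otimes>\<^bsub>T\<^esub> t"
  using hom_mult[OF tensor_lift_hom[OF comm_group_tensor_group balanced_left_mult]]
  by (simp add: mult_T T_simps)

lemma T_r_distr:
  assumes "s \<in> carrier T" "t \<in> carrier T" "t' \<in> carrier T"
  shows "s \<otimes>\<^bsub>T\<^esub> (t \<oplus>\<^bsub>T\<^esub> t') = s \<otimes>\<^bsub>T\<^esub> t \<oplus>\<^bsub>T\<^esub> s \<otimes>\<^bsub>T\<^esub> t'"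
  using assms(1) by (induction rule: tensor_T_induct)
    (simp_all add: mult_tens_left left_mult_add assms T_l_distr T.a_ac)

lemma T_m_assoc:
  assumes "s \<in> carrier T" "t \<in> carrier T" "u \<in> carrier T"
  shows "(s \<otimes>\<^bsub>T\<^esub> t) \<otimes>\<^bsub>T\<^esub> u = s \<otimes>\<^bsub>T\<^esub> (t \<otimes>\<^bsub>T\<^esub> u)"
  using assms(1)
proof (induction rule: tensor_T_induct)
  case (tens a b)
  show ?case using assms(2)
  proof (induction rule: tensor_T_induct)
    case (tens c d)
    show ?case using assms(3)
      by (induction rule: tensor_T_induct)
        (use tens \<open>a \<in> carrier A\<close> \<open>b \<in> carrier B\<close> in \<open>simp_all add: T_r_distr A.m_assoc B.m_assoc\<close>)
  next
    case (add s t)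
    then show ?case using tens assms(3) by (simp add: T_r_distr T_l_distr)
  qed
next
  case (add s s')
  then show ?case using assms by (simp add: T_l_distr)
qed

lemma ring_T: "ring T"
proof (rule ringI[OF abelian_group_T])
  show "monoid T"
  proof (rule monoidI)
    show "\<one>\<^bsub>T\<^esub> \<in> carrier T" by (simp add: T_simps)
    show "\<one>\<^bsub>T\<^esub> \<otimes>\<^bsub>T\<^esub> t = t" if "t \<in> carrier T" for t
      using that unfolding T_simps(4)
      by (induction rule: tensor_T_induct) (simp_all add: T_r_distr)
    show "t \<otimes>\<^bsub>T\<^esub> \<one>\<^bsub>T\<^esub> = t" if "t \<in> carrier T" for t
      using that unfolding T_simps(4)
      by (induction rule: tensor_T_induct) (simp_all add: T_l_distr)
  qed (auto simp: T_m_assoc)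
qed (auto simp: T_l_distr T_r_distr)

lemma T_smult:
  assumes "c \<in> carrier K"
  shows T_smult_add: "s \<in> carrier T \<Longrightarrow> t \<in> carrier T \<Longrightarrow>
      c \<odot>\<^bsub>T\<^esub> (s \<oplus>\<^bsub>T\<^esub> t) = c \<odot>\<^bsub>T\<^esub> s \<oplus>\<^bsub>T\<^esub> c \<odot>\<^bsub>T\<^esub> t"
    and T_smult_closed [simp]: "s \<in> carrier T \<Longrightarrow> c \<odot>\<^bsub>T\<^esub> s \<in> carrier T"
    and T_smult_tens: "a \<in> carrier A \<Longrightarrow> b \<in> carrier B \<Longrightarrow> c \<odot>\<^bsub>T\<^esub> tn a b = tn (c \<odot>\<^bsub>A\<^esub> a) b"
proof -
  interpret MA: module K A by (rule unital_algebraD[OF A])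
  \<comment> \<open>Scaling the left factor respects the balancing relation because the scalars
    commute.\<close>
  have "c \<odot>\<^bsub>A\<^esub> (c' \<odot>\<^bsub>A\<^esub> a) = c' \<odot>\<^bsub>A\<^esub> (c \<odot>\<^bsub>A\<^esub> a)" if "c' \<in> carrier K" "a \<in> carrier A" for c' a
    using that assms by (metis MA.R.m_comm MA.smult_assoc1)
  then have bal: "balanced K A B G (\<lambda>a b. tn (c \<odot>\<^bsub>A\<^esub> a) b)"
    using assms unfolding balanced_def
    by (auto simp: MA.smult_r_distr tens_add_left tens_add_right tens_balanced)
  have eq: "c \<odot>\<^bsub>T\<^esub> s = tensor_lift K A B G (\<lambda>a b. tn (c \<odot>\<^bsub>A\<^esub> a) b) s" for s
    by (simp add: tensor_alg_def Let_def)
  note h = tensor_lift_hom[OF comm_group_tensor_group bal, folded eq]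
  show "s \<in> carrier T \<Longrightarrow> t \<in> carrier T \<Longrightarrow>
      c \<odot>\<^bsub>T\<^esub> (s \<oplus>\<^bsub>T\<^esub> t) = c \<odot>\<^bsub>T\<^esub> s \<oplus>\<^bsub>T\<^esub> c \<odot>\<^bsub>T\<^esub> t"
    using hom_mult[OF tensor_lift_hom[OF comm_group_tensor_group bal]] unfolding eq by (simp add: T_simps)
  show "s \<in> carrier T \<Longrightarrow> c \<odot>\<^bsub>T\<^esub> s \<in> carrier T"
    using hom_in_carrier[OF tensor_lift_hom[OF comm_group_tensor_group bal]] unfolding eq by (simp add: T_simps)
  show "a \<in> carrier A \<Longrightarrow> b \<in> carrier B \<Longrightarrow> c \<odot>\<^bsub>T\<^esub> tn a b = tn (c \<odot>\<^bsub>A\<^esub> a) b"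
    using tensor_lift_tens[OF comm_group_tensor_group bal] unfolding eq by simp
qed

text \<open>This closure property allows \<open>tensor_pair\<close> to be interpreted again with
  tensor products as factors, as \<open>T \<otimes> T\<close> and
  \<open>(T \<otimes> T) \<otimes> T\<close> require.\<close>

theorem unital_algebra_T: "unital_algebra K T"
proof -
  interpret MA: module K A by (rule unital_algebraD[OF A])
  interpret T: ring T by (rule ring_T)
  have "module K T"
  proof (rule moduleI)
    show "cring K" by (rule MA.R.is_cring)
    show "abelian_group T" by (rule abelian_group_T)
    fix c c' t assume c: "c \<in> carrier K" "c' \<in> carrier K" and t: "t \<in> carrier T"
    show "(c \<oplus>\<^bsub>K\<^esub> c') \<odot>\<^bsub>T\<^esub> t = c \<odot>\<^bsub>T\<^esub> t \<oplus>\<^bsub>T\<^esub> c' \<odot>\<^bsub>T\<^esub> t" using t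
      by (induction rule: tensor_T_induct)
        (simp_all add: c T_smult_add T_smult_tens MA.smult_l_distr tens_add T.a_ac)
    show "(c \<otimes>\<^bsub>K\<^esub> c') \<odot>\<^bsub>T\<^esub> t = c \<odot>\<^bsub>T\<^esub> (c' \<odot>\<^bsub>T\<^esub> t)" using t
      by (induction rule: tensor_T_induct)
        (simp_all add: c T_smult_add T_smult_tens MA.smult_assoc1)
  next
    fix t assume t: "t \<in> carrier T"
    then show "\<one>\<^bsub>K\<^esub> \<odot>\<^bsub>T\<^esub> t = t"
      by (induction rule: tensor_T_induct) (simp_all add: T_smult_add T_smult_tens)
  qed (simp_all add: T_smult_add)
  moreover have "(c \<odot>\<^bsub>T\<^esub> s) \<otimes>\<^bsub>T\<^esub> t = c \<odot>\<^bsub>T\<^esub> (s \<otimes>\<^bsub>T\<^esub> t) \<and> s \<otimes>\<^bsub>T\<^esub> (c \<odot>\<^bsub>T\<^esub> t) = c \<odot>\<^bsub>T\<^esub> (s \<otimes>\<^bsub>T\<^esub> t)"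
    if c: "c \<in> carrier K" and "s \<in> carrier T" and t: "t \<in> carrier T" for c s t
    using that(2)
  proof (induction rule: tensor_T_induct)
    case (tens a b)
    show ?case using t
      by (induction rule: tensor_T_induct)
        (use tens c in \<open>simp_all add: T_smult_add T_r_distr T_smult_tens smult_mult\<close>)
  next
    case (add s s')
    then show ?case using c t by (simp add: T_smult_add T_l_distr)
  qed
  ultimately show ?thesis
    using unital_algebraD(1)[OF A] ring_T unfolding unital_algebra_def by blast
qed

end

subsection \<open>Linear and algebra maps out of tensor products\<close>

definition linear_map ::
  "('k, 'l) ring_scheme \<Rightarrow> ('k, 'a) module \<Rightarrow> ('k, 'b) module \<Rightarrow> ('a \<Rightarrow> 'b) \<Rightarrow> bool" where
  "linear_map K A M f \<longleftrightarrow> f \<in> carrier A \<rightarrow> carrier M \<and>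
     (\<forall>x\<in>carrier A. \<forall>y\<in>carrier A. f (x \<oplus>\<^bsub>A\<^esub> y) = f x \<oplus>\<^bsub>M\<^esub> f y) \<and>
     (\<forall>c\<in>carrier K. \<forall>x\<in>carrier A. f (c \<odot>\<^bsub>A\<^esub> x) = c \<odot>\<^bsub>M\<^esub> f x)"

definition algebra_map ::
  "('k, 'l) ring_scheme \<Rightarrow> ('k, 'a) module \<Rightarrow> ('k, 'b) module \<Rightarrow> ('a \<Rightarrow> 'b) \<Rightarrow> bool" where
  "algebra_map K A M f \<longleftrightarrow> linear_map K A M f \<and>
     (\<forall>x\<in>carrier A. \<forall>y\<in>carrier A. f (x \<otimes>\<^bsub>A\<^esub> y) = f x \<otimes>\<^bsub>M\<^esub> f y) \<and> f \<one>\<^bsub>A\<^esub> = \<one>\<^bsub>M\<^esub>"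

definition commuting where
  "commuting M A B f g \<longleftrightarrow> (\<forall>a\<in>carrier A. \<forall>b\<in>carrier B. f a \<otimes>\<^bsub>M\<^esub> g b = g b \<otimes>\<^bsub>M\<^esub> f a)"

text \<open>When \<open>f\<close> and \<open>g\<close> embed two algebras as factors of a larger
  tensor product, this puts a tensor into those factors; it is the usual index notation such as
  \<open>r\<^sub>1\<^sub>4\<close>. Being built from linear data alone, it also accommodates maps
  that reverse products.\<close>

definition product_lift ::
  "('k, 'l) ring_scheme \<Rightarrow> ('k, 'a) module \<Rightarrow> ('k, 'b) module \<Rightarrow> ('k, 'c) module
     \<Rightarrow> ('a \<Rightarrow> 'c) \<Rightarrow> ('b \<Rightarrow> 'c) \<Rightarrow> (('a \<times> 'b) \<Rightarrow>\<^sub>0 int) set \<Rightarrow> 'c" where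
  "product_lift K A B M f g = tensor_lift K A B (add_monoid M) (\<lambda>a b. f a \<otimes>\<^bsub>M\<^esub> g b)"

lemma linear_map_closed: "linear_map K A M f \<Longrightarrow> x \<in> carrier A \<Longrightarrow> f x \<in> carrier M"
  by (auto simp: linear_map_def)

lemma linear_map_add: "linear_map K A M f \<Longrightarrow> x \<in> carrier A \<Longrightarrow> y \<in> carrier A \<Longrightarrow>
    f (x \<oplus>\<^bsub>A\<^esub> y) = f x \<oplus>\<^bsub>M\<^esub> f y"
  by (auto simp: linear_map_def)

lemma linear_map_smult: "linear_map K A M f \<Longrightarrow> c \<in> carrier K \<Longrightarrow> x \<in> carrier A \<Longrightarrow>
    f (c \<odot>\<^bsub>A\<^esub> x) = c \<odot>\<^bsub>M\<^esub> f x"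
  by (auto simp: linear_map_def)

lemma linear_map_zero:
  assumes "abelian_group A" "abelian_group M" "linear_map K A M f"
  shows "f \<zero>\<^bsub>A\<^esub> = \<zero>\<^bsub>M\<^esub>"
proof -
  interpret A: abelian_group A by fact
  interpret M: abelian_group M by fact
  have "f \<zero>\<^bsub>A\<^esub> \<oplus>\<^bsub>M\<^esub> f \<zero>\<^bsub>A\<^esub> = f \<zero>\<^bsub>A\<^esub>"
    using linear_map_add[OF assms(3), of "\<zero>\<^bsub>A\<^esub>" "\<zero>\<^bsub>A\<^esub>"] by simp
  then show ?thesis
    using linear_map_closed[OF assms(3), of "\<zero>\<^bsub>A\<^esub>"]
    by (metis A.zero_closed M.add.l_cancel_one')
qed

lemma linear_map_finsum:
  assumes "abelian_group A" "abelian_group M" "linear_map K A M f" "\<And>i. i \<in> I \<Longrightarrow> x i \<in> carrier A"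
  shows "f (finsum A x I) = finsum M (\<lambda>i. f (x i)) I"
proof -
  interpret A: abelian_group A by fact
  interpret M: abelian_group M by fact
  show ?thesis using assms(4)
  proof (induction I rule: infinite_finite_induct)
    case (insert i I)
    then show ?case
      by (simp add: Pi_def linear_map_add[OF assms(3)] linear_map_closed[OF assms(3)])
  qed (simp_all add: linear_map_zero[OF assms(1-3)])
qed

lemma linear_map_comp: "linear_map K A B f \<Longrightarrow> linear_map K B C g \<Longrightarrow> linear_map K A C (\<lambda>x. g (f x))"
  by (auto simp: linear_map_def Pi_iff)

lemma algebra_map_linear: "algebra_map K A M f \<Longrightarrow> linear_map K A M f"
  by (simp add: algebra_map_def)

lemma algebra_map_mult: "algebra_map K A M f \<Longrightarrow> x \<in> carrier A \<Longrightarrow> y \<in> carrier A \<Longrightarrow>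
    f (x \<otimes>\<^bsub>A\<^esub> y) = f x \<otimes>\<^bsub>M\<^esub> f y"
  by (auto simp: algebra_map_def)

lemma algebra_map_one: "algebra_map K A M f \<Longrightarrow> f \<one>\<^bsub>A\<^esub> = \<one>\<^bsub>M\<^esub>"
  by (auto simp: algebra_map_def)

lemma algebra_map_comp:
  "algebra_map K A B f \<Longrightarrow> algebra_map K B C g \<Longrightarrow> algebra_map K A C (\<lambda>x. g (f x))"
  unfolding algebra_map_def
  by (auto simp: linear_map_closed[of K A B f] intro: linear_map_comp[of K A B f C g])

lemma commutingD: "commuting M A B f g \<Longrightarrow> a \<in> carrier A \<Longrightarrow> b \<in> carrier B \<Longrightarrow>
    f a \<otimes>\<^bsub>M\<^esub> g b = g b \<otimes>\<^bsub>M\<^esub> f a"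
  by (simp add: commuting_def)

lemma commuting_sym: "commuting M A B f g \<Longrightarrow> commuting M B A g f"
  by (auto simp: commuting_def)

lemma algebra_auto_map: "f \<in> algebra_auto K A \<Longrightarrow> algebra_map K A A f"
  by (auto simp: algebra_auto_def algebra_map_def linear_map_def ring_iso_def ring_hom_def)

lemma algebra_map_inv:
  assumes "monoid A" "monoid M" "algebra_map K A M f" "x \<in> Units A"
  shows "f x \<in> Units M" "inv\<^bsub>M\<^esub> (f x) = f (inv\<^bsub>A\<^esub> x)"
proof -
  interpret A: monoid A by fact
  interpret M: monoid M by fact
  note m = algebra_map_mult[OF assms(3), symmetric] algebra_map_one[OF assms(3)]
    linear_map_closed[OF algebra_map_linear[OF assms(3)]]
  have 1: "f x \<otimes>\<^bsub>M\<^esub> f (inv\<^bsub>A\<^esub> x) = \<one>\<^bsub>M\<^esub>" "f (inv\<^bsub>A\<^esub> x) \<otimes>\<^bsub>M\<^esub> f x = \<one>\<^bsub>M\<^esub>"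
    using assms(4) by (simp_all add: m A.Units_closed)
  show "f x \<in> Units M"
    unfolding Units_def using 1 assms(4)
    by (intro CollectI conjI bexI[of _ "f (inv\<^bsub>A\<^esub> x)"]) (auto simp: m A.Units_closed)
  show "inv\<^bsub>M\<^esub> (f x) = f (inv\<^bsub>A\<^esub> x)"
    using 1 assms(4) by (intro M.inv_char) (auto simp: m A.Units_closed)
qed

section \<open>Products of finite sums as sums over index tuples\<close>

lemma (in abelian_monoid) finsum_Times:
  assumes "finite I" "finite J" "\<And>i j. i \<in> I \<Longrightarrow> j \<in> J \<Longrightarrow> f (i, j) \<in> carrier G"
  shows "finsum G f (I \<times> J) = finsum G (\<lambda>i. finsum G (\<lambda>j. f (i, j)) J) I"
  using assms(1,3)
proof (induction I)
  case (insert i I)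
  have "finsum G f (insert i I \<times> J) = finsum G f (Pair i ` J \<union> I \<times> J)"
    by (rule arg_cong[of _ _ "finsum G f"]) auto
  also have "\<dots> = finsum G f (Pair i ` J) \<oplus> finsum G f (I \<times> J)"
    using insert assms(2) by (intro finsum_Un_disjoint) auto
  also have "finsum G f (Pair i ` J) = finsum G (\<lambda>j. f (i, j)) J"
    using insert by (intro finsum_reindex) (auto simp: inj_on_def)
  finally show ?case using insert by (simp add: Pi_def)
qed simp

text \<open>Condition (d) sums over the index of \<open>p'\<close> first, whereas the general
  treatment of triple products lists the indices in the order of the three tensors. A cyclic shift
  of the index triple mediates between the two.\<close>

lemma (in abelian_monoid) finsum_rotate:
  assumes "\<And>i j k. i \<in> I \<Longrightarrow> j \<in> J \<Longrightarrow> k \<in> L \<Longrightarrow> f i j k \<in> carrier G"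
  shows "finsum G (\<lambda>(k, i, j). f i j k) (L \<times> I \<times> J) = finsum G (\<lambda>(i, j, k). f i j k) (I \<times> J \<times> L)"
proof -
  let ?h = "\<lambda>(i, j, k). (k, i, j)"
  have "L \<times> I \<times> J = ?h ` (I \<times> J \<times> L)" by force
  then have "finsum G (\<lambda>(k, i, j). f i j k) (L \<times> I \<times> J)
      = finsum G (\<lambda>(k, i, j). f i j k) (?h ` (I \<times> J \<times> L))" by (simp only:)
  also have "\<dots> = finsum G (\<lambda>z. (\<lambda>(k, i, j). f i j k) (?h z)) (I \<times> J \<times> L)"
    using assms by (intro finsum_reindex) (auto simp: inj_on_def)
  also have "(\<lambda>z. (\<lambda>(k, i, j). f i j k) (?h z)) = (\<lambda>(i, j, k). f i j k)" by auto
  finally show ?thesis .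
qed

lemma (in ring) finsum_mult_finsum:
  assumes "finite I" "finite J" "\<And>i. i \<in> I \<Longrightarrow> f i \<in> carrier R" "\<And>j. j \<in> J \<Longrightarrow> g j \<in> carrier R"
  shows "finsum R f I \<otimes> finsum R g J = finsum R (\<lambda>(i, j). f i \<otimes> g j) (I \<times> J)"
proof -
  have "finsum R f I \<otimes> finsum R g J = finsum R (\<lambda>i. f i \<otimes> finsum R g J) I"
    using assms by (intro finsum_ldistr) (auto intro: finsum_closed)
  also have "\<dots> = finsum R (\<lambda>i. finsum R (\<lambda>j. f i \<otimes> g j) J) I"
    using assms by (intro finsum_cong') (auto intro: finsum_rdistr finsum_closed)
  finally show ?thesis using assms by (subst finsum_Times) auto
qed

text \<open>The factors change places while the index order stays: the two equations in (a) run over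
  the same index pairs with their products taken in opposite orders.\<close>

lemma (in ring) finsum_mult_finsum_swap:
  assumes "finite I" "finite J" "\<And>i. i \<in> I \<Longrightarrow> f i \<in> carrier R" "\<And>j. j \<in> J \<Longrightarrow> g j \<in> carrier R"
  shows "finsum R g J \<otimes> finsum R f I = finsum R (\<lambda>(i, j). g j \<otimes> f i) (I \<times> J)"
proof -
  have "finsum R g J \<otimes> finsum R f I = finsum R (\<lambda>i. finsum R g J \<otimes> f i) I"
    using assms by (intro finsum_rdistr) (auto intro: finsum_closed)
  also have "\<dots> = finsum R (\<lambda>i. finsum R (\<lambda>j. g j \<otimes> f i) J) I"
    using assms by (intro finsum_cong') (auto intro: finsum_ldistr finsum_closed)
  finally show ?thesis using assms by (subst finsum_Times) auto
qed

section \<open>Product maps from a tensor product into a target algebra\<close>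

context tensor_pair
begin

lemma tensor_expr_closed:
  assumes "tensor_expr K A B t I x y"
  shows "finite I" "\<And>i. i \<in> I \<Longrightarrow> x i \<in> carrier A" "\<And>i. i \<in> I \<Longrightarrow> y i \<in> carrier B"
    "t \<in> carrier T" "t = finsum T (\<lambda>i. tn (x i) (y i)) I"
  using assms unfolding tensor_expr_def by (auto simp: Pi_def)

text \<open>The definitions quantify over expressions indexed by sets of natural numbers, so an
  expression of exactly this kind is needed in order to exploit their conditions.\<close>

lemma ex_tensor_expr:
  assumes "t \<in> carrier T"
  shows "\<exists>(I :: nat set) x y. tensor_expr K A B t I x y"
  using assms
proof (induction rule: tensor_T_induct)
  case (tens a b)
  then have "tensor_expr K A B (tn a b) {0::nat} (\<lambda>_. a) (\<lambda>_. b)"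
    unfolding tensor_expr_def by (auto simp: T.finsum_insert T.finsum_empty)
  then show ?case by blast
next
  case (add s t)
  then obtain I J :: "nat set" and x y z w
    where s: "tensor_expr K A B s I x y" and t: "tensor_expr K A B t J z w" by blast
  \<comment> \<open>The two index sets are made disjoint by sending one to even and the other to odd
    numbers.\<close>
  let ?e = "\<lambda>n :: nat. 2 * n" and ?o = "\<lambda>n :: nat. 2 * n + 1"
  define x' where "x' n = (if even n then x (n div 2) else z (n div 2))" for n
  define y' where "y' n = (if even n then y (n div 2) else w (n div 2))" for n
  note s' = tensor_expr_closed[OF s] and t' = tensor_expr_closed[OF t]
  have "finsum T (\<lambda>n. tn (x' n) (y' n)) (?e ` I \<union> ?o ` J)
     = finsum T (\<lambda>n. tn (x' n) (y' n)) (?e ` I) \<oplus>\<^bsub>T\<^esub> finsum T (\<lambda>n. tn (x' n) (y' n)) (?o ` J)"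
    by (intro T.finsum_Un_disjoint) (auto simp: s' t' x'_def y'_def, presburger)
  also have "finsum T (\<lambda>n. tn (x' n) (y' n)) (?e ` I) = finsum T (\<lambda>n. tn (x' (?e n)) (y' (?e n))) I"
    by (intro T.finsum_reindex) (auto simp: inj_on_def s' x'_def y'_def)
  also have "finsum T (\<lambda>n. tn (x' n) (y' n)) (?o ` J) = finsum T (\<lambda>n. tn (x' (?o n)) (y' (?o n))) J"
    by (intro T.finsum_reindex) (auto simp: inj_on_def t' x'_def y'_def)
  finally have "tensor_expr K A B (s \<oplus>\<^bsub>T\<^esub> t) (?e ` I \<union> ?o ` J) x' y'"
    unfolding tensor_expr_def
    by (auto simp: x'_def y'_def s'(1-3) t'(1-3) simp flip: s'(5) t'(5))
  then show ?case by blast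
qed

text \<open>The uniqueness half of the universal property; it reduces the functoriality identities
  below to pure tensors.\<close>

lemma linear_map_ext:
  assumes "linear_map K T M f" "linear_map K T M g" "t \<in> carrier T"
    and "\<And>a b. a \<in> carrier A \<Longrightarrow> b \<in> carrier B \<Longrightarrow> f (tn a b) = g (tn a b)"
  shows "f t = g t"
  using assms(3) by (induction rule: tensor_T_induct)
    (simp_all add: assms(4) linear_map_add[OF assms(1)] linear_map_add[OF assms(2)])

text \<open>The universal property yields a group homomorphism only. Compatibility with scalars is
  the extra condition \<open>sm\<close> on pure tensors, extended by additivity.\<close>

lemma tensor_lift_linear:
  assumes M: "unital_algebra K M" and bal: "balanced K A B (add_monoid M) f"
    and sm: "\<And>c a b. c \<in> carrier K \<Longrightarrow> a \<in> carrier A \<Longrightarrow> b \<in> carrier B \<Longrightarrow> f (c \<odot>\<^bsub>A\<^esub> a) b = c \<odot>\<^bsub>M\<^esub> f a b"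
  shows "linear_map K T M (tensor_lift K A B (add_monoid M) f)"
    and "a \<in> carrier A \<Longrightarrow> b \<in> carrier B \<Longrightarrow> tensor_lift K A B (add_monoid M) f (tn a b) = f a b"
proof -
  interpret M: module K M by (rule unital_algebraD[OF M])
  note h = tensor_lift_hom[OF M.a_comm_group bal] and v = tensor_lift_tens[OF M.a_comm_group bal]
  let ?h = "tensor_lift K A B (add_monoid M) f"
  have cl: "?h t \<in> carrier M" if "t \<in> carrier T" for t
    using hom_in_carrier[OF h] that by (simp add: T_simps)
  have ad: "?h (s \<oplus>\<^bsub>T\<^esub> t) = ?h s \<oplus>\<^bsub>M\<^esub> ?h t" if "s \<in> carrier T" "t \<in> carrier T" for s t
    using hom_mult[OF h] that by (simp add: T_simps)
  have "?h (c \<odot>\<^bsub>T\<^esub> t) = c \<odot>\<^bsub>M\<^esub> ?h t" if c: "c \<in> carrier K" and "t \<in> carrier T" for c t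
    using that(2) by (induction rule: tensor_T_induct)
      (simp_all add: c T_smult_tens v sm T_smult_add ad cl M.smult_r_distr)
  then show "linear_map K T M ?h" using cl ad by (auto simp: linear_map_def)
  show "a \<in> carrier A \<Longrightarrow> b \<in> carrier B \<Longrightarrow> ?h (tn a b) = f a b" by (rule v)
qed

lemma product_lift_linear:
  assumes M: "unital_algebra K M" and f: "linear_map K A M f" and g: "linear_map K B M g"
  shows "linear_map K T M (product_lift K A B M f g)"
    and "a \<in> carrier A \<Longrightarrow> b \<in> carrier B \<Longrightarrow> product_lift K A B M f g (tn a b) = f a \<otimes>\<^bsub>M\<^esub> g b"
proof -
  interpret M: ring M by (rule unital_algebraD[OF M])
  have sm: "(c \<odot>\<^bsub>M\<^esub> x) \<otimes>\<^bsub>M\<^esub> y = c \<odot>\<^bsub>M\<^esub> (x \<otimes>\<^bsub>M\<^esub> y)" "x \<otimes>\<^bsub>M\<^esub> (c \<odot>\<^bsub>M\<^esub> y) = c \<odot>\<^bsub>M\<^esub> (x \<otimes>\<^bsub>M\<^esub> y)"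
    if "c \<in> carrier K" "x \<in> carrier M" "y \<in> carrier M" for c x y
    using M that by (auto simp: unital_algebra_def)
  note s = sm linear_map_closed[OF f] linear_map_closed[OF g] linear_map_add[OF f]
    linear_map_add[OF g] linear_map_smult[OF f] linear_map_smult[OF g] M.l_distr M.r_distr
  have 1: "balanced K A B (add_monoid M) (\<lambda>a b. f a \<otimes>\<^bsub>M\<^esub> g b)"
    unfolding balanced_def by (auto simp: s)
  show "linear_map K T M (product_lift K A B M f g)"
    unfolding product_lift_def by (intro tensor_lift_linear M 1) (auto simp: s)
  show "a \<in> carrier A \<Longrightarrow> b \<in> carrier B \<Longrightarrow> product_lift K A B M f g (tn a b) = f a \<otimes>\<^bsub>M\<^esub> g b"
    unfolding product_lift_def by (intro tensor_lift_linear M 1) (auto simp: s)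
qed

text \<open>Passage from the summation convention to \<open>product_lift\<close>. Every expression
  of \<open>t\<close> evaluates the same map, which is why index formulas do not depend on the
  expression chosen.\<close>

lemma product_lift_expr:
  assumes "unital_algebra K M" "linear_map K A M f" "linear_map K B M g" "tensor_expr K A B t I x y"
  shows "product_lift K A B M f g t = finsum M (\<lambda>i. f (x i) \<otimes>\<^bsub>M\<^esub> g (y i)) I"
proof -
  interpret M: ring M by (rule unital_algebraD[OF assms(1)])
  note t = tensor_expr_closed[OF assms(4)]
  have "product_lift K A B M f g t = finsum M (\<lambda>i. product_lift K A B M f g (tn (x i) (y i))) I"
    unfolding t(5) by (intro linear_map_finsum[OF abelian_group_T M.is_abelian_group product_lift_linear(1)] assms)
      (simp add: t)
  also have "\<dots> = finsum M (\<lambda>i. f (x i) \<otimes>\<^bsub>M\<^esub> g (y i)) I"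
    using t by (intro M.finsum_cong')
      (auto simp: product_lift_linear(2)[OF assms(1-3)] linear_map_closed[OF assms(2)] linear_map_closed[OF assms(3)])
  finally show ?thesis .
qed

lemma product_lift_commute:
  assumes M: "unital_algebra K M" and f: "linear_map K A M f" and g: "linear_map K B M g"
    and z: "z \<in> carrier M"
    and "\<And>a. a \<in> carrier A \<Longrightarrow> f a \<otimes>\<^bsub>M\<^esub> z = z \<otimes>\<^bsub>M\<^esub> f a"
    and "\<And>b. b \<in> carrier B \<Longrightarrow> g b \<otimes>\<^bsub>M\<^esub> z = z \<otimes>\<^bsub>M\<^esub> g b"
    and t: "t \<in> carrier T"
  shows "product_lift K A B M f g t \<otimes>\<^bsub>M\<^esub> z = z \<otimes>\<^bsub>M\<^esub> product_lift K A B M f g t"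
proof -
  interpret M: ring M by (rule unital_algebraD[OF M])
  note c = product_lift_linear[OF M f g]
  from t show ?thesis
  proof (induction rule: tensor_T_induct)
    case (tens a b)
    note ab = linear_map_closed[OF f tens(1)] linear_map_closed[OF g tens(2)]
    have "f a \<otimes>\<^bsub>M\<^esub> g b \<otimes>\<^bsub>M\<^esub> z = f a \<otimes>\<^bsub>M\<^esub> (z \<otimes>\<^bsub>M\<^esub> g b)"
      using ab z tens assms(6) by (simp add: M.m_assoc)
    also have "\<dots> = z \<otimes>\<^bsub>M\<^esub> (f a \<otimes>\<^bsub>M\<^esub> g b)"
      using ab z tens assms(5) by (simp add: M.m_assoc[symmetric])
    finally show ?case using tens by (simp add: c)
  next
    case (add s t)
    then show ?case
      using z by (simp add: linear_map_add[OF c(1)] linear_map_closed[OF c(1)] M.l_distr M.r_distr)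
  qed
qed

text \<open>On pure tensors multiplicativity amounts to exchanging the inner factors
  \<open>f a'\<close> and \<open>g b\<close>, which commuting images permit; distributivity extends
  it to sums.\<close>

lemma product_lift_algebra_map:
  assumes M: "unital_algebra K M" and f: "algebra_map K A M f" and g: "algebra_map K B M g"
    and fg: "commuting M A B f g"
  shows "algebra_map K T M (product_lift K A B M f g)"
proof -
  interpret M: ring M by (rule unital_algebraD[OF M])
  interpret T: ring T by (rule ring_T)
  note fl = algebra_map_linear[OF f] and gl = algebra_map_linear[OF g]
  note c = product_lift_linear[OF M fl gl]
  note cl = linear_map_closed[OF fl] linear_map_closed[OF gl] linear_map_closed[OF c(1)]
  let ?c = "product_lift K A B M f g"
  have "?c (s \<otimes>\<^bsub>T\<^esub> t) = ?c s \<otimes>\<^bsub>M\<^esub> ?c t" if "s \<in> carrier T" and t: "t \<in> carrier T" for s t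
    using that(1)
  proof (induction rule: tensor_T_induct)
    case (tens a b)
    show ?case using t
    proof (induction rule: tensor_T_induct)
      case (tens a' b')
      have "?c (tn a b \<otimes>\<^bsub>T\<^esub> tn a' b') = f a \<otimes>\<^bsub>M\<^esub> (f a' \<otimes>\<^bsub>M\<^esub> g b) \<otimes>\<^bsub>M\<^esub> g b'"
        using tens \<open>a \<in> _\<close> \<open>b \<in> _\<close>
        by (simp add: c algebra_map_mult[OF f] algebra_map_mult[OF g] cl M.m_assoc)
      also have "\<dots> = f a \<otimes>\<^bsub>M\<^esub> (g b \<otimes>\<^bsub>M\<^esub> f a') \<otimes>\<^bsub>M\<^esub> g b'"
        using tens \<open>b \<in> _\<close> commutingD[OF fg] by simp
      finally show ?case
        using tens \<open>a \<in> _\<close> \<open>b \<in> _\<close> by (simp add: c cl M.m_assoc)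
    next
      case (add s t)
      then show ?case using tens by (simp add: linear_map_add[OF c(1)] cl T.r_distr M.r_distr)
    qed
  next
    case (add s s')
    then show ?case using t by (simp add: linear_map_add[OF c(1)] cl T.l_distr M.l_distr)
  qed
  moreover have "?c \<one>\<^bsub>T\<^esub> = \<one>\<^bsub>M\<^esub>"
    by (simp add: T_simps c algebra_map_one[OF f] algebra_map_one[OF g])
  ultimately show ?thesis using c(1) by (simp add: algebra_map_def)
qed

lemma embed_left: "algebra_map K A T (\<lambda>a. tn a \<one>\<^bsub>B\<^esub>)"
  unfolding algebra_map_def linear_map_def
  by (auto simp: tens_add T_smult_tens T_simps(4))

lemma embed_right: "algebra_map K B T (\<lambda>b. tn \<one>\<^bsub>A\<^esub> b)"
  unfolding algebra_map_def linear_map_def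
  by (auto simp: tens_add T_smult_tens tens_balanced T_simps(4))

end

text \<open>An element that commutes with the images of both factors commutes with every sum of
  products of them. Using this for one tensor and then for the other reduces the claim to four pairs
  of maps.\<close>

lemma product_lift_commuting:
  assumes "unital_algebra K A" "unital_algebra K B" "unital_algebra K C" "unital_algebra K D"
    and M: "unital_algebra K M"
    and f: "linear_map K A M f" and g: "linear_map K B M g"
    and f': "linear_map K C M f'" and g': "linear_map K D M g'"
    and "commuting M A C f f'" "commuting M A D f g'" "commuting M B C g f'" "commuting M B D g g'"
  shows "commuting M (tensor_alg K A B) (tensor_alg K C D) (product_lift K A B M f g) (product_lift K C D M f' g')"
proof -
  interpret AB: tensor_pair K A B using assms by unfold_locales
  interpret CD: tensor_pair K C D using assms by unfold_locales
  note c = linear_map_closed[OF f] linear_map_closed[OF g] linear_map_closed[OF f'] linear_map_closed[OF g']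
  have 1: "product_lift K C D M f' g' t \<otimes>\<^bsub>M\<^esub> f a = f a \<otimes>\<^bsub>M\<^esub> product_lift K C D M f' g' t"
    if "t \<in> carrier (tensor_alg K C D)" "a \<in> carrier A" for t a
    using that assms by (intro CD.product_lift_commute) (auto simp: c commuting_def)
  have 2: "product_lift K C D M f' g' t \<otimes>\<^bsub>M\<^esub> g a = g a \<otimes>\<^bsub>M\<^esub> product_lift K C D M f' g' t"
    if "t \<in> carrier (tensor_alg K C D)" "a \<in> carrier B" for t a
    using that assms by (intro CD.product_lift_commute) (auto simp: c commuting_def)
  show ?thesis unfolding commuting_def
    by (intro ballI AB.product_lift_commute M f g)
      (auto simp: 1 2 linear_map_closed[OF CD.product_lift_linear(1)[OF M f' g']])
qed

subsection \<open>Functoriality, opposite algebras and triple products\<close>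

text \<open>\<open>tensor_map\<close> lifts into the bare group, the linearity results lift into the
  additive monoid of the algebra. Both targets have the same homomorphisms, so the
  \<open>SOME\<close> in the two lifts ranges over the same predicate.\<close>

lemma tensor_lift_tensor_group:
  "tensor_lift K A B (tensor_group K C D) f = tensor_lift K A B (add_monoid (tensor_alg K C D)) f"
proof -
  have "hom (tensor_group K A B) (tensor_group K C D)
      = hom (tensor_group K A B) (add_monoid (tensor_alg K C D))"
    by (simp add: hom_def tensor_alg_def Let_def)
  then show ?thesis by (simp add: tensor_lift_def)
qed

lemma tensor_map:
  assumes A: "unital_algebra K A" and B: "unital_algebra K B"
    and C: "unital_algebra K C" and D: "unital_algebra K D"
    and f: "linear_map K A C f" and g: "linear_map K B D g"
  shows tensor_map_linear: "linear_map K (tensor_alg K A B) (tensor_alg K C D) (tensor_map K A B C D f g)"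
    and tensor_map_tens: "a \<in> carrier A \<Longrightarrow> b \<in> carrier B \<Longrightarrow>
      tensor_map K A B C D f g (tens K A B a b) = tens K C D (f a) (g b)"
proof -
  interpret AB: tensor_pair K A B using A B by unfold_locales
  interpret CD: tensor_pair K C D using C D by unfold_locales
  note s = linear_map_closed[OF f] linear_map_closed[OF g] linear_map_add[OF f]
    linear_map_add[OF g] linear_map_smult[OF f] linear_map_smult[OF g] CD.tens_add
    CD.tens_balanced CD.T_smult_tens
  have bal: "balanced K A B (add_monoid (tensor_alg K C D)) (\<lambda>a b. tens K C D (f a) (g b))"
    unfolding balanced_def by (auto simp: s)
  show "linear_map K (tensor_alg K A B) (tensor_alg K C D) (tensor_map K A B C D f g)"
    unfolding tensor_map_def tensor_lift_tensor_group
    by (intro AB.tensor_lift_linear CD.unital_algebra_T bal) (simp add: s)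
  show "a \<in> carrier A \<Longrightarrow> b \<in> carrier B \<Longrightarrow>
      tensor_map K A B C D f g (tens K A B a b) = tens K C D (f a) (g b)"
    unfolding tensor_map_def tensor_lift_tensor_group
    by (intro AB.tensor_lift_linear CD.unital_algebra_T bal) (simp_all add: s)
qed

text \<open>Twists of a tensor are absorbed into the maps along which it is placed. Invariance of a
  tensor thereby becomes the freedom to twist both of its maps.\<close>

lemma product_lift_tensor_map:
  assumes A: "unital_algebra K A" and B: "unital_algebra K B"
    and C: "unital_algebra K C" and D: "unital_algebra K D" and M: "unital_algebra K M"
    and f: "linear_map K A C f" and g: "linear_map K B D g"
    and f': "linear_map K C M f'" and g': "linear_map K D M g'"
    and t: "t \<in> carrier (tensor_alg K A B)"
  shows "product_lift K C D M f' g' (tensor_map K A B C D f g t) = product_lift K A B M (\<lambda>a. f' (f a)) (\<lambda>b. g' (g b)) t"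
proof -
  interpret AB: tensor_pair K A B using A B by unfold_locales
  interpret CD: tensor_pair K C D using C D by unfold_locales
  note ff = linear_map_comp[OF f f'] and gg = linear_map_comp[OF g g']
  show ?thesis
    by (rule AB.linear_map_ext[OF linear_map_comp[OF tensor_map_linear[OF A B C D f g] CD.product_lift_linear(1)[OF M f' g']]
          AB.product_lift_linear(1)[OF M ff gg] t])
      (simp add: tensor_map_tens[OF A B C D f g] CD.product_lift_linear(2)[OF M f' g'] AB.product_lift_linear(2)[OF M ff gg]
        linear_map_closed[OF f] linear_map_closed[OF g])
qed

lemma algebra_map_product_lift:
  assumes A: "unital_algebra K A" and B: "unital_algebra K B" and M: "unital_algebra K M"
    and N: "unital_algebra K N" and f: "linear_map K A M f" and g: "linear_map K B M g"
    and h: "algebra_map K M N h" and t: "t \<in> carrier (tensor_alg K A B)"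
  shows "h (product_lift K A B M f g t) = product_lift K A B N (\<lambda>a. h (f a)) (\<lambda>b. h (g b)) t"
proof -
  interpret AB: tensor_pair K A B using A B by unfold_locales
  note hl = algebra_map_linear[OF h]
  note fh = linear_map_comp[OF f hl] and gh = linear_map_comp[OF g hl]
  show ?thesis
    by (rule AB.linear_map_ext[OF linear_map_comp[OF AB.product_lift_linear(1)[OF M f g] hl]
          AB.product_lift_linear(1)[OF N fh gh] t])
      (simp add: AB.product_lift_linear(2)[OF M f g] AB.product_lift_linear(2)[OF N fh gh] algebra_map_mult[OF h]
        linear_map_closed[OF f] linear_map_closed[OF g])
qed

lemma tensor_map_algebra_map:
  assumes A: "unital_algebra K A" and B: "unital_algebra K B"
    and C: "unital_algebra K C" and D: "unital_algebra K D"
    and f: "algebra_map K A C f" and g: "algebra_map K B D g"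
  shows "algebra_map K (tensor_alg K A B) (tensor_alg K C D) (tensor_map K A B C D f g)"
proof -
  interpret AB: tensor_pair K A B using A B by unfold_locales
  interpret CD: tensor_pair K C D using C D by unfold_locales
  interpret S: ring "tensor_alg K A B" by (rule AB.ring_T)
  interpret T: ring "tensor_alg K C D" by (rule CD.ring_T)
  note fl = algebra_map_linear[OF f] and gl = algebra_map_linear[OF g]
  let ?h = "tensor_map K A B C D f g"
  note l = tensor_map_linear[OF A B C D fl gl] and tt = tensor_map_tens[OF A B C D fl gl]
  note c = linear_map_closed[OF fl] linear_map_closed[OF gl] linear_map_closed[OF l]
  have "?h (s \<otimes>\<^bsub>tensor_alg K A B\<^esub> t) = ?h s \<otimes>\<^bsub>tensor_alg K C D\<^esub> ?h t"
    if "s \<in> carrier (tensor_alg K A B)" and t: "t \<in> carrier (tensor_alg K A B)" for s t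
    using that(1)
  proof (induction rule: AB.tensor_T_induct)
    case (tens a b)
    show ?case using t
    proof (induction rule: AB.tensor_T_induct)
      case (tens a' b')
      then show ?case using \<open>a \<in> _\<close> \<open>b \<in> _\<close>
        by (simp add: tt c algebra_map_mult[OF f] algebra_map_mult[OF g])
    next
      case (add s t)
      then show ?case using tens by (simp add: linear_map_add[OF l] c S.r_distr T.r_distr)
    qed
  next
    case (add s s')
    then show ?case using t by (simp add: linear_map_add[OF l] c S.l_distr T.l_distr)
  qed
  then show ?thesis using l
    by (simp add: algebra_map_def AB.T_simps(4) CD.T_simps(4) tt algebra_map_one[OF f] algebra_map_one[OF g])
qed

lemma tensor_map_comp:
  assumes A: "unital_algebra K A" and B: "unital_algebra K B"
    and f: "linear_map K A A f" and g: "linear_map K B B g"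
    and f': "linear_map K A A f'" and g': "linear_map K B B g'"
    and t: "t \<in> carrier (tensor_alg K A B)"
  shows "tensor_map K A B A B f' g' (tensor_map K A B A B f g t)
       = tensor_map K A B A B (\<lambda>x. f' (f x)) (\<lambda>y. g' (g y)) t"
proof -
  interpret AB: tensor_pair K A B using A B by unfold_locales
  note tl = tensor_map_linear[OF A B A B] and tt = tensor_map_tens[OF A B A B]
  note ff = linear_map_comp[OF f f'] linear_map_comp[OF g g']
  show ?thesis
    by (rule AB.linear_map_ext[OF linear_map_comp[OF tl[OF f g] tl[OF f' g']] tl[OF ff] t])
      (simp add: tt[OF f g] tt[OF f' g'] tt[OF ff] linear_map_closed[OF f] linear_map_closed[OF g])
qed

lemma tensor_map_cong:
  assumes A: "unital_algebra K A" and B: "unital_algebra K B"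
    and "linear_map K A A f" "linear_map K B B g" "linear_map K A A f'" "linear_map K B B g'"
    and t: "t \<in> carrier (tensor_alg K A B)"
    and "\<And>a. a \<in> carrier A \<Longrightarrow> f a = f' a" "\<And>b. b \<in> carrier B \<Longrightarrow> g b = g' b"
  shows "tensor_map K A B A B f g t = tensor_map K A B A B f' g' t"
proof -
  interpret AB: tensor_pair K A B using A B by unfold_locales
  note tl = tensor_map_linear[OF A B A B] and tt = tensor_map_tens[OF A B A B]
  show ?thesis
    by (rule AB.linear_map_ext[OF tl[OF assms(3,4)] tl[OF assms(5,6)] t])
      (simp add: tt[OF assms(3,4)] tt[OF assms(5,6)] assms(8,9))
qed

lemma tensor_map_id:
  assumes A: "unital_algebra K A" and B: "unital_algebra K B"
    and f: "linear_map K A A f" and g: "linear_map K B B g"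
    and t: "t \<in> carrier (tensor_alg K A B)"
    and "\<And>a. a \<in> carrier A \<Longrightarrow> f a = a" "\<And>b. b \<in> carrier B \<Longrightarrow> g b = b"
  shows "tensor_map K A B A B f g t = t"
proof -
  interpret AB: tensor_pair K A B using A B by unfold_locales
  have "linear_map K (tensor_alg K A B) (tensor_alg K A B) (\<lambda>x. x)" by (simp add: linear_map_def)
  from AB.linear_map_ext[OF tensor_map_linear[OF A B A B f g] this t] show ?thesis
    by (simp add: tensor_map_tens[OF A B A B f g] assms)
qed

lemma algebra_auto_inv_into:
  fixes X :: "('k, 'a) module"
  assumes X: "unital_algebra K X" and h: "h \<in> algebra_auto K X"
  shows "inv_into (carrier X) h \<in> algebra_auto K X"
    and "\<And>x. x \<in> carrier X \<Longrightarrow> inv_into (carrier X) h (h x) = x"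
    and "\<And>x. x \<in> carrier X \<Longrightarrow> h (inv_into (carrier X) h x) = x"
proof -
  have b: "bij_betw h (carrier X) (carrier X)" and i: "h \<in> ring_iso X X"
    using h by (auto simp: algebra_auto_def ring_iso_def)
  note l = algebra_map_linear[OF algebra_auto_map[OF h]]
  show 1: "\<And>x. x \<in> carrier X \<Longrightarrow> inv_into (carrier X) h (h x) = x"
    using b by (simp add: bij_betw_inv_into_left)
  show 2: "\<And>x. x \<in> carrier X \<Longrightarrow> h (inv_into (carrier X) h x) = x"
    using b by (simp add: bij_betw_inv_into_right)
  have 3: "\<And>x. x \<in> carrier X \<Longrightarrow> inv_into (carrier X) h x \<in> carrier X"
    using b by (metis bij_betw_def inv_into_into)
  have "inv_into (carrier X) h (c \<odot>\<^bsub>X\<^esub> x) = c \<odot>\<^bsub>X\<^esub> inv_into (carrier X) h x"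
    if "c \<in> carrier K" "x \<in> carrier X" for c x
    using linear_map_smult[OF l that(1) 3[OF that(2)]] that 1 2 3
      module.smult_closed[OF unital_algebraD(3)[OF X]] by metis
  then show "inv_into (carrier X) h \<in> algebra_auto K X"
    using ring_iso_set_sym[OF unital_algebraD(2)[OF X] i] by (simp add: algebra_auto_def)
qed

text \<open>Bijectivity comes from an explicit inverse, the tensor product of the two inverse
  automorphisms.\<close>

lemma tensor_map_auto:
  assumes A: "unital_algebra K A" and B: "unital_algebra K B"
    and f: "f \<in> algebra_auto K A" and g: "g \<in> algebra_auto K B"
  shows "tensor_map K A B A B f g \<in> algebra_auto K (tensor_alg K A B)"
proof -
  note f' = algebra_auto_inv_into[OF A f] and g' = algebra_auto_inv_into[OF B g]
  let ?T = "tensor_alg K A B" and ?h = "tensor_map K A B A B f g"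
  let ?k = "tensor_map K A B A B (inv_into (carrier A) f) (inv_into (carrier B) g)"
  note am = algebra_auto_map and al = algebra_map_linear[OF algebra_auto_map]
  have h: "algebra_map K ?T ?T ?h" and k: "algebra_map K ?T ?T ?k"
    by (intro tensor_map_algebra_map A B am f g f'(1) g'(1))+
  note c = linear_map_closed[OF algebra_map_linear[OF h]] linear_map_closed[OF algebra_map_linear[OF k]]
  have "?k (?h t) = t" if "t \<in> carrier ?T" for t
    unfolding tensor_map_comp[OF A B al[OF f] al[OF g] al[OF f'(1)] al[OF g'(1)] that]
    by (rule tensor_map_id[OF A B linear_map_comp[OF al[OF f] al[OF f'(1)]] linear_map_comp[OF al[OF g] al[OF g'(1)]] that])
      (simp_all add: f' g')
  moreover have "?h (?k t) = t" if "t \<in> carrier ?T" for t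
    unfolding tensor_map_comp[OF A B al[OF f'(1)] al[OF g'(1)] al[OF f] al[OF g] that]
    by (rule tensor_map_id[OF A B linear_map_comp[OF al[OF f'(1)] al[OF f]] linear_map_comp[OF al[OF g'(1)] al[OF g]] that])
      (simp_all add: f' g')
  ultimately have "bij_betw ?h (carrier ?T) (carrier ?T)"
    using c by (intro bij_betw_byWitness[where f' = ?k]) auto
  then show ?thesis
    using h by (auto simp: algebra_auto_def algebra_map_def linear_map_def ring_iso_def ring_hom_def)
qed

section \<open>Opposite algebras and tensor products with them\<close>

lemma opposite_simps [simp]:
  "carrier (opposite A) = carrier A" "x \<oplus>\<^bsub>opposite A\<^esub> y = x \<oplus>\<^bsub>A\<^esub> y" "\<zero>\<^bsub>opposite A\<^esub> = \<zero>\<^bsub>A\<^esub>"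
  "\<one>\<^bsub>opposite A\<^esub> = \<one>\<^bsub>A\<^esub>" "x \<otimes>\<^bsub>opposite A\<^esub> y = y \<otimes>\<^bsub>A\<^esub> x" "c \<odot>\<^bsub>opposite A\<^esub> x = c \<odot>\<^bsub>A\<^esub> x"
  by (simp_all add: opposite_def)

lemma unital_algebra_opposite:
  assumes "unital_algebra K A"
  shows "unital_algebra K (opposite A)"
proof -
  interpret A: ring A by (rule unital_algebraD[OF assms])
  interpret MA: module K A by (rule unital_algebraD[OF assms])
  have g: "abelian_group (opposite A)"
    by (rule abelian_groupI) (auto simp: A.a_ac intro: A.add.l_inv_ex)
  have "ring (opposite A)"
    by (rule ringI[OF g]) (auto intro!: monoidI simp: A.m_assoc A.l_distr A.r_distr)
  moreover have "module K (opposite A)"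
    by (rule moduleI[OF MA.R.is_cring g]) (auto simp: MA.smult_l_distr MA.smult_r_distr MA.smult_assoc1)
  ultimately show ?thesis
    using assms by (simp add: unital_algebra_def)
qed

lemma linear_map_opposite [simp]:
  "linear_map K (opposite A) M f = linear_map K A M f" "linear_map K A (opposite M) f = linear_map K A M f"
  by (simp_all add: linear_map_def)

lemma algebra_map_opposite: "algebra_map K A M f \<Longrightarrow> algebra_map K (opposite A) (opposite M) f"
  by (simp add: algebra_map_def)

text \<open>The additive group of a tensor product is built from addition and scalars, which
  \<open>opposite\<close> leaves alone. The equalities are literal, so the same element can be read
  in a tensor product with \<open>B\<close> and with its opposite.\<close>

lemma tensor_opposite:
  "tensor_relations K A (opposite B) = tensor_relations K A B"
  "tensor_null K A (opposite B) = tensor_null K A B"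
  "tensor_group K A (opposite B) = tensor_group K A B"
  "tens K A (opposite B) = tens K A B"
  "tensor_lift K A (opposite B) = tensor_lift K A B"
proof -
  show 1: "tensor_relations K A (opposite B) = tensor_relations K A B"
    by (simp add: tensor_relations_def)
  show 2: "tensor_null K A (opposite B) = tensor_null K A B"
    by (simp add: tensor_null_def 1)
  show 3: "tensor_group K A (opposite B) = tensor_group K A B"
    by (simp add: tensor_group_def 2)
  show 4: "tens K A (opposite B) = tens K A B"
    by (intro ext) (simp add: tens_def 2)
  show "tensor_lift K A (opposite B) = tensor_lift K A B"
    by (intro ext) (simp add: tensor_lift_def 3 4)
qed

lemma product_lift_opposite: "product_lift K A (opposite B) M f g = product_lift K A B M f g"
  by (intro ext) (simp add: product_lift_def tensor_opposite)

lemma carrier_tensor_opposite: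
  "carrier (tensor_alg K A (opposite B)) = carrier (tensor_alg K A B)"
  by (simp add: tensor_alg_def Let_def tensor_opposite)

lemma (in ring) finsum_mult_finsum3:
  assumes "finite I" "finite J" "finite L" "\<And>i. i \<in> I \<Longrightarrow> f i \<in> carrier R"
    "\<And>j. j \<in> J \<Longrightarrow> g j \<in> carrier R" "\<And>k. k \<in> L \<Longrightarrow> h k \<in> carrier R"
  shows "finsum R f I \<otimes> (finsum R g J \<otimes> finsum R h L)
      = finsum R (\<lambda>(i, j, k). f i \<otimes> (g j \<otimes> h k)) (I \<times> J \<times> L)"
    and "finsum R h L \<otimes> (finsum R g J \<otimes> finsum R f I)
      = finsum R (\<lambda>(i, j, k). h k \<otimes> (g j \<otimes> f i)) (I \<times> J \<times> L)"
proof -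
  have "finsum R f I \<otimes> finsum R (\<lambda>(j, k). g j \<otimes> h k) (J \<times> L)
      = finsum R (\<lambda>(i, z). f i \<otimes> (\<lambda>(j, k). g j \<otimes> h k) z) (I \<times> J \<times> L)"
    using assms by (intro finsum_mult_finsum) auto
  also have "(\<lambda>(i, z). f i \<otimes> (\<lambda>(j, k). g j \<otimes> h k) z) = (\<lambda>(i, j, k). f i \<otimes> (g j \<otimes> h k))"
    by auto
  finally show "finsum R f I \<otimes> (finsum R g J \<otimes> finsum R h L)
      = finsum R (\<lambda>(i, j, k). f i \<otimes> (g j \<otimes> h k)) (I \<times> J \<times> L)"
    using assms by (simp add: finsum_mult_finsum)
  have "finsum R h L \<otimes> (finsum R g J \<otimes> finsum R f I) = (finsum R h L \<otimes> finsum R g J) \<otimes> finsum R f I"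
    using assms by (intro m_assoc[symmetric] finsum_closed) auto
  also have "\<dots> = finsum R (\<lambda>(j, k). h k \<otimes> g j) (J \<times> L) \<otimes> finsum R f I"
    using assms by (simp add: finsum_mult_finsum_swap)
  also have "\<dots> = finsum R (\<lambda>(i, z). (\<lambda>(j, k). h k \<otimes> g j) z \<otimes> f i) (I \<times> J \<times> L)"
    using assms by (intro finsum_mult_finsum_swap) auto
  also have "\<dots> = finsum R (\<lambda>(i, j, k). h k \<otimes> (g j \<otimes> f i)) (I \<times> J \<times> L)"
    using assms by (intro finsum_cong') (auto simp: m_assoc)
  finally show "finsum R h L \<otimes> (finsum R g J \<otimes> finsum R f I)
      = finsum R (\<lambda>(i, j, k). h k \<otimes> (g j \<otimes> f i)) (I \<times> J \<times> L)" .
qed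

text \<open>Expanding a product of three placed tensors lists the letters tensor by tensor. Sorting
  them by \<open>a\<close>, \<open>b\<close>, \<open>c\<close> exchanges only letters of different
  maps, so the order within each map survives; the two resulting index patterns are the two sides of
  a Yang-Baxter relation.\<close>

lemma triple_sum:
  assumes A: "unital_algebra K A" and B: "unital_algebra K B" and C: "unital_algebra K C"
    and M: "unital_algebra K M"
    and a: "algebra_map K A M a" and b: "algebra_map K B M b" and c: "algebra_map K C M c"
    and ab: "commuting M A B a b" and ac: "commuting M A C a c" and bc: "commuting M B C b c"
    and s: "tensor_expr K A B s I x y" and t: "tensor_expr K A C t J z w" and u: "tensor_expr K B C u L v q"
  shows triple_sum_left: "finsum M (\<lambda>(i, j, k).
        a (x i \<otimes>\<^bsub>A\<^esub> z j) \<otimes>\<^bsub>M\<^esub> b (y i \<otimes>\<^bsub>B\<^esub> v k) \<otimes>\<^bsub>M\<^esub> c (w j \<otimes>\<^bsub>C\<^esub> q k)) (I \<times> J \<times> L)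
      = product_lift K A B M a b s \<otimes>\<^bsub>M\<^esub> (product_lift K A C M a c t \<otimes>\<^bsub>M\<^esub> product_lift K B C M b c u)" (is ?left)
    and triple_sum_right: "finsum M (\<lambda>(i, j, k).
        a (z j \<otimes>\<^bsub>A\<^esub> x i) \<otimes>\<^bsub>M\<^esub> b (v k \<otimes>\<^bsub>B\<^esub> y i) \<otimes>\<^bsub>M\<^esub> c (q k \<otimes>\<^bsub>C\<^esub> w j)) (I \<times> J \<times> L)
      = product_lift K B C M b c u \<otimes>\<^bsub>M\<^esub> (product_lift K A C M a c t \<otimes>\<^bsub>M\<^esub> product_lift K A B M a b s)" (is ?right)
proof -
  interpret M: ring M by (rule unital_algebraD[OF M])
  interpret AB: tensor_pair K A B using A B by unfold_locales
  interpret AC: tensor_pair K A C using A C by unfold_locales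
  interpret BC: tensor_pair K B C using B C by unfold_locales
  note al = algebra_map_linear[OF a] and bl = algebra_map_linear[OF b] and cl = algebra_map_linear[OF c]
  note s' = AB.tensor_expr_closed(1-3)[OF s] and t' = AC.tensor_expr_closed(1-3)[OF t]
    and u' = BC.tensor_expr_closed(1-3)[OF u]
  note m = algebra_map_mult[OF a] algebra_map_mult[OF b] algebra_map_mult[OF c]
  note cc = linear_map_closed[OF al] linear_map_closed[OF bl] linear_map_closed[OF cl]
  note e = AB.product_lift_expr[OF M al bl s] AC.product_lift_expr[OF M al cl t] BC.product_lift_expr[OF M bl cl u]
  have swap: "p \<otimes>\<^bsub>M\<^esub> (r \<otimes>\<^bsub>M\<^esub> n) = r \<otimes>\<^bsub>M\<^esub> (p \<otimes>\<^bsub>M\<^esub> n)"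
    if "p \<otimes>\<^bsub>M\<^esub> r = r \<otimes>\<^bsub>M\<^esub> p" "p \<in> carrier M" "r \<in> carrier M" "n \<in> carrier M" for p r n
    using that by (metis M.m_assoc)
  \<comment> \<open>In right-nested products these exchange rules act as a sorting procedure that
    puts \<open>a\<close> before \<open>b\<close> before \<open>c\<close>.\<close>
  have ba': "b p \<otimes>\<^bsub>M\<^esub> (a r \<otimes>\<^bsub>M\<^esub> n) = a r \<otimes>\<^bsub>M\<^esub> (b p \<otimes>\<^bsub>M\<^esub> n)"
    if "p \<in> carrier B" "r \<in> carrier A" "n \<in> carrier M" for p r n
    using that commutingD[OF ab, of r p] by (intro swap) (auto simp: cc)
  have ca': "c p \<otimes>\<^bsub>M\<^esub> (a r \<otimes>\<^bsub>M\<^esub> n) = a r \<otimes>\<^bsub>M\<^esub> (c p \<otimes>\<^bsub>M\<^esub> n)"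
    if "p \<in> carrier C" "r \<in> carrier A" "n \<in> carrier M" for p r n
    using that commutingD[OF ac, of r p] by (intro swap) (auto simp: cc)
  have cb': "c p \<otimes>\<^bsub>M\<^esub> (b r \<otimes>\<^bsub>M\<^esub> n) = b r \<otimes>\<^bsub>M\<^esub> (c p \<otimes>\<^bsub>M\<^esub> n)"
    if "p \<in> carrier C" "r \<in> carrier B" "n \<in> carrier M" for p r n
    using that commutingD[OF bc, of r p] by (intro swap) (auto simp: cc)
  note comm = commutingD[OF ab, symmetric] commutingD[OF ac, symmetric] commutingD[OF bc, symmetric]
  show ?left
    unfolding e using s' t' u'
    by (subst M.finsum_mult_finsum3(1); (intro M.finsum_cong')?) (auto simp: m cc M.m_assoc ba' ca' cb' comm)
  show ?right
    unfolding e using s' t' u'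
    by (subst M.finsum_mult_finsum3(2); (intro M.finsum_cong')?) (auto simp: m cc M.m_assoc ba' ca' cb' comm)
qed

subsection \<open>The Yang--Baxter word\<close>

context monoid
begin

lemma commute_left:
  assumes "x \<otimes> y = y \<otimes> x" "x \<in> carrier G" "y \<in> carrier G" "z \<in> carrier G"
  shows "x \<otimes> (y \<otimes> z) = y \<otimes> (x \<otimes> z)"
  using assms by (metis m_assoc)

text \<open>The trailing factor \<open>w\<close> lets a relation between three letters act in the
  middle of a right-nested word.\<close>

lemma triple_left:
  assumes "x \<otimes> (y \<otimes> z) = z \<otimes> (y \<otimes> x)" "x \<in> carrier G" "y \<in> carrier G" "z \<in> carrier G" "w \<in> carrier G"
  shows "x \<otimes> (y \<otimes> (z \<otimes> w)) = z \<otimes> (y \<otimes> (x \<otimes> w))"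
proof -
  have "x \<otimes> (y \<otimes> (z \<otimes> w)) = (x \<otimes> (y \<otimes> z)) \<otimes> w" using assms(2-) by (simp add: m_assoc)
  also have "\<dots> = z \<otimes> (y \<otimes> (x \<otimes> w))" unfolding assms(1) using assms(2-) by (simp add: m_assoc)
  finally show ?thesis .
qed

lemma cancel_left:
  assumes "x \<otimes> y = \<one>" "x \<in> carrier G" "y \<in> carrier G" "z \<in> carrier G"
  shows "x \<otimes> (y \<otimes> z) = z"
  using assms by (metis m_assoc l_one)

text \<open>Multiply the relation by \<open>X\<close> on both sides. This carries (c) and (d) over
  to the case where one of the two occurrences of \<open>r\<close> is replaced by
  \<open>R\<close>.\<close>

lemma triple_inverse_one:
  assumes "x \<otimes> (y \<otimes> z) = z \<otimes> (y \<otimes> x)" "X \<otimes> x = \<one>" "x \<otimes> X = \<one>"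
    and [simp]: "x \<in> carrier G" "X \<in> carrier G" "y \<in> carrier G" "z \<in> carrier G"
  shows "X \<otimes> (z \<otimes> y) = y \<otimes> (z \<otimes> X)"
proof -
  have "y \<otimes> (z \<otimes> X) = X \<otimes> (x \<otimes> (y \<otimes> z)) \<otimes> X" using cancel_left[OF assms(2)] by (simp add: m_assoc)
  also have "\<dots> = X \<otimes> (z \<otimes> y)" unfolding assms(1) using assms(3) by (simp add: m_assoc)
  finally show ?thesis by simp
qed

text \<open>The case where both occurrences of \<open>r\<close> become \<open>R\<close>, as for the
  factors 2, 3, 5 and 2, 4, 5.\<close>

lemma triple_inverse_two:
  assumes "x \<otimes> (y \<otimes> z) = z \<otimes> (y \<otimes> x)" "X \<otimes> x = \<one>" "x \<otimes> X = \<one>" "Y \<otimes> y = \<one>" "y \<otimes> Y = \<one>"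
    and [simp]: "x \<in> carrier G" "X \<in> carrier G" "y \<in> carrier G" "Y \<in> carrier G" "z \<in> carrier G"
  shows "z \<otimes> (X \<otimes> Y) = Y \<otimes> (X \<otimes> z)"
proof -
  have "z \<otimes> (X \<otimes> Y) = Y \<otimes> (X \<otimes> (x \<otimes> (y \<otimes> z))) \<otimes> (X \<otimes> Y)"
    using cancel_left[OF assms(2)] cancel_left[OF assms(4)] by (simp add: m_assoc)
  also have "\<dots> = Y \<otimes> (X \<otimes> z)"
    unfolding assms(1) using cancel_left[OF assms(3)] assms(5) by (simp add: m_assoc)
  finally show ?thesis .
qed

text \<open>The three copies consist of the factors 1, 2 and 3, 4 and 5, 6. Choosing one factor from
  each copy gives eight triples; these are the eight hypotheses \<open>rel\<close>, and each is used
  exactly once. Letters in \<open>comm\<close> have disjoint indices and are shifted until the three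
  letters of a triple are adjacent and can be reversed.\<close>

lemma yang_baxter_word:
  assumes [simp]: "r14 \<in> carrier G" "r16 \<in> carrier G" "r36 \<in> carrier G"
    "p13 \<in> carrier G" "p15 \<in> carrier G" "p35 \<in> carrier G"
    "q24 \<in> carrier G" "q26 \<in> carrier G" "q46 \<in> carrier G"
    "R32 \<in> carrier G" "R52 \<in> carrier G" "R54 \<in> carrier G"
    and rel: "R32 \<otimes> (q26 \<otimes> r36) = r36 \<otimes> (q26 \<otimes> R32)"
      "R32 \<otimes> (R52 \<otimes> p35) = p35 \<otimes> (R52 \<otimes> R32)"
      "p13 \<otimes> (r16 \<otimes> r36) = r36 \<otimes> (r16 \<otimes> p13)"
      "p13 \<otimes> (p15 \<otimes> p35) = p35 \<otimes> (p15 \<otimes> p13)"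
      "q24 \<otimes> (q26 \<otimes> q46) = q46 \<otimes> (q26 \<otimes> q24)"
      "r14 \<otimes> (r16 \<otimes> q46) = q46 \<otimes> (r16 \<otimes> r14)"
      "q24 \<otimes> (R52 \<otimes> R54) = R54 \<otimes> (R52 \<otimes> q24)"
      "r14 \<otimes> (p15 \<otimes> R54) = R54 \<otimes> (p15 \<otimes> r14)"
    and comm: "R32 \<otimes> r16 = r16 \<otimes> R32" "R32 \<otimes> p15 = p15 \<otimes> R32" "R52 \<otimes> r36 = r36 \<otimes> R52"
      "q24 \<otimes> r16 = r16 \<otimes> q24" "q24 \<otimes> p15 = p15 \<otimes> q24" "q24 \<otimes> r36 = r36 \<otimes> q24" "p15 \<otimes> r36 = r36 \<otimes> p15"
      "q26 \<otimes> p35 = p35 \<otimes> q26" "q24 \<otimes> p35 = p35 \<otimes> q24" "R32 \<otimes> q46 = q46 \<otimes> R32" "R52 \<otimes> q46 = q46 \<otimes> R52"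
      "r14 \<otimes> r36 = r36 \<otimes> r14" "R32 \<otimes> R54 = R54 \<otimes> R32"
      "p13 \<otimes> q46 = q46 \<otimes> p13" "p15 \<otimes> q46 = q46 \<otimes> p15" "p35 \<otimes> q46 = q46 \<otimes> p35"
      "p13 \<otimes> q26 = q26 \<otimes> p13" "p13 \<otimes> R54 = R54 \<otimes> p13" "p13 \<otimes> R52 = R52 \<otimes> p13"
      "r14 \<otimes> p35 = p35 \<otimes> r14" "r16 \<otimes> p35 = p35 \<otimes> r16" "q26 \<otimes> R54 = R54 \<otimes> q26"
      "r16 \<otimes> R54 = R54 \<otimes> r16" "r14 \<otimes> q26 = q26 \<otimes> r14" "r14 \<otimes> R52 = R52 \<otimes> r14"
  shows "(r14 \<otimes> (p13 \<otimes> (q24 \<otimes> R32))) \<otimes> ((r16 \<otimes> (p15 \<otimes> (q26 \<otimes> R52))) \<otimes> (r36 \<otimes> (p35 \<otimes> (q46 \<otimes> R54))))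
       = (r36 \<otimes> (p35 \<otimes> (q46 \<otimes> R54))) \<otimes> ((r16 \<otimes> (p15 \<otimes> (q26 \<otimes> R52))) \<otimes> (r14 \<otimes> (p13 \<otimes> (q24 \<otimes> R32))))"
    (is "?lhs = ?rhs")
proof -
  note c = comm[THEN commute_left]
  \<comment> \<open>\<open>R32\<close> is brought up to \<open>q26\<close> and \<open>R52\<close> up
    to \<open>p35\<close>, which prepares the triple 2, 3, 6 and, after its reversal, the triple 2,
    3, 5.\<close>
  have "?lhs = r14 \<otimes> (p13 \<otimes> (q24 \<otimes> (r16 \<otimes> (p15 \<otimes> (R32 \<otimes> (q26 \<otimes> (r36 \<otimes> (R52 \<otimes> (p35 \<otimes> (q46 \<otimes> R54))))))))))"
    by (simp add: m_assoc c(1-3))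
  also have "\<dots> = r14 \<otimes> (p13 \<otimes> (q24 \<otimes> (r16 \<otimes> (p15 \<otimes> (r36 \<otimes> (q26 \<otimes> (p35 \<otimes> (R52 \<otimes> (R32 \<otimes> (q46 \<otimes> R54))))))))))"
    by (simp add: triple_left[OF rel(1)] triple_left[OF rel(2)])
  \<comment> \<open>Now 1, 3, 6 and 2, 4, 6 are adjacent, and reversing 1, 3, 6 moves
    \<open>p13\<close> next to \<open>p15\<close> and \<open>p35\<close>, which prepares 1, 3,
    5.\<close>
  also have "\<dots> = r14 \<otimes> (p13 \<otimes> (r16 \<otimes> (r36 \<otimes> (p15 \<otimes> (p35 \<otimes> (q24 \<otimes> (q26 \<otimes> (q46 \<otimes> (R52 \<otimes> (R32 \<otimes> R54))))))))))"
    by (simp add: c(4-11))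
  also have "\<dots> = r36 \<otimes> (r14 \<otimes> (r16 \<otimes> (p35 \<otimes> (p15 \<otimes> (p13 \<otimes> (q46 \<otimes> (q26 \<otimes> (q24 \<otimes> (R52 \<otimes> (R54 \<otimes> R32))))))))))"
    by (simp add: triple_left[OF rel(3)] triple_left[OF rel(4)] triple_left[OF rel(5)] c(12) comm(13))
  \<comment> \<open>The triple 2, 4, 5 is reversed, and \<open>q46\<close> travels left to meet
    \<open>r14\<close> and \<open>r16\<close> for the triple 1, 4, 6.\<close>
  also have "\<dots> = r36 \<otimes> (r14 \<otimes> (r16 \<otimes> (q46 \<otimes> (p35 \<otimes> (p15 \<otimes> (p13 \<otimes> (q26 \<otimes> (R54 \<otimes> (R52 \<otimes> (q24 \<otimes> R32))))))))))"
    by (simp add: triple_left[OF rel(7)] c(14-16))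
  also have "\<dots> = r36 \<otimes> (q46 \<otimes> (r16 \<otimes> (r14 \<otimes> (p35 \<otimes> (p15 \<otimes> (p13 \<otimes> (q26 \<otimes> (R54 \<otimes> (R52 \<otimes> (q24 \<otimes> R32))))))))))"
    by (simp add: triple_left[OF rel(6)])
  \<comment> \<open>The last triple is 1, 4, 5: \<open>p35\<close> leaves to the left and
    \<open>p13\<close> to the right, and \<open>R54\<close> passes \<open>q26\<close> to reach
    \<open>p15\<close>.\<close>
  also have "\<dots> = r36 \<otimes> (p35 \<otimes> (q46 \<otimes> (r16 \<otimes> (r14 \<otimes> (p15 \<otimes> (R54 \<otimes> (q26 \<otimes> (R52 \<otimes> (p13 \<otimes> (q24 \<otimes> R32))))))))))"
    by (simp add: c(17-22) c(16)[symmetric])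
  also have "\<dots> = ?rhs"
    by (simp add: m_assoc triple_left[OF rel(8)] c(23-25))
  finally show ?thesis .
qed

end

lemma (in abelian_monoid) finsum_swap_pairs:
  assumes "\<And>i j k l. i \<in> I \<Longrightarrow> j \<in> J \<Longrightarrow> k \<in> L \<Longrightarrow> l \<in> Q \<Longrightarrow> f i j k l \<in> carrier G"
  shows "finsum G (\<lambda>(k, l, i, j). f i j k l) (L \<times> Q \<times> I \<times> J)
       = finsum G (\<lambda>(i, j, k, l). f i j k l) (I \<times> J \<times> L \<times> Q)"
proof -
  let ?h = "\<lambda>(i, j, k, l). (k, l, i, j)"
  have "L \<times> Q \<times> I \<times> J = ?h ` (I \<times> J \<times> L \<times> Q)" by force
  then have "finsum G (\<lambda>(k, l, i, j). f i j k l) (L \<times> Q \<times> I \<times> J)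
      = finsum G (\<lambda>(k, l, i, j). f i j k l) (?h ` (I \<times> J \<times> L \<times> Q))" by (simp only:)
  also have "\<dots> = finsum G (\<lambda>z. (\<lambda>(k, l, i, j). f i j k l) (?h z)) (I \<times> J \<times> L \<times> Q)"
    using assms by (intro finsum_reindex) (auto simp: inj_on_def)
  also have "(\<lambda>z. (\<lambda>(k, l, i, j). f i j k l) (?h z)) = (\<lambda>(i, j, k, l). f i j k l)" by auto
  finally show ?thesis .
qed

lemma (in ring) finsum_mult_finsum4:
  assumes "finite I" "finite J" "finite L" "finite Q" "\<And>i. i \<in> I \<Longrightarrow> f i \<in> carrier R"
    "\<And>j. j \<in> J \<Longrightarrow> g j \<in> carrier R" "\<And>k. k \<in> L \<Longrightarrow> h k \<in> carrier R" "\<And>l. l \<in> Q \<Longrightarrow> e l \<in> carrier R"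
  shows "finsum R f I \<otimes> (finsum R g J \<otimes> (finsum R h L \<otimes> finsum R e Q))
      = finsum R (\<lambda>(i, j, k, l). f i \<otimes> (g j \<otimes> (h k \<otimes> e l))) (I \<times> J \<times> L \<times> Q)"
proof -
  have "finsum R f I \<otimes> finsum R (\<lambda>(j, k, l). g j \<otimes> (h k \<otimes> e l)) (J \<times> L \<times> Q)
      = finsum R (\<lambda>(i, z). f i \<otimes> (\<lambda>(j, k, l). g j \<otimes> (h k \<otimes> e l)) z) (I \<times> J \<times> L \<times> Q)"
    using assms by (intro finsum_mult_finsum) auto
  also have "(\<lambda>(i, z). f i \<otimes> (\<lambda>(j, k, l). g j \<otimes> (h k \<otimes> e l)) z) = (\<lambda>(i, j, k, l). f i \<otimes> (g j \<otimes> (h k \<otimes> e l)))"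
    by auto
  finally show "finsum R f I \<otimes> (finsum R g J \<otimes> (finsum R h L \<otimes> finsum R e Q))
      = finsum R (\<lambda>(i, j, k, l). f i \<otimes> (g j \<otimes> (h k \<otimes> e l))) (I \<times> J \<times> L \<times> Q)"
    using assms by (simp add: finsum_mult_finsum3)
qed

text \<open>The displayed formulas list the indices by first appearance, not by the order of the
  factors in the word. For the inverse of \<alpha>, and for \<alpha> read with the opposite
  multiplication, the two orders differ by exchanging the leading and the trailing pair.\<close>

lemma (in ring) finsum_mult_finsum4_swap:
  assumes "finite I" "finite J" "finite L" "finite Q" "\<And>i. i \<in> I \<Longrightarrow> f i \<in> carrier R"
    "\<And>j. j \<in> J \<Longrightarrow> g j \<in> carrier R" "\<And>k. k \<in> L \<Longrightarrow> h k \<in> carrier R" "\<And>l. l \<in> Q \<Longrightarrow> e l \<in> carrier R"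
  shows "finsum R h L \<otimes> (finsum R e Q \<otimes> (finsum R f I \<otimes> finsum R g J))
      = finsum R (\<lambda>(i, j, k, l). h k \<otimes> (e l \<otimes> (f i \<otimes> g j))) (I \<times> J \<times> L \<times> Q)"
  using assms by (subst finsum_mult_finsum4, simp_all) (rule finsum_swap_pairs, simp)

lemma linear_map_id: "linear_map K A A id" "linear_map K A A (\<lambda>x. x)"
  by (simp_all add: linear_map_def)

lemma product_lift_cong:
  assumes A: "unital_algebra K A" and B: "unital_algebra K B" and M: "unital_algebra K M"
    and f: "linear_map K A M f" and g: "linear_map K B M g"
    and f': "linear_map K A M f'" and g': "linear_map K B M g'"
    and "\<And>a. a \<in> carrier A \<Longrightarrow> f a = f' a" "\<And>b. b \<in> carrier B \<Longrightarrow> g b = g' b"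
    and t: "t \<in> carrier (tensor_alg K A B)"
  shows "product_lift K A B M f g t = product_lift K A B M f' g' t"
proof -
  interpret AB: tensor_pair K A B using A B by unfold_locales
  show ?thesis
    by (rule AB.linear_map_ext[OF AB.product_lift_linear(1)[OF M f g] AB.product_lift_linear(1)[OF M f' g'] t])
      (simp add: AB.product_lift_linear(2)[OF M f g] AB.product_lift_linear(2)[OF M f' g'] assms(8,9))
qed

text \<open>Sending a triple tensor to the product of its images under \<open>a\<close>,
  \<open>b\<close>, \<open>c\<close> turns an identity of sums into a relation between placed
  tensors. One statement covers (3) with \<open>s = t = u = p\<close>, (c) with \<open>s = p\<close>
  and \<open>t = u = r\<close>, and (d) with \<open>s = t = r\<close> and
  \<open>u = p'\<close>.\<close>

lemma triple_relation:
  assumes A: "unital_algebra K A" and B: "unital_algebra K B" and C: "unital_algebra K C"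
    and M: "unital_algebra K M"
    and a: "algebra_map K A M a" and b: "algebra_map K B M b" and c: "algebra_map K C M c"
    and ab: "commuting M A B a b" and ac: "commuting M A C a c" and bc: "commuting M B C b c"
    and s: "tensor_expr K A B s I x y" and t: "tensor_expr K A C t J z w" and u: "tensor_expr K B C u L v q"
    and eq: "finsum (tensor_alg K (tensor_alg K A B) C) (\<lambda>(i, j, k).
        tens K (tensor_alg K A B) C (tens K A B (x i \<otimes>\<^bsub>A\<^esub> z j) (y i \<otimes>\<^bsub>B\<^esub> v k)) (w j \<otimes>\<^bsub>C\<^esub> q k)) (I \<times> J \<times> L)
      = finsum (tensor_alg K (tensor_alg K A B) C) (\<lambda>(i, j, k).
        tens K (tensor_alg K A B) C (tens K A B (z j \<otimes>\<^bsub>A\<^esub> x i) (v k \<otimes>\<^bsub>B\<^esub> y i)) (q k \<otimes>\<^bsub>C\<^esub> w j)) (I \<times> J \<times> L)"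
  shows "product_lift K A B M a b s \<otimes>\<^bsub>M\<^esub> (product_lift K A C M a c t \<otimes>\<^bsub>M\<^esub> product_lift K B C M b c u)
    = product_lift K B C M b c u \<otimes>\<^bsub>M\<^esub> (product_lift K A C M a c t \<otimes>\<^bsub>M\<^esub> product_lift K A B M a b s)"
proof -
  interpret M: ring M by (rule unital_algebraD[OF M])
  interpret AB: tensor_pair K A B using A B by unfold_locales
  interpret AC: tensor_pair K A C using A C by unfold_locales
  interpret BC: tensor_pair K B C using B C by unfold_locales
  interpret C: ring C by (rule unital_algebraD[OF C])
  interpret ABC: tensor_pair K "tensor_alg K A B" C using AB.unital_algebra_T C by unfold_locales
  note al = algebra_map_linear[OF a] and bl = algebra_map_linear[OF b] and cl = algebra_map_linear[OF c]
  note l = AB.product_lift_linear(1)[OF M al bl]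
  note s' = AB.tensor_expr_closed(1-3)[OF s] and t' = AC.tensor_expr_closed(1-3)[OF t]
    and u' = BC.tensor_expr_closed(1-3)[OF u]
  let ?h = "product_lift K (tensor_alg K A B) C M (product_lift K A B M a b) c"
  have h: "?h (finsum (tensor_alg K (tensor_alg K A B) C) (\<lambda>(i, j, k).
        tens K (tensor_alg K A B) C (tens K A B (f i j k) (g i j k)) (e i j k)) (I \<times> J \<times> L))
    = finsum M (\<lambda>(i, j, k). a (f i j k) \<otimes>\<^bsub>M\<^esub> b (g i j k) \<otimes>\<^bsub>M\<^esub> c (e i j k)) (I \<times> J \<times> L)"
    if "\<And>i j k. i \<in> I \<Longrightarrow> j \<in> J \<Longrightarrow> k \<in> L \<Longrightarrow> f i j k \<in> carrier A \<and> g i j k \<in> carrier B \<and> e i j k \<in> carrier C"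
    for f g e using that
    by (subst linear_map_finsum[OF ABC.abelian_group_T M.is_abelian_group ABC.product_lift_linear(1)[OF M l cl]], force)
      (intro M.finsum_cong', auto simp: AB.product_lift_linear(2)[OF M al bl] ABC.product_lift_linear(2)[OF M l cl]
        linear_map_closed[OF al] linear_map_closed[OF bl] linear_map_closed[OF cl])
  show ?thesis
    using arg_cong[OF eq, of ?h] s' t' u'
    by (simp add: h triple_sum_left[OF A B C M a b c ab ac bc s t u]
      triple_sum_right[OF A B C M a b c ab ac bc s t u])
qed

lemma product_lift_closed:
  assumes "unital_algebra K A" "unital_algebra K B" "unital_algebra K M"
    "linear_map K A M f" "linear_map K B M g" "t \<in> carrier (tensor_alg K A B)"
  shows "product_lift K A B M f g t \<in> carrier M"
proof -
  interpret AB: tensor_pair K A B using assms by unfold_locales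
  show ?thesis using assms by (intro linear_map_closed[OF AB.product_lift_linear(1)])
qed

lemma product_lift_inverse:
  assumes A: "unital_algebra K A" and B: "unital_algebra K B" and M: "unital_algebra K M"
    and "algebra_map K A M a" "algebra_map K B M b" "commuting M A B a b"
    and t: "t \<in> Units (tensor_alg K A B)"
  shows "product_lift K A B M a b t \<otimes>\<^bsub>M\<^esub> product_lift K A B M a b (inv\<^bsub>tensor_alg K A B\<^esub> t) = \<one>\<^bsub>M\<^esub>"
    and "product_lift K A B M a b (inv\<^bsub>tensor_alg K A B\<^esub> t) \<otimes>\<^bsub>M\<^esub> product_lift K A B M a b t = \<one>\<^bsub>M\<^esub>"
proof -
  interpret AB: tensor_pair K A B using A B by unfold_locales
  interpret T: ring "tensor_alg K A B" by (rule AB.ring_T)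
  note h = AB.product_lift_algebra_map[OF assms(3-6)]
  show "product_lift K A B M a b t \<otimes>\<^bsub>M\<^esub> product_lift K A B M a b (inv\<^bsub>tensor_alg K A B\<^esub> t) = \<one>\<^bsub>M\<^esub>"
    "product_lift K A B M a b (inv\<^bsub>tensor_alg K A B\<^esub> t) \<otimes>\<^bsub>M\<^esub> product_lift K A B M a b t = \<one>\<^bsub>M\<^esub>"
    using t by (simp_all add: algebra_map_mult[OF h, symmetric] algebra_map_one[OF h] T.Units_closed)
qed

lemma product_lift_elements_commute:
  assumes "unital_algebra K A" "unital_algebra K B" "unital_algebra K C" "unital_algebra K E"
    and "unital_algebra K M"
    and "algebra_map K A M f" "algebra_map K B M g" "algebra_map K C M f'" "algebra_map K E M g'"
    and "commuting M A C f f'" "commuting M A E f g'" "commuting M B C g f'" "commuting M B E g g'"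
    and "s \<in> carrier (tensor_alg K A B)" "t \<in> carrier (tensor_alg K C E)"
  shows "product_lift K A B M f g s \<otimes>\<^bsub>M\<^esub> product_lift K C E M f' g' t = product_lift K C E M f' g' t \<otimes>\<^bsub>M\<^esub> product_lift K A B M f g s"
  using assms by (intro commutingD[OF product_lift_commuting]) (auto intro: algebra_map_linear)

subsection \<open>Oriented quantum algebras and nonuples\<close>

lemma oqaD:
  assumes "oriented_quantum_algebra K H p D U"
  shows "unital_algebra K H" "p \<in> Units (tensor_alg K H H)" "D \<in> algebra_auto K H" "U \<in> algebra_auto K H"
    "commute_on (carrier H) D U" "tensor_map K H H H H D D p = p" "tensor_map K H H H H U U p = p"
  using assms by (simp_all add: oriented_quantum_algebra_def Let_def)

lemma oqa_yang_baxter: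
  assumes oqa: "oriented_quantum_algebra K H p D U" and M: "unital_algebra K M"
    and a: "algebra_map K H M a" and b: "algebra_map K H M b" and c: "algebra_map K H M c"
    and ab: "commuting M H H a b" and ac: "commuting M H H a c" and bc: "commuting M H H b c"
  shows "product_lift K H H M a b p \<otimes>\<^bsub>M\<^esub> (product_lift K H H M a c p \<otimes>\<^bsub>M\<^esub> product_lift K H H M b c p)
    = product_lift K H H M b c p \<otimes>\<^bsub>M\<^esub> (product_lift K H H M a c p \<otimes>\<^bsub>M\<^esub> product_lift K H H M a b p)"
proof -
  note H = oqaD(1)[OF oqa]
  interpret HH: tensor_pair K H H using H by unfold_locales
  interpret T: ring "tensor_alg K H H" by (rule HH.ring_T)
  obtain I :: "nat set" and x y where e: "tensor_expr K H H p I x y"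
    using HH.ex_tensor_expr[of p] oqaD(2)[OF oqa] by auto
  show ?thesis
    by (rule triple_relation[OF H H H M a b c ab ac bc e e e])
      (use oqa e in \<open>simp add: oriented_quantum_algebra_def Let_def\<close>)
qed

text \<open>Condition (1) holds in \<open>H \<otimes> H\<^sup>o\<^sup>p\<close>. With
  \<open>b\<close> defined on the opposite algebra, \<open>a\<close> and \<open>b\<close> together
  give an algebra map out of that tensor product, which carries the condition to \<open>M\<close>;
  the twists by \<open>D\<close> and \<open>U\<close> are absorbed into \<open>a\<close> and
  \<open>b\<close>.\<close>

lemma oqa_inverse:
  assumes oqa: "oriented_quantum_algebra K H p D U" and M: "unital_algebra K M"
    and a: "algebra_map K H M a" and b: "algebra_map K (opposite H) M b" and ab: "commuting M H H a b"
  shows "product_lift K H H M (\<lambda>x. a (D x)) b (inv\<^bsub>tensor_alg K H H\<^esub> p) \<otimes>\<^bsub>M\<^esub> product_lift K H H M a (\<lambda>x. b (U x)) p = \<one>\<^bsub>M\<^esub>"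
    and "product_lift K H H M a (\<lambda>x. b (U x)) p \<otimes>\<^bsub>M\<^esub> product_lift K H H M (\<lambda>x. a (D x)) b (inv\<^bsub>tensor_alg K H H\<^esub> p) = \<one>\<^bsub>M\<^esub>"
proof -
  note H = oqaD(1)[OF oqa]
  note Hop = unital_algebra_opposite[OF H]
  interpret HH: tensor_pair K H H using H by unfold_locales
  interpret HO: tensor_pair K H "opposite H" using H Hop by unfold_locales
  interpret T: ring "tensor_alg K H H" by (rule HH.ring_T)
  let ?h = "product_lift K H (opposite H) M a b"
  have h: "algebra_map K (tensor_alg K H (opposite H)) M ?h"
    using ab by (intro HO.product_lift_algebra_map M a b) (simp add: commuting_def)
  note al = algebra_map_linear[OF a] and bl = algebra_map_linear[OF b, unfolded linear_map_opposite]
  note D = algebra_map_linear[OF algebra_auto_map[OF oqaD(3)[OF oqa]]]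
  note U = algebra_map_linear[OF algebra_auto_map[OF oqaD(4)[OF oqa]]]
  let ?D = "tensor_map K H H H H D id (inv\<^bsub>tensor_alg K H H\<^esub> p)" and ?U = "tensor_map K H H H H id U p"
  have c: "p \<in> carrier (tensor_alg K H H)" "inv\<^bsub>tensor_alg K H H\<^esub> p \<in> carrier (tensor_alg K H H)"
    using oqaD(2)[OF oqa] by auto
  have DU: "?D \<in> carrier (tensor_alg K H (opposite H))" "?U \<in> carrier (tensor_alg K H (opposite H))"
    unfolding carrier_tensor_opposite
    by (auto intro!: linear_map_closed[OF tensor_map_linear] H D U linear_map_id c)
  have D': "?h ?D = product_lift K H H M (\<lambda>x. a (D x)) b (inv\<^bsub>tensor_alg K H H\<^esub> p)"
    unfolding product_lift_opposite product_lift_tensor_map[OF H H H H M D linear_map_id(1) al bl c(2)] by simp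
  have U': "?h ?U = product_lift K H H M a (\<lambda>x. b (U x)) p"
    unfolding product_lift_opposite product_lift_tensor_map[OF H H H H M linear_map_id(1) U al bl c(1)] by simp
  have "?D \<otimes>\<^bsub>tensor_alg K H (opposite H)\<^esub> ?U = \<one>\<^bsub>tensor_alg K H (opposite H)\<^esub>"
    "?U \<otimes>\<^bsub>tensor_alg K H (opposite H)\<^esub> ?D = \<one>\<^bsub>tensor_alg K H (opposite H)\<^esub>"
    using oqa by (simp_all add: oriented_quantum_algebra_def Let_def)
  from arg_cong[OF this(1), of ?h] arg_cong[OF this(2), of ?h]
  show "product_lift K H H M (\<lambda>x. a (D x)) b (inv\<^bsub>tensor_alg K H H\<^esub> p) \<otimes>\<^bsub>M\<^esub> product_lift K H H M a (\<lambda>x. b (U x)) p = \<one>\<^bsub>M\<^esub>"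
    and "product_lift K H H M a (\<lambda>x. b (U x)) p \<otimes>\<^bsub>M\<^esub> product_lift K H H M (\<lambda>x. a (D x)) b (inv\<^bsub>tensor_alg K H H\<^esub> p) = \<one>\<^bsub>M\<^esub>"
    unfolding algebra_map_mult[OF h DU] algebra_map_mult[OF h DU(2,1)] algebra_map_one[OF h] D' U' .
qed

text \<open>Condition (b) speaks of \<open>r\<close>; an algebra map that fixes \<open>r\<close>
  also fixes its inverse.\<close>

lemma tensor_map_inv:
  assumes A: "unital_algebra K A" and B: "unital_algebra K B"
    and f: "f \<in> algebra_auto K A" and g: "g \<in> algebra_auto K B"
    and t: "t \<in> Units (tensor_alg K A B)" and inv: "tensor_map K A B A B f g t = t"
  shows "tensor_map K A B A B f g (inv\<^bsub>tensor_alg K A B\<^esub> t) = inv\<^bsub>tensor_alg K A B\<^esub> t"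
proof -
  interpret AB: tensor_pair K A B using A B by unfold_locales
  interpret T: ring "tensor_alg K A B" by (rule AB.ring_T)
  have "algebra_map K (tensor_alg K A B) (tensor_alg K A B) (tensor_map K A B A B f g)"
    by (intro tensor_map_algebra_map A B algebra_auto_map f g)
  from algebra_map_inv(2)[OF T.monoid_axioms T.monoid_axioms this t] show ?thesis
    by (simp add: inv)
qed

section \<open>The nonuple relations as relations between placed tensors\<close>

locale oqa_gluing =
  fixes K :: "('k, 'l) ring_scheme"
    and H :: "('k, 'a) module" and H' :: "('k, 'b) module"
    and p p' r D U D' U'
  assumes oqa: "oriented_quantum_algebra K H p D U"
    and oqa': "oriented_quantum_algebra K H' p' D' U'"
    and nonuple: "oqa_nonuple K H H' p p' r D U D' U'"
begin

abbreviation "T \<equiv> tensor_alg K H H'"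
abbreviation "R \<equiv> inv\<^bsub>T\<^esub> r"
abbreviation "P \<equiv> inv\<^bsub>tensor_alg K H H\<^esub> p"
abbreviation "P' \<equiv> inv\<^bsub>tensor_alg K H' H'\<^esub> p'"

lemmas H = oqaD(1)[OF oqa] and H' = oqaD(1)[OF oqa']

lemma r_Units: "r \<in> Units T"
  using nonuple by (simp add: oqa_nonuple_def Let_def)

lemma r_invariant: "tensor_map K H H' H H' D D' r = r" "tensor_map K H H' H H' U U' r = r"
  using nonuple by (simp_all add: oqa_nonuple_def Let_def)

sublocale HH': tensor_pair K H H' using H H' by unfold_locales
sublocale HH: tensor_pair K H H using H by unfold_locales
sublocale H'H': tensor_pair K H' H' using H' by unfold_locales

lemmas TA = HH'.unital_algebra_T
sublocale TT: tensor_pair K T T using TA by unfold_locales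

sublocale RT: ring T by (rule HH'.ring_T)
sublocale RHH: ring "tensor_alg K H H" by (rule HH.ring_T)
sublocale RH'H': ring "tensor_alg K H' H'" by (rule H'H'.ring_T)

lemma elements [simp]:
  "r \<in> carrier T" "R \<in> carrier T" "p \<in> carrier (tensor_alg K H H)" "P \<in> carrier (tensor_alg K H H)"
  "p' \<in> carrier (tensor_alg K H' H')" "P' \<in> carrier (tensor_alg K H' H')"
  using r_Units oqaD(2)[OF oqa] oqaD(2)[OF oqa'] by auto

lemmas D = algebra_auto_map[OF oqaD(3)[OF oqa]] and U = algebra_auto_map[OF oqaD(4)[OF oqa]]
lemmas D' = algebra_auto_map[OF oqaD(3)[OF oqa']] and U' = algebra_auto_map[OF oqaD(4)[OF oqa']]
lemmas Dl = algebra_map_linear[OF D] and Ul = algebra_map_linear[OF U]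
lemmas Dl' = algebra_map_linear[OF D'] and Ul' = algebra_map_linear[OF U']

lemma R_invariant: "tensor_map K H H' H H' D D' R = R" "tensor_map K H H' H H' U U' R = R"
  by (intro tensor_map_inv H H' oqaD(3,4)[OF oqa] oqaD(3,4)[OF oqa'] r_Units r_invariant)+

lemma ex_exprs:
  obtains I :: "nat set" and x y and L :: "nat set" and z w
  where "tensor_expr K H H' r I x y" "tensor_expr K H H' R L z w"
  using HH'.ex_tensor_expr[OF elements(1)] HH'.ex_tensor_expr[OF elements(2)] by blast

lemma nonuple_inverse:
  assumes "tensor_expr K H H' r (I :: nat set) x y" "tensor_expr K H H' R (L :: nat set) z w"
  shows "finsum T (\<lambda>(l, k). tens K H H' (D (z l) \<otimes>\<^bsub>H\<^esub> x k) (U' (y k) \<otimes>\<^bsub>H'\<^esub> w l)) (L \<times> I) = tens K H H' \<one>\<^bsub>H\<^esub> \<one>\<^bsub>H'\<^esub>"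
    and "finsum T (\<lambda>(l, k). tens K H H' (x k \<otimes>\<^bsub>H\<^esub> D (z l)) (w l \<otimes>\<^bsub>H'\<^esub> U' (y k))) (L \<times> I) = tens K H H' \<one>\<^bsub>H\<^esub> \<one>\<^bsub>H'\<^esub>"
proof -
  from nonuple have "\<forall>(I :: nat set) x y (L :: nat set) z w.
           tensor_expr K H H' r I x y \<and> tensor_expr K H H' R L z w \<longrightarrow>
           finsum T (\<lambda>(l, k). tens K H H' (D (z l) \<otimes>\<^bsub>H\<^esub> x k) (U' (y k) \<otimes>\<^bsub>H'\<^esub> w l)) (L \<times> I)
             = tens K H H' \<one>\<^bsub>H\<^esub> \<one>\<^bsub>H'\<^esub> \<and>
           finsum T (\<lambda>(l, k). tens K H H' (x k \<otimes>\<^bsub>H\<^esub> D (z l)) (w l \<otimes>\<^bsub>H'\<^esub> U' (y k))) (L \<times> I)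
             = tens K H H' \<one>\<^bsub>H\<^esub> \<one>\<^bsub>H'\<^esub>"
    unfolding oqa_nonuple_def Let_def by (elim conjE) assumption
  with assms show "finsum T (\<lambda>(l, k). tens K H H' (D (z l) \<otimes>\<^bsub>H\<^esub> x k) (U' (y k) \<otimes>\<^bsub>H'\<^esub> w l)) (L \<times> I) = tens K H H' \<one>\<^bsub>H\<^esub> \<one>\<^bsub>H'\<^esub>"
    "finsum T (\<lambda>(l, k). tens K H H' (x k \<otimes>\<^bsub>H\<^esub> D (z l)) (w l \<otimes>\<^bsub>H'\<^esub> U' (y k))) (L \<times> I) = tens K H H' \<one>\<^bsub>H\<^esub> \<one>\<^bsub>H'\<^esub>"
    by blast+
qed

text \<open>Condition (a) is pushed forward along maps that are merely linear, because in the
  applications one of the two reverses products and both may be twisted. Multiplicative laws are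
  applied to the summands afterwards.\<close>

lemma linear_image_inverse:
  assumes M: "unital_algebra K M" and f: "linear_map K H M f" and g: "linear_map K H' M g"
    and r: "tensor_expr K H H' r (I :: nat set) x y" and R: "tensor_expr K H H' R (L :: nat set) z w"
  shows "finsum M (\<lambda>(l, k). f (D (z l) \<otimes>\<^bsub>H\<^esub> x k) \<otimes>\<^bsub>M\<^esub> g (U' (y k) \<otimes>\<^bsub>H'\<^esub> w l)) (L \<times> I) = f \<one>\<^bsub>H\<^esub> \<otimes>\<^bsub>M\<^esub> g \<one>\<^bsub>H'\<^esub>"
    and "finsum M (\<lambda>(l, k). f (x k \<otimes>\<^bsub>H\<^esub> D (z l)) \<otimes>\<^bsub>M\<^esub> g (w l \<otimes>\<^bsub>H'\<^esub> U' (y k))) (L \<times> I) = f \<one>\<^bsub>H\<^esub> \<otimes>\<^bsub>M\<^esub> g \<one>\<^bsub>H'\<^esub>"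
proof -
  interpret M: ring M by (rule unital_algebraD[OF M])
  note r' = HH'.tensor_expr_closed(1-3)[OF r] and R' = HH'.tensor_expr_closed(1-3)[OF R]
  note c = HH'.product_lift_linear[OF M f g]
  note cl = linear_map_closed[OF f] linear_map_closed[OF g] linear_map_closed[OF Dl] linear_map_closed[OF Ul']
  have h: "product_lift K H H' M f g (finsum T (\<lambda>(l, k). tens K H H' (u l k) (v l k)) (L \<times> I))
      = finsum M (\<lambda>(l, k). f (u l k) \<otimes>\<^bsub>M\<^esub> g (v l k)) (L \<times> I)"
    if "\<And>l k. l \<in> L \<Longrightarrow> k \<in> I \<Longrightarrow> u l k \<in> carrier H \<and> v l k \<in> carrier H'" for u v
    using that by (subst linear_map_finsum[OF HH'.abelian_group_T M.is_abelian_group c(1)], force)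
      (intro M.finsum_cong', auto simp: c(2) cl)
  have one: "product_lift K H H' M f g (tens K H H' \<one>\<^bsub>H\<^esub> \<one>\<^bsub>H'\<^esub>) = f \<one>\<^bsub>H\<^esub> \<otimes>\<^bsub>M\<^esub> g \<one>\<^bsub>H'\<^esub>"
    by (simp add: c)
  show "finsum M (\<lambda>(l, k). f (D (z l) \<otimes>\<^bsub>H\<^esub> x k) \<otimes>\<^bsub>M\<^esub> g (U' (y k) \<otimes>\<^bsub>H'\<^esub> w l)) (L \<times> I) = f \<one>\<^bsub>H\<^esub> \<otimes>\<^bsub>M\<^esub> g \<one>\<^bsub>H'\<^esub>"
    using arg_cong[OF nonuple_inverse(1)[OF r R], of "product_lift K H H' M f g"] r' R' by (simp add: h cl one)
  show "finsum M (\<lambda>(l, k). f (x k \<otimes>\<^bsub>H\<^esub> D (z l)) \<otimes>\<^bsub>M\<^esub> g (w l \<otimes>\<^bsub>H'\<^esub> U' (y k))) (L \<times> I) = f \<one>\<^bsub>H\<^esub> \<otimes>\<^bsub>M\<^esub> g \<one>\<^bsub>H'\<^esub>"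
    using arg_cong[OF nonuple_inverse(2)[OF r R], of "product_lift K H H' M f g"] r' R' by (simp add: h cl one)
qed

text \<open>Since \<open>b\<close> reverses products, a summand of the first equation in (a) splits
  into a term of the placed \<open>R\<close> times a term of the placed \<open>r\<close>; the second
  equation splits in the other order. So (a) says that the two placed tensors are mutually
  inverse.\<close>

lemma r_inverse_D:
  assumes M: "unital_algebra K M"
    and a: "algebra_map K H M a" and b: "algebra_map K (opposite H') M b" and ab: "commuting M H H' a b"
  shows "product_lift K H H' M (\<lambda>x. a (D x)) b R \<otimes>\<^bsub>M\<^esub> product_lift K H H' M a (\<lambda>x. b (U' x)) r = \<one>\<^bsub>M\<^esub>"
    and "product_lift K H H' M a (\<lambda>x. b (U' x)) r \<otimes>\<^bsub>M\<^esub> product_lift K H H' M (\<lambda>x. a (D x)) b R = \<one>\<^bsub>M\<^esub>"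
proof -
  interpret M: ring M by (rule unital_algebraD[OF M])
  obtain I :: "nat set" and x y and L :: "nat set" and z w
    where r: "tensor_expr K H H' r I x y" and R: "tensor_expr K H H' R L z w" by (rule ex_exprs)
  note al = algebra_map_linear[OF a] and bl = algebra_map_linear[OF b, unfolded linear_map_opposite]
  note r' = HH'.tensor_expr_closed(1-3)[OF r] and R' = HH'.tensor_expr_closed(1-3)[OF R]
  note cl = linear_map_closed[OF al] linear_map_closed[OF bl] linear_map_closed[OF Dl] linear_map_closed[OF Ul']
  have m: "a (u \<otimes>\<^bsub>H\<^esub> u') \<otimes>\<^bsub>M\<^esub> b (v' \<otimes>\<^bsub>H'\<^esub> v) = (a u \<otimes>\<^bsub>M\<^esub> b v) \<otimes>\<^bsub>M\<^esub> (a u' \<otimes>\<^bsub>M\<^esub> b v')"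
    if "u \<in> carrier H" "u' \<in> carrier H" "v \<in> carrier H'" "v' \<in> carrier H'" for u u' v v'
  proof -
    have "a (u \<otimes>\<^bsub>H\<^esub> u') \<otimes>\<^bsub>M\<^esub> b (v' \<otimes>\<^bsub>H'\<^esub> v) = a u \<otimes>\<^bsub>M\<^esub> (a u' \<otimes>\<^bsub>M\<^esub> b v) \<otimes>\<^bsub>M\<^esub> b v'"
      using that algebra_map_mult[OF b, of v v'] by (simp add: algebra_map_mult[OF a] cl M.m_assoc)
    also have "a u' \<otimes>\<^bsub>M\<^esub> b v = b v \<otimes>\<^bsub>M\<^esub> a u'" using that by (intro commutingD[OF ab])
    finally show ?thesis using that by (simp add: cl M.m_assoc)
  qed
  note e = HH'.product_lift_expr[OF M linear_map_comp[OF Dl al] bl R] HH'.product_lift_expr[OF M al linear_map_comp[OF Ul' bl] r]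
  have one: "a \<one>\<^bsub>H\<^esub> \<otimes>\<^bsub>M\<^esub> b \<one>\<^bsub>H'\<^esub> = \<one>\<^bsub>M\<^esub>"
    using algebra_map_one[OF a] algebra_map_one[OF b] by simp
  show "product_lift K H H' M (\<lambda>x. a (D x)) b R \<otimes>\<^bsub>M\<^esub> product_lift K H H' M a (\<lambda>x. b (U' x)) r = \<one>\<^bsub>M\<^esub>"
    unfolding e one[symmetric] linear_image_inverse(1)[OF M al bl r R, symmetric] using r' R'
    by (subst M.finsum_mult_finsum; (intro M.finsum_cong')?) (auto simp: m cl)
  show "product_lift K H H' M a (\<lambda>x. b (U' x)) r \<otimes>\<^bsub>M\<^esub> product_lift K H H' M (\<lambda>x. a (D x)) b R = \<one>\<^bsub>M\<^esub>"
    unfolding e one[symmetric] linear_image_inverse(2)[OF M al bl r R, symmetric] using r' R'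
    by (subst M.finsum_mult_finsum_swap; (intro M.finsum_cong')?) (auto simp: m cl)
qed

text \<open>
  Besides \<open>r = x \<otimes> y\<close> and \<open>R = z \<otimes> w\<close>, invariance gives \<open>r = U x \<otimes> U' y\<close> and \<open>R = D z \<otimes> D' w\<close>.
  In these expressions the claim is the image of (a) under \<open>U \<otimes> D'\<close>.
\<close>

lemma r_inverse_U:
  assumes M: "unital_algebra K M"
    and a: "algebra_map K (opposite H) M a" and b: "algebra_map K H' M b" and ab: "commuting M H H' a b"
  shows "product_lift K H H' M a (\<lambda>x. b (D' x)) r \<otimes>\<^bsub>M\<^esub> product_lift K H H' M (\<lambda>x. a (U x)) b R = \<one>\<^bsub>M\<^esub>"
    and "product_lift K H H' M (\<lambda>x. a (U x)) b R \<otimes>\<^bsub>M\<^esub> product_lift K H H' M a (\<lambda>x. b (D' x)) r = \<one>\<^bsub>M\<^esub>"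
proof -
  interpret M: ring M by (rule unital_algebraD[OF M])
  obtain I :: "nat set" and x y and L :: "nat set" and z w
    where r: "tensor_expr K H H' r I x y" and R: "tensor_expr K H H' R L z w" by (rule ex_exprs)
  note al = algebra_map_linear[OF a, unfolded linear_map_opposite] and bl = algebra_map_linear[OF b]
  note aU = linear_map_comp[OF Ul al] and bD = linear_map_comp[OF Dl' bl]
  note r' = HH'.tensor_expr_closed(1-3)[OF r] and R' = HH'.tensor_expr_closed(1-3)[OF R]
  note cl = linear_map_closed[OF al] linear_map_closed[OF bl] linear_map_closed[OF Dl] linear_map_closed[OF Ul']
    linear_map_closed[OF Dl'] linear_map_closed[OF Ul]
  have m: "a (U (u' \<otimes>\<^bsub>H\<^esub> u)) \<otimes>\<^bsub>M\<^esub> b (D' (v \<otimes>\<^bsub>H'\<^esub> v')) = (a (U u) \<otimes>\<^bsub>M\<^esub> b (D' v)) \<otimes>\<^bsub>M\<^esub> (a (U u') \<otimes>\<^bsub>M\<^esub> b (D' v'))"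
    if "u \<in> carrier H" "u' \<in> carrier H" "v \<in> carrier H'" "v' \<in> carrier H'" for u u' v v'
  proof -
    have "a (U (u' \<otimes>\<^bsub>H\<^esub> u)) \<otimes>\<^bsub>M\<^esub> b (D' (v \<otimes>\<^bsub>H'\<^esub> v')) = a (U u) \<otimes>\<^bsub>M\<^esub> (a (U u') \<otimes>\<^bsub>M\<^esub> b (D' v)) \<otimes>\<^bsub>M\<^esub> b (D' v')"
      using that algebra_map_mult[OF a, of "U u" "U u'"]
      by (simp add: algebra_map_mult[OF b] algebra_map_mult[OF U] algebra_map_mult[OF D'] cl M.m_assoc)
    also have "a (U u') \<otimes>\<^bsub>M\<^esub> b (D' v) = b (D' v) \<otimes>\<^bsub>M\<^esub> a (U u')" using that by (intro commutingD[OF ab]) (simp_all add: cl)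
    finally show ?thesis using that by (simp add: cl M.m_assoc)
  qed
  have "product_lift K H H' M a (\<lambda>x. b (D' x)) r = product_lift K H H' M (\<lambda>x. a (U x)) (\<lambda>x. b (D' (U' x))) r"
    using product_lift_tensor_map[OF H H' H H' M Ul Ul' al bD elements(1)] by (simp add: r_invariant)
  also have "\<dots> = finsum M (\<lambda>i. a (U (x i)) \<otimes>\<^bsub>M\<^esub> b (D' (U' (y i)))) I"
    by (rule HH'.product_lift_expr[OF M aU linear_map_comp[OF Ul' bD] r])
  finally have e1: "product_lift K H H' M a (\<lambda>x. b (D' x)) r = finsum M (\<lambda>i. a (U (x i)) \<otimes>\<^bsub>M\<^esub> b (D' (U' (y i)))) I" .
  have "product_lift K H H' M (\<lambda>x. a (U x)) b R = product_lift K H H' M (\<lambda>x. a (U (D x))) (\<lambda>x. b (D' x)) R"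
    using product_lift_tensor_map[OF H H' H H' M Dl Dl' aU bl elements(2)] by (simp add: R_invariant)
  also have "\<dots> = finsum M (\<lambda>i. a (U (D (z i))) \<otimes>\<^bsub>M\<^esub> b (D' (w i))) L"
    by (rule HH'.product_lift_expr[OF M linear_map_comp[OF Dl aU] bD R])
  finally have e2: "product_lift K H H' M (\<lambda>x. a (U x)) b R = finsum M (\<lambda>i. a (U (D (z i))) \<otimes>\<^bsub>M\<^esub> b (D' (w i))) L" .
  have one: "a (U \<one>\<^bsub>H\<^esub>) \<otimes>\<^bsub>M\<^esub> b (D' \<one>\<^bsub>H'\<^esub>) = \<one>\<^bsub>M\<^esub>"
    using algebra_map_one[OF a] algebra_map_one[OF b] by (simp add: algebra_map_one[OF U] algebra_map_one[OF D'])
  show "product_lift K H H' M a (\<lambda>x. b (D' x)) r \<otimes>\<^bsub>M\<^esub> product_lift K H H' M (\<lambda>x. a (U x)) b R = \<one>\<^bsub>M\<^esub>"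
    unfolding e1 e2 one[symmetric] linear_image_inverse(1)[OF M aU bD r R, symmetric] using r' R'
    by (subst M.finsum_mult_finsum_swap; (intro M.finsum_cong')?) (auto simp: m cl)
  show "product_lift K H H' M (\<lambda>x. a (U x)) b R \<otimes>\<^bsub>M\<^esub> product_lift K H H' M a (\<lambda>x. b (D' x)) r = \<one>\<^bsub>M\<^esub>"
    unfolding e1 e2 one[symmetric] linear_image_inverse(2)[OF M aU bD r R, symmetric] using r' R'
    by (subst M.finsum_mult_finsum; (intro M.finsum_cong')?) (auto simp: m cl)
qed

text \<open>Condition (c), used later for the factors 1, 3 with 6, for 3, 5 with 2, and for 1, 5
  with 4.\<close>

lemma relation_p_r:
  assumes M: "unital_algebra K M"
    and a: "algebra_map K H M a" and b: "algebra_map K H M b" and c: "algebra_map K H' M c"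
    and ab: "commuting M H H a b" and ac: "commuting M H H' a c" and bc: "commuting M H H' b c"
  shows "product_lift K H H M a b p \<otimes>\<^bsub>M\<^esub> (product_lift K H H' M a c r \<otimes>\<^bsub>M\<^esub> product_lift K H H' M b c r)
    = product_lift K H H' M b c r \<otimes>\<^bsub>M\<^esub> (product_lift K H H' M a c r \<otimes>\<^bsub>M\<^esub> product_lift K H H M a b p)"
proof -
  obtain I :: "nat set" and x y where r: "tensor_expr K H H' r I x y"
    using HH'.ex_tensor_expr[OF elements(1)] by blast
  obtain J :: "nat set" and u v where p: "tensor_expr K H H p J u v"
    using HH.ex_tensor_expr[OF elements(3)] by blast
  have "finsum (tensor_alg K (tensor_alg K H H) H') (\<lambda>(i, k, s).
          tens K (tensor_alg K H H) H' (tens K H H (u i \<otimes>\<^bsub>H\<^esub> x k) (v i \<otimes>\<^bsub>H\<^esub> x s)) (y k \<otimes>\<^bsub>H'\<^esub> y s)) (J \<times> I \<times> I)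
      = finsum (tensor_alg K (tensor_alg K H H) H') (\<lambda>(i, k, s).
          tens K (tensor_alg K H H) H' (tens K H H (x k \<otimes>\<^bsub>H\<^esub> u i) (x s \<otimes>\<^bsub>H\<^esub> v i)) (y s \<otimes>\<^bsub>H'\<^esub> y k)) (J \<times> I \<times> I)"
    using nonuple r p unfolding oqa_nonuple_def Let_def by (elim conjE) blast
  then show ?thesis by (rule triple_relation[OF H H H' M a b c ab ac bc p r r])
qed

text \<open>Condition (d), used later for the factor 1 with 4, 6, for 3 with 2, 6, and for 5 with 2,
  4.\<close>

lemma relation_r_p':
  assumes M: "unital_algebra K M"
    and a: "algebra_map K H M a" and b: "algebra_map K H' M b" and c: "algebra_map K H' M c"
    and ab: "commuting M H H' a b" and ac: "commuting M H H' a c" and bc: "commuting M H' H' b c"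
  shows "product_lift K H H' M a b r \<otimes>\<^bsub>M\<^esub> (product_lift K H H' M a c r \<otimes>\<^bsub>M\<^esub> product_lift K H' H' M b c p')
    = product_lift K H' H' M b c p' \<otimes>\<^bsub>M\<^esub> (product_lift K H H' M a c r \<otimes>\<^bsub>M\<^esub> product_lift K H H' M a b r)"
proof -
  obtain I :: "nat set" and x y where r: "tensor_expr K H H' r I x y"
    using HH'.ex_tensor_expr[OF elements(1)] by blast
  obtain J :: "nat set" and u v where p': "tensor_expr K H' H' p' J u v"
    using H'H'.ex_tensor_expr[OF elements(5)] by blast
  interpret S: tensor_pair K T H' using TA H' by unfold_locales
  note r' = HH'.tensor_expr_closed(1-3)[OF r] and p'' = H'H'.tensor_expr_closed(1-3)[OF p']
  from nonuple have "\<forall>(I :: nat set) x y (J :: nat set) u v.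
      tensor_expr K H H' r I x y \<and> tensor_expr K H' H' p' J u v \<longrightarrow>
      finsum (tensor_alg K T H') (\<lambda>(j, k, s).
          tens K T H' (tens K H H' (x k \<otimes>\<^bsub>H\<^esub> x s) (y k \<otimes>\<^bsub>H'\<^esub> u j)) (y s \<otimes>\<^bsub>H'\<^esub> v j)) (J \<times> I \<times> I)
      = finsum (tensor_alg K T H') (\<lambda>(j, k, s).
          tens K T H' (tens K H H' (x s \<otimes>\<^bsub>H\<^esub> x k) (u j \<otimes>\<^bsub>H'\<^esub> y k)) (v j \<otimes>\<^bsub>H'\<^esub> y s)) (J \<times> I \<times> I)"
    unfolding oqa_nonuple_def Let_def by (elim conjE) assumption
  note eq = this[rule_format, OF conjI[OF r p']]
  have "finsum (tensor_alg K T H') (\<lambda>(k, s, j).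
          tens K T H' (tens K H H' (x k \<otimes>\<^bsub>H\<^esub> x s) (y k \<otimes>\<^bsub>H'\<^esub> u j)) (y s \<otimes>\<^bsub>H'\<^esub> v j)) (I \<times> I \<times> J)
      = finsum (tensor_alg K T H') (\<lambda>(j, k, s).
          tens K T H' (tens K H H' (x k \<otimes>\<^bsub>H\<^esub> x s) (y k \<otimes>\<^bsub>H'\<^esub> u j)) (y s \<otimes>\<^bsub>H'\<^esub> v j)) (J \<times> I \<times> I)"
    using r' p'' by (intro S.T.finsum_rotate[symmetric]) simp
  also note eq
  also have "finsum (tensor_alg K T H') (\<lambda>(j, k, s).
          tens K T H' (tens K H H' (x s \<otimes>\<^bsub>H\<^esub> x k) (u j \<otimes>\<^bsub>H'\<^esub> y k)) (v j \<otimes>\<^bsub>H'\<^esub> y s)) (J \<times> I \<times> I)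
      = finsum (tensor_alg K T H') (\<lambda>(k, s, j).
          tens K T H' (tens K H H' (x s \<otimes>\<^bsub>H\<^esub> x k) (u j \<otimes>\<^bsub>H'\<^esub> y k)) (v j \<otimes>\<^bsub>H'\<^esub> y s)) (I \<times> I \<times> J)"
    using r' p'' by (intro S.T.finsum_rotate) simp
  finally show ?thesis by (rule triple_relation[OF H H' H' M a b c ab ac bc r r p'])
qed

end

subsection \<open>The glued tensor\<close>

context oqa_gluing
begin

text \<open>The four maps are left open so that the same expression describes \<alpha> in
  \<open>T \<otimes> T\<close>, its twists by automorphisms, and its three placements in a triple
  tensor product.\<close>

definition glue where
  "glue M e1 e2 e3 e4 = product_lift K H H' M e1 e4 r \<otimes>\<^bsub>M\<^esub>
     (product_lift K H H M e1 e3 p \<otimes>\<^bsub>M\<^esub> (product_lift K H' H' M e2 e4 p' \<otimes>\<^bsub>M\<^esub> product_lift K H H' M e3 e2 R))"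

definition glue_inv where
  "glue_inv M e1 e2 e3 e4 = product_lift K H H' M e3 e2 r \<otimes>\<^bsub>M\<^esub>
     (product_lift K H' H' M e2 e4 P' \<otimes>\<^bsub>M\<^esub> (product_lift K H H M e1 e3 P \<otimes>\<^bsub>M\<^esub> product_lift K H H' M e1 e4 R))"

lemma glue_inverse:
  assumes M: "unital_algebra K M"
    and e: "algebra_map K H M e1" "algebra_map K H' M e2" "algebra_map K H M e3" "algebra_map K H' M e4"
    and c: "commuting M H H' e1 e4" "commuting M H H e1 e3" "commuting M H' H' e2 e4" "commuting M H H' e3 e2"
  shows "glue M e1 e2 e3 e4 \<in> carrier M" "glue_inv M e1 e2 e3 e4 \<in> carrier M"
    "glue M e1 e2 e3 e4 \<otimes>\<^bsub>M\<^esub> glue_inv M e1 e2 e3 e4 = \<one>\<^bsub>M\<^esub>"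
    "glue_inv M e1 e2 e3 e4 \<otimes>\<^bsub>M\<^esub> glue M e1 e2 e3 e4 = \<one>\<^bsub>M\<^esub>"
proof -
  interpret M: ring M by (rule unital_algebraD[OF M])
  note l = e[THEN algebra_map_linear]
  note cl = product_lift_closed[OF H H M] product_lift_closed[OF H H' M] product_lift_closed[OF H' H' M] l
  note i = product_lift_inverse[OF H H' M e(1,4) c(1) r_Units] product_lift_inverse[OF H H' M e(3,2) c(4) r_Units]
    product_lift_inverse[OF H H M e(1,3) c(2) oqaD(2)[OF oqa]] product_lift_inverse[OF H' H' M e(2,4) c(3) oqaD(2)[OF oqa']]
  show "glue M e1 e2 e3 e4 \<in> carrier M" "glue_inv M e1 e2 e3 e4 \<in> carrier M"
    by (simp_all add: glue_def glue_inv_def cl)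
  show "glue M e1 e2 e3 e4 \<otimes>\<^bsub>M\<^esub> glue_inv M e1 e2 e3 e4 = \<one>\<^bsub>M\<^esub>"
    "glue_inv M e1 e2 e3 e4 \<otimes>\<^bsub>M\<^esub> glue M e1 e2 e3 e4 = \<one>\<^bsub>M\<^esub>"
    by (simp_all add: glue_def glue_inv_def cl M.m_assoc i M.cancel_left[OF i(1)] M.cancel_left[OF i(2)]
      M.cancel_left[OF i(3)] M.cancel_left[OF i(4)] M.cancel_left[OF i(5)] M.cancel_left[OF i(6)]
      M.cancel_left[OF i(7)] M.cancel_left[OF i(8)])
qed

text \<open>Placed tensors are natural in the target algebra, so an algebra map acts on the glued
  element through the four maps. Pointwise agreement on the carriers with linear maps
  \<open>g1\<close> to \<open>g4\<close> covers twisted slots as well as slots carried into another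
  algebra.\<close>

lemma glue_image:
  assumes M: "unital_algebra K M" and N: "unital_algebra K N"
    and e: "linear_map K H M e1" "linear_map K H' M e2" "linear_map K H M e3" "linear_map K H' M e4"
    and g: "linear_map K H N g1" "linear_map K H' N g2" "linear_map K H N g3" "linear_map K H' N g4"
    and h: "algebra_map K M N h"
    and eq: "\<And>x. x \<in> carrier H \<Longrightarrow> h (e1 x) = g1 x" "\<And>x. x \<in> carrier H' \<Longrightarrow> h (e2 x) = g2 x"
      "\<And>x. x \<in> carrier H \<Longrightarrow> h (e3 x) = g3 x" "\<And>x. x \<in> carrier H' \<Longrightarrow> h (e4 x) = g4 x"
  shows "h (glue M e1 e2 e3 e4) = glue N g1 g2 g3 g4"
proof -
  interpret M: ring M by (rule unital_algebraD[OF M])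
  note cl = product_lift_closed[OF H H M] product_lift_closed[OF H H' M] product_lift_closed[OF H' H' M]
  have c: "h (product_lift K A B M f g t) = product_lift K A B N f' g' t"
    if "unital_algebra K A" "unital_algebra K B" "linear_map K A M f" "linear_map K B M g"
      "linear_map K A N f'" "linear_map K B N g'" "\<And>a. a \<in> carrier A \<Longrightarrow> h (f a) = f' a"
      "\<And>b. b \<in> carrier B \<Longrightarrow> h (g b) = g' b" "t \<in> carrier (tensor_alg K A B)"
    for A :: "('k, 'x) module" and B :: "('k, 'y) module" and f g f' g' t
    unfolding algebra_map_product_lift[OF that(1,2) M N that(3,4) h that(9)]
    by (rule product_lift_cong) (use that N h in \<open>auto intro: linear_map_comp algebra_map_linear\<close>)
  show ?thesis
    unfolding glue_def by (simp add: algebra_map_mult[OF h] cl e)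
      (simp add: c[OF H H' e(1,4) g(1,4) eq(1,4)] c[OF H' H' e(2,4) g(2,4) eq(2,4)]
        algebra_map_product_lift[OF H H M N e(1,3) h] product_lift_cong[OF H H N linear_map_comp[OF e(1) algebra_map_linear[OF h]]
          linear_map_comp[OF e(3) algebra_map_linear[OF h]] g(1,3) eq(1,3)]
        algebra_map_product_lift[OF H H' M N e(3,2) h] product_lift_cong[OF H H' N linear_map_comp[OF e(3) algebra_map_linear[OF h]]
          linear_map_comp[OF e(2) algebra_map_linear[OF h]] g(3,2) eq(3,2)])
qed

text \<open>Each triple in \<open>yang_baxter_word\<close> is supplied by one condition: 1, 3, 5 and
  2, 4, 6 by (3) for \<open>p\<close> and \<open>p'\<close>, triples with exactly two
  \<open>H\<close>-factors by (c), and those with exactly two \<open>H'\<close>-factors by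
  (d).\<close>

lemma glue_yang_baxter:
  assumes M: "unital_algebra K M"
    and e: "algebra_map K H M e1" "algebra_map K H' M e2" "algebra_map K H M e3" "algebra_map K H' M e4"
      "algebra_map K H M e5" "algebra_map K H' M e6"
    and c: "commuting M H H' e1 e2" "commuting M H H e1 e3" "commuting M H H' e1 e4" "commuting M H H e1 e5"
      "commuting M H H' e1 e6" "commuting M H' H e2 e3" "commuting M H' H' e2 e4" "commuting M H' H e2 e5"
      "commuting M H' H' e2 e6" "commuting M H H' e3 e4" "commuting M H H e3 e5" "commuting M H H' e3 e6"
      "commuting M H' H e4 e5" "commuting M H' H' e4 e6" "commuting M H H' e5 e6"
  shows "glue M e1 e2 e3 e4 \<otimes>\<^bsub>M\<^esub> (glue M e1 e2 e5 e6 \<otimes>\<^bsub>M\<^esub> glue M e3 e4 e5 e6)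
       = glue M e3 e4 e5 e6 \<otimes>\<^bsub>M\<^esub> (glue M e1 e2 e5 e6 \<otimes>\<^bsub>M\<^esub> glue M e1 e2 e3 e4)"
proof -
  interpret M: ring M by (rule unital_algebraD[OF M])
  note c' = c[THEN commuting_sym]
  note l = e[THEN algebra_map_linear]
  note F = H H' M e c c' elements
  let ?r = "\<lambda>a b. product_lift K H H' M a b r" and ?R = "\<lambda>a b. product_lift K H H' M a b R"
    and ?p = "\<lambda>a b. product_lift K H H M a b p" and ?q = "\<lambda>a b. product_lift K H' H' M a b p'"
  have cl: "?r a b \<in> carrier M" "?R a b \<in> carrier M" if "linear_map K H M a" "linear_map K H' M b" for a b
    using that by (auto intro!: product_lift_closed H H' M)
  have clp: "?p a b \<in> carrier M" if "linear_map K H M a" "linear_map K H M b" for a b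
    using that by (auto intro!: product_lift_closed H M)
  have clq: "?q a b \<in> carrier M" if "linear_map K H' M a" "linear_map K H' M b" for a b
    using that by (auto intro!: product_lift_closed H' M)
  note cls = cl[OF l(1) l(4)] cl[OF l(1) l(6)] cl[OF l(3) l(6)] cl[OF l(3) l(2)] cl[OF l(5) l(2)] cl[OF l(5) l(4)]
    clp[OF l(1) l(3)] clp[OF l(1) l(5)] clp[OF l(3) l(5)] clq[OF l(2) l(4)] clq[OF l(2) l(6)] clq[OF l(4) l(6)]
  note i = product_lift_inverse[OF H H' M _ _ _ r_Units]
  have i32: "?R e3 e2 \<otimes>\<^bsub>M\<^esub> ?r e3 e2 = \<one>\<^bsub>M\<^esub>" "?r e3 e2 \<otimes>\<^bsub>M\<^esub> ?R e3 e2 = \<one>\<^bsub>M\<^esub>" by (rule i; fact F)+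
  have i52: "?R e5 e2 \<otimes>\<^bsub>M\<^esub> ?r e5 e2 = \<one>\<^bsub>M\<^esub>" "?r e5 e2 \<otimes>\<^bsub>M\<^esub> ?R e5 e2 = \<one>\<^bsub>M\<^esub>" by (rule i; fact F)+
  have i54: "?R e5 e4 \<otimes>\<^bsub>M\<^esub> ?r e5 e4 = \<one>\<^bsub>M\<^esub>" "?r e5 e4 \<otimes>\<^bsub>M\<^esub> ?R e5 e4 = \<one>\<^bsub>M\<^esub>" by (rule i; fact F)+
  have b1: "?r e3 e2 \<otimes>\<^bsub>M\<^esub> (?r e3 e6 \<otimes>\<^bsub>M\<^esub> ?q e2 e6) = ?q e2 e6 \<otimes>\<^bsub>M\<^esub> (?r e3 e6 \<otimes>\<^bsub>M\<^esub> ?r e3 e2)"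
    by (rule relation_r_p'; fact F)
  have b2: "?p e3 e5 \<otimes>\<^bsub>M\<^esub> (?r e3 e2 \<otimes>\<^bsub>M\<^esub> ?r e5 e2) = ?r e5 e2 \<otimes>\<^bsub>M\<^esub> (?r e3 e2 \<otimes>\<^bsub>M\<^esub> ?p e3 e5)"
    by (rule relation_p_r; fact F)
  have b7: "?r e5 e2 \<otimes>\<^bsub>M\<^esub> (?r e5 e4 \<otimes>\<^bsub>M\<^esub> ?q e2 e4) = ?q e2 e4 \<otimes>\<^bsub>M\<^esub> (?r e5 e4 \<otimes>\<^bsub>M\<^esub> ?r e5 e2)"
    by (rule relation_r_p'; fact F)
  have b8: "?p e1 e5 \<otimes>\<^bsub>M\<^esub> (?r e1 e4 \<otimes>\<^bsub>M\<^esub> ?r e5 e4) = ?r e5 e4 \<otimes>\<^bsub>M\<^esub> (?r e1 e4 \<otimes>\<^bsub>M\<^esub> ?p e1 e5)"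
    by (rule relation_p_r; fact F)
  \<comment> \<open>Four of the triples involve \<open>R\<close> where (c) and (d) have
    \<open>r\<close>; they result from \<open>b1\<close>, \<open>b2\<close>, \<open>b7\<close>,
    \<open>b8\<close> by cancellation.\<close>
  have a1: "?R e3 e2 \<otimes>\<^bsub>M\<^esub> (?q e2 e6 \<otimes>\<^bsub>M\<^esub> ?r e3 e6) = ?r e3 e6 \<otimes>\<^bsub>M\<^esub> (?q e2 e6 \<otimes>\<^bsub>M\<^esub> ?R e3 e2)"
    by (rule M.triple_inverse_one[OF b1 i32]; fact cls)
  have a2: "?R e3 e2 \<otimes>\<^bsub>M\<^esub> (?R e5 e2 \<otimes>\<^bsub>M\<^esub> ?p e3 e5) = ?p e3 e5 \<otimes>\<^bsub>M\<^esub> (?R e5 e2 \<otimes>\<^bsub>M\<^esub> ?R e3 e2)"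
    by (rule M.triple_inverse_two[OF b2[symmetric] i52 i32, symmetric]; fact cls)
  have a3: "?q e2 e4 \<otimes>\<^bsub>M\<^esub> (?R e5 e2 \<otimes>\<^bsub>M\<^esub> ?R e5 e4) = ?R e5 e4 \<otimes>\<^bsub>M\<^esub> (?R e5 e2 \<otimes>\<^bsub>M\<^esub> ?q e2 e4)"
    by (rule M.triple_inverse_two[OF b7 i52 i54]; fact cls)
  have a4: "?r e1 e4 \<otimes>\<^bsub>M\<^esub> (?p e1 e5 \<otimes>\<^bsub>M\<^esub> ?R e5 e4) = ?R e5 e4 \<otimes>\<^bsub>M\<^esub> (?p e1 e5 \<otimes>\<^bsub>M\<^esub> ?r e1 e4)"
    by (rule M.triple_inverse_one[OF b8[symmetric] i54, symmetric]; fact cls)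
  have a5: "?p e1 e3 \<otimes>\<^bsub>M\<^esub> (?r e1 e6 \<otimes>\<^bsub>M\<^esub> ?r e3 e6) = ?r e3 e6 \<otimes>\<^bsub>M\<^esub> (?r e1 e6 \<otimes>\<^bsub>M\<^esub> ?p e1 e3)"
    by (rule relation_p_r; fact F)
  have a6: "?p e1 e3 \<otimes>\<^bsub>M\<^esub> (?p e1 e5 \<otimes>\<^bsub>M\<^esub> ?p e3 e5) = ?p e3 e5 \<otimes>\<^bsub>M\<^esub> (?p e1 e5 \<otimes>\<^bsub>M\<^esub> ?p e1 e3)"
    by (rule oqa_yang_baxter[OF oqa]; fact F)
  have a7: "?q e2 e4 \<otimes>\<^bsub>M\<^esub> (?q e2 e6 \<otimes>\<^bsub>M\<^esub> ?q e4 e6) = ?q e4 e6 \<otimes>\<^bsub>M\<^esub> (?q e2 e6 \<otimes>\<^bsub>M\<^esub> ?q e2 e4)"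
    by (rule oqa_yang_baxter[OF oqa']; fact F)
  have a8: "?r e1 e4 \<otimes>\<^bsub>M\<^esub> (?r e1 e6 \<otimes>\<^bsub>M\<^esub> ?q e4 e6) = ?q e4 e6 \<otimes>\<^bsub>M\<^esub> (?r e1 e6 \<otimes>\<^bsub>M\<^esub> ?r e1 e4)"
    by (rule relation_r_p'; fact F)
  show ?thesis
    unfolding glue_def
    by (rule M.yang_baxter_word; (fact cls | fact a1 a2 a3 a4 a5 a6 a7 a8 | (rule product_lift_elements_commute; fact F)))
qed

end

text \<open>Lets a sum known in a tensor product of algebras be factored anew with the
  multiplication of the opposite second factor.\<close>

lemma finsum_tensor_opposite:
  "finsum (tensor_alg K A (opposite B)) f I = finsum (tensor_alg K A B) f I"
  by (simp add: finsum_def tensor_alg_def tensor_opposite Let_def)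

section \<open>The glued tensor inside \<open>T \<otimes> T\<close>\<close>

context oqa_gluing
begin

text \<open>The slots are plain functions given by explicit pure tensors, so they serve both as maps
  into \<open>T \<otimes> T\<close> and as maps into \<open>T \<otimes> T\<^sup>o\<^sup>p\<close>,
  which has the same elements.\<close>

definition "slot1 x = tens K T T (tens K H H' x \<one>\<^bsub>H'\<^esub>) (tens K H H' \<one>\<^bsub>H\<^esub> \<one>\<^bsub>H'\<^esub>)"
definition "slot2 y = tens K T T (tens K H H' \<one>\<^bsub>H\<^esub> y) (tens K H H' \<one>\<^bsub>H\<^esub> \<one>\<^bsub>H'\<^esub>)"
definition "slot3 x = tens K T T (tens K H H' \<one>\<^bsub>H\<^esub> \<one>\<^bsub>H'\<^esub>) (tens K H H' x \<one>\<^bsub>H'\<^esub>)"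
definition "slot4 y = tens K T T (tens K H H' \<one>\<^bsub>H\<^esub> \<one>\<^bsub>H'\<^esub>) (tens K H H' \<one>\<^bsub>H\<^esub> y)"
lemmas slot_defs = slot1_def slot2_def slot3_def slot4_def

abbreviation "TT2 \<equiv> tensor_alg K T T"
abbreviation "t4 a b c d \<equiv> tens K T T (tens K H H' a b) (tens K H H' c d)"
abbreviation "\<alpha> \<equiv> glue TT2 slot1 slot2 slot3 slot4"
abbreviation "Dt \<equiv> tensor_map K H H' H H' D D'"
abbreviation "Ut \<equiv> tensor_map K H H' H H' U U'"

lemmas TTA = TT.unital_algebra_T

lemma slot_maps:
  "algebra_map K H TT2 slot1" "algebra_map K H' TT2 slot2" "algebra_map K H TT2 slot3" "algebra_map K H' TT2 slot4"
  using algebra_map_comp[OF HH'.embed_left TT.embed_left] algebra_map_comp[OF HH'.embed_right TT.embed_left]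
    algebra_map_comp[OF HH'.embed_left TT.embed_right] algebra_map_comp[OF HH'.embed_right TT.embed_right]
  unfolding slot_defs HH'.T_simps(4) .

lemmas slot_linear = slot_maps[THEN algebra_map_linear]

lemma slot_commuting:
  "commuting TT2 H H' slot1 slot4" "commuting TT2 H H slot1 slot3" "commuting TT2 H' H' slot2 slot4" "commuting TT2 H H' slot3 slot2"
  "commuting TT2 H H' slot1 slot2" "commuting TT2 H H' slot3 slot4"
  by (auto simp: commuting_def slot_defs)

lemma alpha_sum:
  assumes p: "tensor_expr K H H p Ip p1 p2" and p': "tensor_expr K H' H' p' Ip' p1' p2'"
    and r: "tensor_expr K H H' r Ir r1 r2" and R: "tensor_expr K H H' R IR R1 R2"
  shows "finsum TT2 (\<lambda>(k, i, j, n).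
      t4 (r1 k \<otimes>\<^bsub>H\<^esub> p1 i) (p1' j \<otimes>\<^bsub>H'\<^esub> R2 n) (p2 i \<otimes>\<^bsub>H\<^esub> R1 n) (r2 k \<otimes>\<^bsub>H'\<^esub> p2' j)) (Ir \<times> Ip \<times> Ip' \<times> IR) = \<alpha>"
proof -
  interpret M: ring TT2 by (rule TT.ring_T)
  note c = HH.tensor_expr_closed(1-3)[OF p] H'H'.tensor_expr_closed(1-3)[OF p']
    HH'.tensor_expr_closed(1-3)[OF r] HH'.tensor_expr_closed(1-3)[OF R]
  note l = slot_linear
  show ?thesis
    unfolding glue_def HH'.product_lift_expr[OF TTA l(1,4) r] HH.product_lift_expr[OF TTA l(1,3) p]
      H'H'.product_lift_expr[OF TTA l(2,4) p'] HH'.product_lift_expr[OF TTA l(3,2) R] using c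
    by (subst M.finsum_mult_finsum4; (intro TT.T.finsum_cong')?) (auto simp: slot_defs)
qed

lemma alpha_inv_sum:
  assumes P: "tensor_expr K H H P IP P1 P2" and P': "tensor_expr K H' H' P' IP' P1' P2'"
    and r: "tensor_expr K H H' r Ir r1 r2" and R: "tensor_expr K H H' R IR R1 R2"
  shows "finsum TT2 (\<lambda>(l, n, k, m).
      t4 (P1 l \<otimes>\<^bsub>H\<^esub> R1 n) (r2 k \<otimes>\<^bsub>H'\<^esub> P1' m) (r1 k \<otimes>\<^bsub>H\<^esub> P2 l) (P2' m \<otimes>\<^bsub>H'\<^esub> R2 n)) (IP \<times> IR \<times> Ir \<times> IP')
    = glue_inv TT2 slot1 slot2 slot3 slot4"
proof -
  interpret M: ring TT2 by (rule TT.ring_T)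
  note c = HH.tensor_expr_closed(1-3)[OF P] H'H'.tensor_expr_closed(1-3)[OF P']
    HH'.tensor_expr_closed(1-3)[OF r] HH'.tensor_expr_closed(1-3)[OF R]
  note l = slot_linear
  show ?thesis
    unfolding glue_inv_def HH'.product_lift_expr[OF TTA l(1,4) R] HH.product_lift_expr[OF TTA l(1,3) P]
      H'H'.product_lift_expr[OF TTA l(2,4) P'] HH'.product_lift_expr[OF TTA l(3,2) r] using c
    by (subst M.finsum_mult_finsum4_swap; (intro TT.T.finsum_cong')?) (auto simp: slot_defs)
qed

lemma alpha_units: "\<alpha> \<in> Units TT2" "inv\<^bsub>TT2\<^esub> \<alpha> = glue_inv TT2 slot1 slot2 slot3 slot4"
proof -
  interpret M: ring TT2 by (rule TT.ring_T)
  note g = glue_inverse[OF TTA slot_maps slot_commuting(1-4)]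
  show "inv\<^bsub>TT2\<^esub> \<alpha> = glue_inv TT2 slot1 slot2 slot3 slot4" by (rule M.inv_char[OF g])
  show "\<alpha> \<in> Units TT2" unfolding Units_def using g by blast
qed

lemma Dt: "Dt \<in> algebra_auto K T" and Ut: "Ut \<in> algebra_auto K T"
  by (intro tensor_map_auto H H' oqaD(3,4)[OF oqa] oqaD(3,4)[OF oqa'])+

lemma Dt_Ut_commute: "commute_on (carrier T) Dt Ut"
  unfolding commute_on_def
proof
  fix t assume t: "t \<in> carrier T"
  show "Dt (Ut t) = Ut (Dt t)"
    unfolding tensor_map_comp[OF H H' Ul Ul' Dl Dl' t] tensor_map_comp[OF H H' Dl Dl' Ul Ul' t]
    using oqaD(5)[OF oqa] oqaD(5)[OF oqa'] t
    by (intro tensor_map_cong H H' linear_map_comp[OF Ul Dl] linear_map_comp[OF Ul' Dl']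
        linear_map_comp[OF Dl Ul] linear_map_comp[OF Dl' Ul']) (auto simp: commute_on_def)
qed

text \<open>Acting on \<alpha> twists the four slots, and twisting the slots is the same as twisting
  the tensors placed in them. Keeping the automorphisms general serves \<open>Dt\<close> and
  \<open>Ut\<close> at once.\<close>

lemma alpha_invariant:
  assumes f: "f \<in> algebra_auto K H" and g: "g \<in> algebra_auto K H'"
    and "tensor_map K H H H H f f p = p" "tensor_map K H' H' H' H' g g p' = p'"
      "tensor_map K H H' H H' f g r = r"
  shows "tensor_map K T T T T (tensor_map K H H' H H' f g) (tensor_map K H H' H H' f g) \<alpha> = \<alpha>"
proof -
  note fm = algebra_auto_map[OF f] and gm = algebra_auto_map[OF g]
  note fl = algebra_map_linear[OF fm] and gl = algebra_map_linear[OF gm]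
  let ?h = "tensor_map K H H' H H' f g"
  note hm = tensor_map_algebra_map[OF H H' H H' fm gm]
  note hl = algebra_map_linear[OF hm]
  have R: "tensor_map K H H' H H' f g R = R" by (intro tensor_map_inv H H' f g r_Units assms)
  note v = tensor_map_tens[OF TA TA TA TA hl hl] tensor_map_tens[OF H H' H H' fl gl]
    algebra_map_one[OF fm] algebra_map_one[OF gm] linear_map_closed[OF fl] linear_map_closed[OF gl]
  note s = slot_linear
  note sf = linear_map_comp[OF fl s(1)] linear_map_comp[OF gl s(2)] linear_map_comp[OF fl s(3)] linear_map_comp[OF gl s(4)]
  have "tensor_map K T T T T ?h ?h \<alpha> = glue TT2 (\<lambda>x. slot1 (f x)) (\<lambda>x. slot2 (g x)) (\<lambda>x. slot3 (f x)) (\<lambda>x. slot4 (g x))"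
    by (rule glue_image[OF TTA TTA s sf tensor_map_algebra_map[OF TA TA TA TA hm hm]])
      (simp_all add: slot_defs v)
  also have "\<dots> = \<alpha>"
    unfolding glue_def
    using product_lift_tensor_map[OF H H H H TTA fl fl s(1,3) elements(3)] product_lift_tensor_map[OF H' H' H' H' TTA gl gl s(2,4) elements(5)]
      product_lift_tensor_map[OF H H' H H' TTA fl gl s(1,4) elements(1)] product_lift_tensor_map[OF H H' H H' TTA fl gl s(3,2) elements(2)]
    by (simp add: assms R)
  finally show ?thesis .
qed

text \<open>Two copies of \<open>T\<close> in \<open>M\<close> provide four maps from
  \<open>H\<close> and \<open>H'\<close>, so \<alpha> placed in these copies is again a glued
  element. This reduces the Yang-Baxter equation for three copies of \<open>T\<close> to the one for
  six maps.\<close>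

lemma alpha_image:
  assumes M: "unital_algebra K M" and a: "algebra_map K T M a" and b: "algebra_map K T M b" and ab: "commuting M T T a b"
  shows "product_lift K T T M a b \<alpha> = glue M (\<lambda>x. a (tens K H H' x \<one>\<^bsub>H'\<^esub>)) (\<lambda>y. a (tens K H H' \<one>\<^bsub>H\<^esub> y))
     (\<lambda>x. b (tens K H H' x \<one>\<^bsub>H'\<^esub>)) (\<lambda>y. b (tens K H H' \<one>\<^bsub>H\<^esub> y))"
proof -
  interpret M: ring M by (rule unital_algebraD[OF M])
  note al = algebra_map_linear[OF a] and bl = algebra_map_linear[OF b]
  note il = algebra_map_linear[OF HH'.embed_left] and ir = algebra_map_linear[OF HH'.embed_right]
  note one = algebra_map_one[OF a, unfolded HH'.T_simps(4)] algebra_map_one[OF b, unfolded HH'.T_simps(4)]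
  show ?thesis
    by (rule glue_image[OF TTA M slot_linear linear_map_comp[OF il al] linear_map_comp[OF ir al]
          linear_map_comp[OF il bl] linear_map_comp[OF ir bl] TT.product_lift_algebra_map[OF M a b ab]])
      (simp_all add: slot_defs TT.product_lift_linear(2)[OF M al bl] one linear_map_closed[OF al] linear_map_closed[OF bl])
qed

lemma alpha_yang_baxter:
  assumes M: "unital_algebra K M"
    and a: "algebra_map K T M a" and b: "algebra_map K T M b" and c: "algebra_map K T M c"
    and ab: "commuting M T T a b" and ac: "commuting M T T a c" and bc: "commuting M T T b c"
  shows "product_lift K T T M a b \<alpha> \<otimes>\<^bsub>M\<^esub> (product_lift K T T M a c \<alpha> \<otimes>\<^bsub>M\<^esub> product_lift K T T M b c \<alpha>)
    = product_lift K T T M b c \<alpha> \<otimes>\<^bsub>M\<^esub> (product_lift K T T M a c \<alpha> \<otimes>\<^bsub>M\<^esub> product_lift K T T M a b \<alpha>)"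
proof -
  \<comment> \<open>Inside one copy of \<open>T\<close> the two tensor factors commute by
    themselves; between different copies the hypotheses apply.\<close>
  have c1: "commuting M H H' (\<lambda>x. f (tens K H H' x \<one>\<^bsub>H'\<^esub>)) (\<lambda>y. f (tens K H H' \<one>\<^bsub>H\<^esub> y))"
    if "algebra_map K T M f" for f
    by (auto simp: commuting_def algebra_map_mult[OF that, symmetric])
  have c2: "commuting M H H (\<lambda>x. f (tens K H H' x \<one>\<^bsub>H'\<^esub>)) (\<lambda>y. g (tens K H H' y \<one>\<^bsub>H'\<^esub>))"
    "commuting M H H' (\<lambda>x. f (tens K H H' x \<one>\<^bsub>H'\<^esub>)) (\<lambda>y. g (tens K H H' \<one>\<^bsub>H\<^esub> y))"
    "commuting M H' H (\<lambda>x. f (tens K H H' \<one>\<^bsub>H\<^esub> x)) (\<lambda>y. g (tens K H H' y \<one>\<^bsub>H'\<^esub>))"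
    "commuting M H' H' (\<lambda>x. f (tens K H H' \<one>\<^bsub>H\<^esub> x)) (\<lambda>y. g (tens K H H' \<one>\<^bsub>H\<^esub> y))"
    if "commuting M T T f g" for f g
    using that by (auto simp: commuting_def)
  note e = algebra_map_comp[OF HH'.embed_left] algebra_map_comp[OF HH'.embed_right]
  show ?thesis
    unfolding alpha_image[OF M a b ab] alpha_image[OF M a c ac] alpha_image[OF M b c bc]
    by (rule glue_yang_baxter[OF M e(1)[OF a] e(2)[OF a] e(1)[OF b] e(2)[OF b] e(1)[OF c] e(2)[OF c]])
      (fact c1[OF a] c1[OF b] c1[OF c] c2[OF ab] c2[OF ac] c2[OF bc])+
qed

text \<open>The return from placed tensors to the index form used in the definition, for every
  expression of \<alpha>: the target is the triple tensor product itself, and the maps are its three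
  embeddings of \<open>T\<close>.\<close>

lemma alpha_yang_baxter_sums:
  assumes "tensor_expr K T T \<alpha> I x y"
  shows "finsum (tensor_alg K TT2 T) (\<lambda>(i, j, k).
      tens K TT2 T (tens K T T (x i \<otimes>\<^bsub>T\<^esub> x j) (y i \<otimes>\<^bsub>T\<^esub> x k)) (y j \<otimes>\<^bsub>T\<^esub> y k)) (I \<times> I \<times> I)
    = finsum (tensor_alg K TT2 T) (\<lambda>(i, j, k).
      tens K TT2 T (tens K T T (x j \<otimes>\<^bsub>T\<^esub> x i) (x k \<otimes>\<^bsub>T\<^esub> y i)) (y k \<otimes>\<^bsub>T\<^esub> y j)) (I \<times> I \<times> I)"
proof -
  interpret S: tensor_pair K TT2 T using TTA TA by unfold_locales
  interpret S: ring S.T by (rule S.ring_T)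
  interpret M: ring TT2 by (rule TT.ring_T)
  note e = TT.tensor_expr_closed(1-3)[OF assms]
  let ?a = "\<lambda>x. tens K TT2 T (tens K T T x \<one>\<^bsub>T\<^esub>) \<one>\<^bsub>T\<^esub>"
  let ?b = "\<lambda>x. tens K TT2 T (tens K T T \<one>\<^bsub>T\<^esub> x) \<one>\<^bsub>T\<^esub>"
  let ?c = "\<lambda>x. tens K TT2 T \<one>\<^bsub>TT2\<^esub> x"
  have m: "algebra_map K T S.T ?a" "algebra_map K T S.T ?b" "algebra_map K T S.T ?c"
    by (rule algebra_map_comp[OF TT.embed_left S.embed_left] algebra_map_comp[OF TT.embed_right S.embed_left]
        S.embed_right)+
  have c: "commuting S.T T T ?a ?b" "commuting S.T T T ?a ?c" "commuting S.T T T ?b ?c"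
    by (auto simp: commuting_def)
  have t3: "tens K TT2 T (tens K T T u v) w = ?a u \<otimes>\<^bsub>S.T\<^esub> ?b v \<otimes>\<^bsub>S.T\<^esub> ?c w"
    if "u \<in> carrier T" "v \<in> carrier T" "w \<in> carrier T" for u v w
    using that by simp
  note A = S.unital_algebra_T
  have "finsum S.T (\<lambda>(i, j, k).
      tens K TT2 T (tens K T T (x i \<otimes>\<^bsub>T\<^esub> x j) (y i \<otimes>\<^bsub>T\<^esub> x k)) (y j \<otimes>\<^bsub>T\<^esub> y k)) (I \<times> I \<times> I)
    = product_lift K T T S.T ?a ?b \<alpha> \<otimes>\<^bsub>S.T\<^esub> (product_lift K T T S.T ?a ?c \<alpha> \<otimes>\<^bsub>S.T\<^esub> product_lift K T T S.T ?b ?c \<alpha>)"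
    unfolding triple_sum_left[OF TA TA TA A m c assms assms assms, symmetric]
    using e by (intro S.T.finsum_cong') (auto intro!: t3 S.m_closed)
  also note alpha_yang_baxter[OF A m c]
  also have "product_lift K T T S.T ?b ?c \<alpha> \<otimes>\<^bsub>S.T\<^esub> (product_lift K T T S.T ?a ?c \<alpha> \<otimes>\<^bsub>S.T\<^esub> product_lift K T T S.T ?a ?b \<alpha>)
    = finsum S.T (\<lambda>(i, j, k).
      tens K TT2 T (tens K T T (x j \<otimes>\<^bsub>T\<^esub> x i) (x k \<otimes>\<^bsub>T\<^esub> y i)) (y k \<otimes>\<^bsub>T\<^esub> y j)) (I \<times> I \<times> I)"
    unfolding triple_sum_right[OF TA TA TA A m c assms assms assms, symmetric]
    using e by (intro S.T.finsum_cong') (auto intro!: t3[symmetric] S.m_closed)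
  finally show ?thesis .
qed

lemma alpha_opposite_inverse:
  defines "Top \<equiv> tensor_alg K T (opposite T)"
  defines "DR \<equiv> tensor_map K T T T T Dt id (inv\<^bsub>TT2\<^esub> \<alpha>)" and "Ur \<equiv> tensor_map K T T T T id Ut \<alpha>"
  shows "DR \<otimes>\<^bsub>Top\<^esub> Ur = \<one>\<^bsub>Top\<^esub>" "Ur \<otimes>\<^bsub>Top\<^esub> DR = \<one>\<^bsub>Top\<^esub>"
proof -
  interpret O: tensor_pair K T "opposite T" using TA unital_algebra_opposite[OF TA] by unfold_locales
  interpret M: ring Top unfolding Top_def by (rule O.ring_T)
  have M: "unital_algebra K Top" unfolding Top_def by (rule O.unital_algebra_T)
  note tens_op = O.mult_tens[unfolded tensor_opposite opposite_simps, folded Top_def]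
  have tens_in: "tens K T T s t \<in> carrier Top" if "s \<in> carrier T" "t \<in> carrier T" for s t
    using that O.tens_in_T[unfolded tensor_opposite opposite_simps, folded Top_def] by blast
  have m1: "algebra_map K H Top slot1" and m2: "algebra_map K H' Top slot2"
    using algebra_map_comp[OF HH'.embed_left O.embed_left] algebra_map_comp[OF HH'.embed_right O.embed_left]
    unfolding slot_defs HH'.T_simps(4)[symmetric] Top_def tensor_opposite opposite_simps by auto
  \<comment> \<open>The second copy of \<open>T\<close> is opposite in \<open>Top\<close>, so the
    unchanged functions \<open>slot3\<close> and \<open>slot4\<close> are algebra maps out of the
    opposite algebras.\<close>
  have m3: "algebra_map K (opposite H) Top slot3" and m4: "algebra_map K (opposite H') Top slot4"
    using algebra_map_comp[OF algebra_map_opposite[OF HH'.embed_left] O.embed_right]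
      algebra_map_comp[OF algebra_map_opposite[OF HH'.embed_right] O.embed_right]
    unfolding slot_defs HH'.T_simps(4)[symmetric] Top_def tensor_opposite opposite_simps by auto
  have c: "commuting Top H H slot1 slot3" "commuting Top H H' slot1 slot4" "commuting Top H H' slot3 slot2" "commuting Top H' H' slot2 slot4"
    by (auto simp: commuting_def slot_defs tens_op)
  note l1 = algebra_map_linear[OF m1] and l2 = algebra_map_linear[OF m2]
    and l3 = algebra_map_linear[OF m3, unfolded linear_map_opposite]
    and l4 = algebra_map_linear[OF m4, unfolded linear_map_opposite]
  let ?P = "product_lift K H H Top (\<lambda>x. slot1 (D x)) slot3 P" and ?p = "product_lift K H H Top slot1 (\<lambda>x. slot3 (U x)) p"
  let ?P' = "product_lift K H' H' Top (\<lambda>x. slot2 (D' x)) slot4 P'" and ?p' = "product_lift K H' H' Top slot2 (\<lambda>x. slot4 (U' x)) p'"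
  let ?R14 = "product_lift K H H' Top (\<lambda>x. slot1 (D x)) slot4 R" and ?r14 = "product_lift K H H' Top slot1 (\<lambda>x. slot4 (U' x)) r"
  let ?r32 = "product_lift K H H' Top slot3 (\<lambda>x. slot2 (D' x)) r" and ?R32 = "product_lift K H H' Top (\<lambda>x. slot3 (U x)) slot2 R"
  obtain Ip :: "nat set" and p1 p2 where p: "tensor_expr K H H p Ip p1 p2"
    using HH.ex_tensor_expr[OF elements(3)] by blast
  obtain IP :: "nat set" and P1 P2 where P: "tensor_expr K H H P IP P1 P2"
    using HH.ex_tensor_expr[OF elements(4)] by blast
  obtain Ip' :: "nat set" and p1' p2' where p': "tensor_expr K H' H' p' Ip' p1' p2'"
    using H'H'.ex_tensor_expr[OF elements(5)] by blast
  obtain IP' :: "nat set" and P1' P2' where P': "tensor_expr K H' H' P' IP' P1' P2'"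
    using H'H'.ex_tensor_expr[OF elements(6)] by blast
  obtain Ir :: "nat set" and r1 r2 and IR :: "nat set" and R1 R2
    where r: "tensor_expr K H H' r Ir r1 r2" and R: "tensor_expr K H H' R IR R1 R2" by (rule ex_exprs)
  note ce = HH.tensor_expr_closed(1-3)[OF p] H'H'.tensor_expr_closed(1-3)[OF p']
    HH.tensor_expr_closed(1-3)[OF P] H'H'.tensor_expr_closed(1-3)[OF P']
    HH'.tensor_expr_closed(1-3)[OF r] HH'.tensor_expr_closed(1-3)[OF R]
  note cDU = linear_map_closed[OF Dl] linear_map_closed[OF Dl'] linear_map_closed[OF Ul] linear_map_closed[OF Ul']
  note lD = linear_map_comp[OF Dl l1] linear_map_comp[OF Dl' l2] and lU = linear_map_comp[OF Ul l3] linear_map_comp[OF Ul' l4]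
  note mDU = algebra_map_mult[OF D] algebra_map_mult[OF D'] algebra_map_mult[OF U] algebra_map_mult[OF U']
  note Dtl = algebra_map_linear[OF algebra_auto_map[OF Dt]] and Utl = algebra_map_linear[OF algebra_auto_map[OF Ut]]
  note vD = tensor_map_tens[OF TA TA TA TA Dtl linear_map_id(1)] tensor_map_tens[OF H H' H H' Dl Dl']
  note vU = tensor_map_tens[OF TA TA TA TA linear_map_id(1) Utl] tensor_map_tens[OF H H' H H' Ul Ul']
  have fs: "finsum TT2 f I = finsum Top f I" for f :: "nat \<times> nat \<times> nat \<times> nat \<Rightarrow> _" and I
    by (simp add: Top_def finsum_tensor_opposite)
  have "DR = finsum TT2 (\<lambda>i. tensor_map K T T T T Dt id (case i of (l, n, k, m) \<Rightarrow>
      t4 (P1 l \<otimes>\<^bsub>H\<^esub> R1 n) (r2 k \<otimes>\<^bsub>H'\<^esub> P1' m) (r1 k \<otimes>\<^bsub>H\<^esub> P2 l) (P2' m \<otimes>\<^bsub>H'\<^esub> R2 n))) (IP \<times> IR \<times> Ir \<times> IP')"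
    unfolding DR_def alpha_units(2) alpha_inv_sum[OF P P' r R, symmetric]
    by (rule linear_map_finsum[OF TT.abelian_group_T TT.abelian_group_T tensor_map_linear[OF TA TA TA TA Dtl linear_map_id(1)]])
      (use ce in auto)
  \<comment> \<open>Products in slots 3 and 4 are reversed, so the slots require \<open>P\<close>
    first and \<open>P'\<close> last. \<open>R\<close> and \<open>r\<close> lie in disjoint slots
    and may stand in either order; the chosen one makes neighbours cancel against the factors of
    \<open>Ur\<close>. \<open>Dt\<close> acts on slots 1 and 2, hence \<open>D\<close> on
    \<open>P\<close> and \<open>R\<close>, and \<open>D'\<close> on \<open>r\<close> and
    \<open>P'\<close>.\<close>
  also have "\<dots> = ?P \<otimes>\<^bsub>Top\<^esub> (?R14 \<otimes>\<^bsub>Top\<^esub> (?r32 \<otimes>\<^bsub>Top\<^esub> ?P'))"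
    unfolding fs HH.product_lift_expr[OF M lD(1) l3 P] HH'.product_lift_expr[OF M lD(1) l4 R] HH'.product_lift_expr[OF M l3 lD(2) r]
      H'H'.product_lift_expr[OF M lD(2) l4 P'] using ce
    by (subst M.finsum_mult_finsum4; (intro M.finsum_cong')?) (auto simp: slot_defs vD mDU cDU tens_op tens_in)
  finally have DR: "DR = ?P \<otimes>\<^bsub>Top\<^esub> (?R14 \<otimes>\<^bsub>Top\<^esub> (?r32 \<otimes>\<^bsub>Top\<^esub> ?P'))" .
  have "Ur = finsum TT2 (\<lambda>i. tensor_map K T T T T id Ut (case i of (k, i, j, n) \<Rightarrow>
      t4 (r1 k \<otimes>\<^bsub>H\<^esub> p1 i) (p1' j \<otimes>\<^bsub>H'\<^esub> R2 n) (p2 i \<otimes>\<^bsub>H\<^esub> R1 n) (r2 k \<otimes>\<^bsub>H'\<^esub> p2' j))) (Ir \<times> Ip \<times> Ip' \<times> IR)"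
    unfolding Ur_def alpha_sum[OF p p' r R, symmetric]
    by (rule linear_map_finsum[OF TT.abelian_group_T TT.abelian_group_T tensor_map_linear[OF TA TA TA TA linear_map_id(1) Utl]])
      (use ce in auto)
  \<comment> \<open>By the same reversal the slots require \<open>p'\<close> first and
    \<open>p\<close> last. \<open>Ut\<close> acts on slots 3 and 4, hence \<open>U\<close> on
    \<open>R\<close> and \<open>p\<close>, and \<open>U'\<close> on \<open>r\<close> and
    \<open>p'\<close>.\<close>
  also have "\<dots> = ?p' \<otimes>\<^bsub>Top\<^esub> (?R32 \<otimes>\<^bsub>Top\<^esub> (?r14 \<otimes>\<^bsub>Top\<^esub> ?p))"
    unfolding fs HH.product_lift_expr[OF M l1 lU(1) p] HH'.product_lift_expr[OF M lU(1) l2 R] HH'.product_lift_expr[OF M l1 lU(2) r]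
      H'H'.product_lift_expr[OF M l2 lU(2) p'] using ce
    by (subst M.finsum_mult_finsum4_swap; (intro M.finsum_cong')?) (auto simp: slot_defs vU mDU cDU tens_op tens_in)
  finally have Ur: "Ur = ?p' \<otimes>\<^bsub>Top\<^esub> (?R32 \<otimes>\<^bsub>Top\<^esub> (?r14 \<otimes>\<^bsub>Top\<^esub> ?p))" .
  note i = oqa_inverse[OF oqa M m1 m3 c(1)] oqa_inverse[OF oqa' M m2 m4 c(4)]
    r_inverse_D[OF M m1 m4 c(2)] r_inverse_U[OF M m3 m2 c(3)]
  note cl = product_lift_closed[OF H H M] product_lift_closed[OF H H' M] product_lift_closed[OF H' H' M] lD lU l1 l2 l3 l4
  show "DR \<otimes>\<^bsub>Top\<^esub> Ur = \<one>\<^bsub>Top\<^esub>" "Ur \<otimes>\<^bsub>Top\<^esub> DR = \<one>\<^bsub>Top\<^esub>"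
    unfolding DR Ur
    by (simp_all add: cl M.m_assoc i M.cancel_left[OF i(1)] M.cancel_left[OF i(2)]
      M.cancel_left[OF i(3)] M.cancel_left[OF i(4)] M.cancel_left[OF i(5)] M.cancel_left[OF i(6)]
      M.cancel_left[OF i(7)] M.cancel_left[OF i(8)])
qed

theorem alpha_oqa: "oriented_quantum_algebra K T \<alpha> Dt Ut"
  unfolding oriented_quantum_algebra_def Let_def
  using TA alpha_units(1) Dt Ut Dt_Ut_commute alpha_opposite_inverse alpha_yang_baxter_sums
    alpha_invariant[OF oqaD(3)[OF oqa] oqaD(3)[OF oqa'] oqaD(6)[OF oqa] oqaD(6)[OF oqa'] r_invariant(1)]
    alpha_invariant[OF oqaD(4)[OF oqa] oqaD(4)[OF oqa'] oqaD(7)[OF oqa] oqaD(7)[OF oqa'] r_invariant(2)]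
  by blast

end

theorem theorem3p6:
  fixes K :: "('k, 'l) ring_scheme"
    and H :: "('k, 'a) module" and H' :: "('k, 'b) module"
    and p P :: "(('a \<times> 'a) \<Rightarrow>\<^sub>0 int) set" and p' P' :: "(('b \<times> 'b) \<Rightarrow>\<^sub>0 int) set"
    and r R :: "(('a \<times> 'b) \<Rightarrow>\<^sub>0 int) set"
    and D U :: "'a \<Rightarrow> 'a" and D' U' :: "'b \<Rightarrow> 'b"
    and Ip :: "'i1 set" and p1 p2 :: "'i1 \<Rightarrow> 'a"
    and Ip' :: "'i2 set" and p1' p2' :: "'i2 \<Rightarrow> 'b"
    and IP :: "'i3 set" and P1 P2 :: "'i3 \<Rightarrow> 'a"
    and IP' :: "'i4 set" and P1' P2' :: "'i4 \<Rightarrow> 'b"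
    and Ir :: "'i5 set" and r1 :: "'i5 \<Rightarrow> 'a" and r2 :: "'i5 \<Rightarrow> 'b"
    and IR :: "'i6 set" and R1 :: "'i6 \<Rightarrow> 'a" and R2 :: "'i6 \<Rightarrow> 'b"
    and \<alpha> :: "((('a \<times> 'b) \<Rightarrow>\<^sub>0 int) set \<times> (('a \<times> 'b) \<Rightarrow>\<^sub>0 int) set \<Rightarrow>\<^sub>0 int) set"
  assumes T: "T = tensor_alg K H H'"
    and t4: "t4 = (\<lambda>a b c d. tens K (tensor_alg K H H') (tensor_alg K H H')
                 (tens K H H' a b) (tens K H H' c d))"
    and "oriented_quantum_algebra K H p D U"
    and "oriented_quantum_algebra K H' p' D' U'"
    and "oqa_nonuple K H H' p p' r D U D' U'"
    and "P = inv\<^bsub>tensor_alg K H H\<^esub> p"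
    and "P' = inv\<^bsub>tensor_alg K H' H'\<^esub> p'"
    and "R = inv\<^bsub>T\<^esub> r"
    and "tensor_expr K H H p Ip p1 p2"
    and "tensor_expr K H' H' p' Ip' p1' p2'"
    and "tensor_expr K H H P IP P1 P2"
    and "tensor_expr K H' H' P' IP' P1' P2'"
    and "tensor_expr K H H' r Ir r1 r2"
    and "tensor_expr K H H' R IR R1 R2"
    and \<alpha>: "\<alpha> = finsum (tensor_alg K T T) (\<lambda>(k, i, j, n).
              t4 (r1 k \<otimes>\<^bsub>H\<^esub> p1 i) (p1' j \<otimes>\<^bsub>H'\<^esub> R2 n)
                (p2 i \<otimes>\<^bsub>H\<^esub> R1 n) (r2 k \<otimes>\<^bsub>H'\<^esub> p2' j))
            (Ir \<times> Ip \<times> Ip' \<times> IR)"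
  shows "oriented_quantum_algebra K T \<alpha>
           (tensor_map K H H' H H' D D') (tensor_map K H H' H H' U U') \<and>
         inv\<^bsub>tensor_alg K T T\<^esub> \<alpha> = finsum (tensor_alg K T T) (\<lambda>(l, n, k, m).
              t4 (P1 l \<otimes>\<^bsub>H\<^esub> R1 n) (r2 k \<otimes>\<^bsub>H'\<^esub> P1' m)
                (r1 k \<otimes>\<^bsub>H\<^esub> P2 l) (P2' m \<otimes>\<^bsub>H'\<^esub> R2 n))
            (IP \<times> IR \<times> Ir \<times> IP')"
proof -
  interpret oqa_gluing K H H' p p' r D U D' U'
    using assms(3-5) by unfold_locales
  note e = assms(9-14)[unfolded assms(6-8) T]
  \<comment> \<open>The given expressions may have index sets of any type; identifying their sum
    with the intrinsic element \<open>glue\<close> removes the dependence on them.\<close>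
  have "\<alpha> = glue (tensor_alg K T T) slot1 slot2 slot3 slot4"
    unfolding \<alpha> t4 T by (rule alpha_sum[OF e(1,2,5,6)])
  then show ?thesis
    using alpha_oqa alpha_units(2) alpha_inv_sum[OF e(3-6)] unfolding t4 T by simp
qed

end
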